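(* Let $0\le S<T$. For $u_0\in\bigcap_{k=0}^\infty H^k(\mathbb{R})$ let $u(t,x)$ denote the solution of $$i\partial_t u(t,x)+\partial_x^2u(t,x)=0,\quad t>0,\ x\in\mathbb{R},\qquad u(0,\cdot)=u_0 .$$ For sets $E_1,E_2\subset\mathbb{R}$ and a constant $C>0$ consider the inequality $$\|u_0\|_{L^2(\mathbb{R})}^2\le C\bigg(\Big\|\Big\{\sup_{x\in E_1\cap[k,k+1]}|u(S,x)|\Big\}_{k\in\mathbb{Z}}\Big\|_{l^2(\mathbb{Z})}^2+\Big\|\Big\{\sup_{x\in E_2\cap[k,k+1]}|u(T,x)|\Big\}_{k\in\mathbb{Z}}\Big\|_{l^2(\mathbb{Z})}^2\bigg).\tag{$*$}$$ (i) There exist $\epsilon>0$ and $C>0$ such that, if $E_1^c=\mathbb{R}\setminus E_1$ and $E_2^c=\mathbb{R}\setminus E_2$ are $\epsilon$-thin with respect to $\rho(x)=\min(1,|x|^{-1})$, then $( * )$ holds with this $C$ for every $u_0\in\bigcap_{k=0}^\infty H^k(\mathbb{R})$. (ii) For every $\alpha\in(0,1)$ there exist $\alpha$-thick subsets $E_1,E_2\subset\mathbb{R}$ for which $( * )$ does not hold; that is, there is no constant $C>0$ such that $( * )$ holds for every $u_0\in\bigcap_{k=0}^\infty H^k(\mathbb{R})$.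
   Context: For $u_0\in\bigcap_{k}H^k(\mathbb{R})$, $u(t,\cdot)=e^{it\partial_x^2}u_0$, taken to be its continuous representative in $x$; a supremum over the empty set is $0$, and the right-hand side of $( * )$ may be $+\infty$. $\epsilon$-thin: for $\epsilon\in(0,1]$, a (Lebesgue measurable) set $E\subset\mathbb{R}$ is $\epsilon$-thin with respect to $\rho$ if $|E\cap B(x,\rho(x))|\le\epsilon\,\rho(x)$ for all $x\in\mathbb{R}$, where $|\cdot|$ is Lebesgue measure, $B(x,r)=\{y\in\mathbb{R}:|y-x|<r\}$, and $\rho(x)=\min(1,|x|^{-1})$ (so $\rho(0)=1$). Hausdorff content: for $\alpha>0$ and $E\subset\mathbb{R}$, $C^{\alpha}_{\mathcal{H}}(E)=\inf\{\sum_j r_j^{\alpha}: E\subset\bigcup_j B(x_j,r_j)\}$, the infimum being over countable covers by balls. $\alpha$-thick: for $\alpha\in(0,1]$, a set $E\subset\mathbb{R}$ is $\alpha$-thick if there are $L>0$ and $\gamma>0$ such that $C^{\alpha}_{\mathcal{H}}(E\cap[x,x+L])>\gamma L$ for all $x\in\mathbb{R}$. *)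

theory Defs
  imports "HOL-Analysis.Analysis"
begin

definition L2_norm_sq :: "(real \<Rightarrow> complex) \<Rightarrow> ennreal" where
  "L2_norm_sq f = (\<integral>\<^sup>+ x. ennreal ((cmod (f x))\<^sup>2) \<partial>lebesgue)"

definition L2 :: "(real \<Rightarrow> complex) \<Rightarrow> bool" where
  "L2 f \<longleftrightarrow> f \<in> borel_measurable lebesgue \<and> L2_norm_sq f < \<infinity>"

definition l2_norm_sq :: "(int \<Rightarrow> ennreal) \<Rightarrow> ennreal" where
  "l2_norm_sq a = (\<Sum>\<^sub>\<infinity>k. (a k)\<^sup>2)"

text \<open>The Fourier transform on the whole of $L^2$, in the unitary normalisation, is the limit in
  $L^2$ of the truncated integrals (Plancherel). It is determined only up to a null set, hence the
  choice operator; everything below is insensitive to the representative chosen.\<close>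

definition trunc_fourier :: "real \<Rightarrow> (real \<Rightarrow> complex) \<Rightarrow> real \<Rightarrow> complex" where
  "trunc_fourier R f \<xi> =
     complex_of_real (1 / sqrt (2 * pi)) * (LINT x:{-R..R}|lebesgue. cis (- (x * \<xi>)) * f x)"

definition L2_fourier :: "(real \<Rightarrow> complex) \<Rightarrow> real \<Rightarrow> complex" where
  "L2_fourier f =
     (SOME g. L2 g \<and> ((\<lambda>R. L2_norm_sq (\<lambda>\<xi>. g \<xi> - trunc_fourier R f \<xi>)) \<longlongrightarrow> 0) at_top)"

definition L2_inverse_fourier :: "(real \<Rightarrow> complex) \<Rightarrow> real \<Rightarrow> complex" where
  "L2_inverse_fourier g = (\<lambda>x. L2_fourier g (- x))"

definition sobolev :: "nat \<Rightarrow> (real \<Rightarrow> complex) set" where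
  "sobolev k = {f. L2 f \<and>
     (\<integral>\<^sup>+ \<xi>. ennreal ((1 + \<xi>\<^sup>2) ^ k * (cmod (L2_fourier f \<xi>))\<^sup>2) \<partial>lebesgue) < \<infinity>}"

text \<open>The propagator $e^{it\partial_x^2}$ on $L^2$ is the Fourier multiplier with symbol
  $e^{-it\xi^2}$. For data in every $H^k$ its value has exactly one continuous representative.\<close>

definition schrodinger_propagator :: "real \<Rightarrow> (real \<Rightarrow> complex) \<Rightarrow> real \<Rightarrow> complex" where
  "schrodinger_propagator t f = L2_inverse_fourier (\<lambda>\<xi>. cis (- (t * \<xi>\<^sup>2)) * L2_fourier f \<xi>)"

definition continuous_representative :: "(real \<Rightarrow> complex) \<Rightarrow> real \<Rightarrow> complex" where
  "continuous_representative f =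
     (THE g. continuous_on UNIV g \<and> (AE x in lebesgue. g x = f x))"

definition schrodinger_solution :: "(real \<Rightarrow> complex) \<Rightarrow> real \<Rightarrow> real \<Rightarrow> complex" where
  "schrodinger_solution u0 t = continuous_representative (schrodinger_propagator t u0)"

text \<open>In \<^typ>\<open>ennreal\<close> the supremum over the empty set is 0.\<close>

definition local_sup :: "real set \<Rightarrow> (real \<Rightarrow> complex) \<Rightarrow> int \<Rightarrow> ennreal" where
  "local_sup E f k = (SUP x \<in> E \<inter> {of_int k .. of_int k + 1}. ennreal (cmod (f x)))"

definition observability_ineq ::
    "real \<Rightarrow> real \<Rightarrow> real set \<Rightarrow> real set \<Rightarrow> real \<Rightarrow> (real \<Rightarrow> complex) \<Rightarrow> bool" where
  "observability_ineq S T E1 E2 C u0 \<longleftrightarrow>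
     L2_norm_sq u0 \<le> ennreal C *
       (l2_norm_sq (local_sup E1 (schrodinger_solution u0 S)) +
        l2_norm_sq (local_sup E2 (schrodinger_solution u0 T)))"

text \<open>The case distinction is needed because \<open>1 / 0 = 0\<close>.\<close>

definition rho :: "real \<Rightarrow> real" where
  "rho x = (if x = 0 then 1 else min 1 (1 / \<bar>x\<bar>))"

definition thin :: "(real \<Rightarrow> real) \<Rightarrow> real \<Rightarrow> real set \<Rightarrow> bool" where
  "thin \<rho> \<epsilon> E \<longleftrightarrow> E \<in> sets lebesgue \<and>
     (\<forall>x. emeasure lebesgue (E \<inter> ball x (\<rho> x)) \<le> ennreal (\<epsilon> * \<rho> x))"

text \<open>Covers are indexed by the natural numbers; finite covers are included since a ball of
  radius 0 is empty and contributes \<open>0 powr \<alpha> = 0\<close> to the sum.\<close>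

definition hausdorff_content :: "real \<Rightarrow> real set \<Rightarrow> ennreal" where
  "hausdorff_content \<alpha> E =
     (INF (c, r) \<in> {(c :: nat \<Rightarrow> real, r :: nat \<Rightarrow> real).
                      (\<forall>j. 0 \<le> r j) \<and> E \<subseteq> (\<Union>j. ball (c j) (r j))}.
        (\<Sum>j. ennreal (r j powr \<alpha>)))"

definition thick :: "real \<Rightarrow> real set \<Rightarrow> bool" where
  "thick \<alpha> E \<longleftrightarrow>
     (\<exists>L>0. \<exists>\<gamma>>0. \<forall>x. hausdorff_content \<alpha> (E \<inter> {x..x + L}) > ennreal (\<gamma> * L))"

end

theory Submission
  imports Defs "HOL-Probability.Probability" "HOL-Library.Discrete_Functions"
begin

text \<open>For $\tau = T - S$ the evolution from time $S$ to time $T$ is, up to unimodular factors and scaling,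
  multiplication by the chirp $e^{ix^2/4\tau}$ followed by the Fourier transform. So $|u(S)|$ and $|u(T)|$ are
  the moduli of a function and of its rescaled Fourier transform.

  Part (i) is then the uncertainty principle of Shubin, Vakilian and Wolff. With $b = 2\tau$, the symbol identity
  $1 = x^2/(x^2 + b^2\xi^2) + b^2\xi^2/(x^2 + b^2\xi^2)$ and
  $a^2/(a^2 + \xi^2) = \int \frac{a}{2} e^{-a|s|} e^{-is\xi}\,ds$ bound $\|h\|^2$ by two quadratic forms, in
  $h$ and in its Fourier transform, with kernel $\frac{c|x|}{2} e^{-c|x||x-y|}$. This kernel lives at scale
  $\rho(x)$, so by Schur's test the part of each form with $x$ in a thin set is small and can be absorbed.
  Suprema over the cells $[k,k+1]$ dominate $L^2$ norms.

  For part (ii), four Gaussian packets are placed such that at both times the solution is bounded by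
  $|e^{iNx} - 1|$ times two Gaussians. It is small on a neighbourhood of the lattice $\frac{2\pi}{N}\mathbb{Z}$
  of width $N^{-1/\alpha} = o(N^{-1})$, which still has $\alpha$-content of order 1 in every cell. A single set that
  carries such a neighbourhood for each $N$ of a sequence in a long enough window serves as both $E_1$ and $E_2$.\<close>

section \<open>Complex Gaussian integrals\<close>

text \<open>In part (i) the obstacle is regularity. The state at time S is the transform of an
  integrable function but need not be integrable itself, and the chirp spoils the decay of its
  transform, whereas the kernel argument asks for integrability on both sides and pointwise
  inversion. So it is run on Gaussian windows exp(-z x^2) with complex z: the real part of z damps,
  the imaginary part is the chirp, and the damping is removed in L^2 at the end. Absorption succeeds
  because the weights in Schur's test let each form return only 3/16 of the norm. In part (ii) the
  zeros at both times must form the same lattice. Over time \<tau> a frequency gap N becomes a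
  distance d = 2 \<tau> N, and both pairs of packets at the later time then have zeros with spacing
  2 pi / N. The two lattices coincide if N d is a multiple of 2 pi and the position a of the first
  packet satisfies N a = pi modulo 2 pi. With \<sigma>^2 = 4 pi \<tau> and N = 2 pi n / \<sigma> one
  gets d = n \<sigma> and N d = 2 pi n^2, so every positive integer n is admissible, and the
  separation n \<sigma> is short compared with a dyadic window of length 2^n.\<close>

lemma has_vector_derivative_integral:
  fixes f f' :: "real \<Rightarrow> real \<Rightarrow> complex"
  assumes I: "open I" "convex I" "t0 \<in> I"
    and int: "\<And>t. t \<in> I \<Longrightarrow> integrable lborel (f t)"
    and der: "\<And>t x. t \<in> I \<Longrightarrow> ((\<lambda>t. f t x) has_vector_derivative f' t x) (at t)"
    and bd: "\<And>t x. t \<in> I \<Longrightarrow> norm (f' t x) \<le> B x"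
    and int': "integrable lborel (f' t0)"
    and B: "integrable lborel B"
  shows "((\<lambda>t. LINT x|lborel. f t x) has_vector_derivative (LINT x|lborel. f' t0 x)) (at t0)"
proof -
  \<comment> \<open>Differentiation under the integral sign: \<open>q\<close> is the normalised
    first-order remainder. It tends to 0 pointwise, and the mean value inequality on the convex set
    \<open>I\<close> bounds it by \<open>2 * B\<close>, so dominated convergence applies.\<close>
  define q where "q t x = (1 / norm (t - t0)) *\<^sub>R (f t x - (f t0 x + (t - t0) *\<^sub>R f' t0 x))" for t x
  have q0: "((\<lambda>t. q t x) \<longlongrightarrow> 0) (at t0)" for x
    using der[OF I(3), of x] by (simp add: has_vector_derivative_def has_derivative_at2 q_def)
  have qb: "norm (q t x) \<le> 2 * B x" if "t \<in> I" for t x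
  proof (cases "t = t0")
    case True
    have "0 \<le> B x" using bd[OF I(3), of x] norm_ge_zero order_trans by blast
    then show ?thesis by (simp add: q_def True)
  next
    case False
    have "closed_segment t0 t \<subseteq> I" using I that by (simp add: closed_segment_subset)
    moreover have "norm (f' s x - f' t0 x) \<le> 2 * B x" if "s \<in> I" for s
      using norm_triangle_ineq4[of "f' s x" "f' t0 x"] bd[OF that, of x] bd[OF I(3), of x] by linarith
    ultimately have "norm (f t x - f t0 x - (t - t0) *\<^sub>R f' t0 x) \<le> norm (t - t0) * (2 * B x)"
      using I der
      by (intro vector_differentiable_bound_linearization[where S=I])
        (auto intro: has_vector_derivative_at_within)
    moreover have "q t x = (1 / \<bar>t - t0\<bar>) *\<^sub>R (f t x - f t0 x - (t - t0) *\<^sub>R f' t0 x)"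
      by (simp add: q_def diff_diff_eq)
    ultimately show ?thesis using False by (simp add: divide_simps mult.commute)
  qed
  have q_int: "integrable lborel (q t)" if "t \<in> I" for t
    unfolding q_def using int[OF that] int[OF I(3)] int' by auto
  have "((\<lambda>t. LINT x|lborel. q t x) \<longlongrightarrow> 0) (at t0)"
    unfolding tendsto_at_iff_sequentially
  proof (intro allI impI)
    fix X :: "nat \<Rightarrow> real"
    assume X: "\<forall>i. X i \<in> UNIV - {t0}" and lim: "X \<longlonglongrightarrow> t0"
    have "\<forall>\<^sub>F n in sequentially. X n \<in> I"
      using lim I(1,3) by (metis topological_tendstoD)
    then obtain N where N: "\<And>n. n \<ge> N \<Longrightarrow> X n \<in> I"
      unfolding eventually_sequentially by blast
    have "(\<lambda>n. LINT x|lborel. q (X (n+N)) x) \<longlonglongrightarrow> (LINT x|(lborel::real measure). 0)"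
    proof (rule integral_dominated_convergence[where w="\<lambda>x. 2 * B x"])
      show "q (X (n+N)) \<in> borel_measurable lborel" for n
        using q_int[OF N[of "n+N"]] by auto
      have "(\<lambda>n. q (X n) x) \<longlonglongrightarrow> 0" for x
        using q0[of x] X lim unfolding tendsto_at_iff_sequentially o_def by blast
      then show "AE x in lborel. (\<lambda>n. q (X (n+N)) x) \<longlonglongrightarrow> 0"
        by (intro AE_I2 LIMSEQ_ignore_initial_segment)
    qed (use B qb N in auto)
    then have "(\<lambda>n. LINT x|lborel. q (X n) x) \<longlonglongrightarrow> 0"
      by (simp only: Bochner_Integration.integral_zero) (rule LIMSEQ_offset[where k=N])
    then show "((\<lambda>t. LINT x|lborel. q t x) \<circ> X) \<longlonglongrightarrow> 0"
      by (simp add: o_def)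
  qed
  moreover have "\<forall>\<^sub>F t in at t0. (LINT x|lborel. q t x) = (1 / norm (t - t0)) *\<^sub>R
      ((LINT x|lborel. f t x) - ((LINT x|lborel. f t0 x) + (t - t0) *\<^sub>R (LINT x|lborel. f' t0 x)))"
  proof -
    have "\<forall>\<^sub>F t in at t0. t \<in> I"
      using I by (simp add: eventually_at_in_open' )
    then show ?thesis
      by eventually_elim (use int int' I in \<open>simp add: q_def\<close>)
  qed
  ultimately have "((\<lambda>t. (1 / norm (t - t0)) *\<^sub>R
      ((LINT x|lborel. f t x) - ((LINT x|lborel. f t0 x) + (t - t0) *\<^sub>R (LINT x|lborel. f' t0 x))))
      \<longlongrightarrow> 0) (at t0)"
    by (rule Lim_transform_eventually)
  then show ?thesis
    by (simp add: has_vector_derivative_def has_derivative_at2 bounded_linear_scaleR_left)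
qed

text \<open>Stands in for integration by parts: with \<open>F\<close> a Gaussian, or x times a
  Gaussian, it gives the relations between moments that turn parameter derivatives of Gaussian
  integrals into differential equations.\<close>

lemma integral_derivative_eq_0:
  fixes F f :: "real \<Rightarrow> complex"
  assumes "\<And>x. (F has_vector_derivative f x) (at x)" "continuous_on UNIV f"
    and "integrable lborel f" "(F \<longlongrightarrow> 0) at_top" "(F \<longlongrightarrow> 0) at_bot"
  shows "(LINT x|lborel. f x) = 0"
proof -
  have "(LBINT x=-\<infinity>..\<infinity>. f x) = 0 - 0"
  proof (rule interval_integral_FTC_integrable)
    show "set_integrable lborel (einterval (-\<infinity>) \<infinity>) f"
      using assms(3) by (simp add: set_integrable_def einterval_def)
    show "((F \<circ> real_of_ereal) \<longlongrightarrow> 0) (at_right (-\<infinity>))"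
      using assms(5) by (simp add: ereal_tendsto_simps)
    show "((F \<circ> real_of_ereal) \<longlongrightarrow> 0) (at_left \<infinity>)"
      using assms(4) by (simp add: ereal_tendsto_simps)
  qed (use assms in \<open>auto simp: continuous_on_eq_continuous_at\<close>)
  then show ?thesis
    by (simp add: interval_lebesgue_integral_def einterval_def set_lebesgue_integral_def)
qed

text \<open>The power is absorbed by \<open>fact k * exp \<bar>x\<bar>\<close>, and completing the
  square pays for the linear exponent with half of the quadratic one.\<close>

lemma power_exp_bound:
  fixes x :: real
  assumes "0 < a"
  shows "\<bar>x\<bar> ^ k * exp (- a * x\<^sup>2 + b * \<bar>x\<bar>) \<le> fact k * exp ((b + 1)\<^sup>2 / (2 * a)) * exp (- (a / 2) * x\<^sup>2)"
proof -
  have "\<bar>x\<bar> ^ k / fact k \<le> exp \<bar>x\<bar>"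
    using sum_le_suminf[OF summable_exp[of "\<bar>x\<bar>"], of "{k}"] by (simp add: exp_def field_simps)
  then have 1: "\<bar>x\<bar> ^ k \<le> fact k * exp \<bar>x\<bar>" by (simp add: field_simps)
  have "0 \<le> (a * \<bar>x\<bar> - (b + 1))\<^sup>2" by simp
  then have "2 * a * ((b + 1) * \<bar>x\<bar>) \<le> a\<^sup>2 * x\<^sup>2 + (b + 1)\<^sup>2"
    by (simp add: power2_eq_square algebra_simps)
  then have 2: "\<bar>x\<bar> + (- a * x\<^sup>2 + b * \<bar>x\<bar>) \<le> (b + 1)\<^sup>2 / (2 * a) - (a / 2) * x\<^sup>2"
    using assms by (simp add: field_simps power2_eq_square)
  have "\<bar>x\<bar> ^ k * exp (- a * x\<^sup>2 + b * \<bar>x\<bar>) \<le> fact k * exp \<bar>x\<bar> * exp (- a * x\<^sup>2 + b * \<bar>x\<bar>)"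
    using 1 by (intro mult_right_mono) auto
  also have "\<dots> = fact k * exp (\<bar>x\<bar> + (- a * x\<^sup>2 + b * \<bar>x\<bar>))"
    by (simp add: exp_add)
  also have "\<dots> \<le> fact k * exp ((b + 1)\<^sup>2 / (2 * a) - (a / 2) * x\<^sup>2)"
    using 2 by (intro mult_left_mono) auto
  also have "\<dots> = fact k * exp ((b + 1)\<^sup>2 / (2 * a)) * exp (- (a / 2) * x\<^sup>2)"
    by (simp add: exp_add[symmetric] algebra_simps flip: exp_minus)
  finally show ?thesis .
qed

lemma has_bochner_integral_gaussian:
  assumes "0 < (a::real)"
  shows "has_bochner_integral lborel (\<lambda>x. exp (- a * x\<^sup>2)) (sqrt (pi / a))"
proof -
  have "has_bochner_integral lborel (\<lambda>x::real. exp (- x\<^sup>2)) (2 *\<^sub>R (sqrt pi / 2))"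
    using gaussian_moment_0 by (intro has_bochner_integral_even_function) auto
  then have "has_bochner_integral lborel (\<lambda>x::real. exp (- (0 + sqrt a * x)\<^sup>2)) (sqrt pi /\<^sub>R \<bar>sqrt a\<bar>)"
    using lborel_has_bochner_integral_real_affine_iff[of "sqrt a" "\<lambda>x. exp (- x\<^sup>2)" "sqrt pi" 0] assms
    by simp
  then show ?thesis using assms
    by (simp add: power_mult_distrib real_sqrt_divide field_simps)
qed

lemma norm_gaussian_le:
  fixes x :: real
  assumes "0 < Re z" "\<bar>Re w\<bar> \<le> b"
  shows "norm (of_real x ^ k * exp (- z * (of_real x)\<^sup>2 + w * of_real x))
    \<le> fact k * exp ((b + 1)\<^sup>2 / (2 * Re z)) * exp (- (Re z / 2) * x\<^sup>2)"
proof -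
  have "Re w * x \<le> b * \<bar>x\<bar>"
    using mult_right_mono[OF assms(2) abs_ge_zero[of x]] abs_ge_self[of "Re w * x"]
    by (simp add: abs_mult)
  then have "norm (of_real x ^ k * exp (- z * (of_real x)\<^sup>2 + w * of_real x))
      \<le> \<bar>x\<bar> ^ k * exp (- Re z * x\<^sup>2 + b * \<bar>x\<bar>)"
    by (auto simp: norm_mult norm_power norm_exp power2_eq_square intro!: mult_left_mono)
  also have "\<dots> \<le> fact k * exp ((b + 1)\<^sup>2 / (2 * Re z)) * exp (- (Re z / 2) * x\<^sup>2)"
    by (rule power_exp_bound[OF assms(1)])
  finally show ?thesis .
qed

lemma integrable_gaussian:
  assumes "0 < Re z"
  shows "integrable lborel (\<lambda>x::real. of_real x ^ k * exp (- z * (of_real x)\<^sup>2 + w * of_real x))"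
proof (rule Bochner_Integration.integrable_bound)
  show "integrable lborel (\<lambda>x. fact k * exp ((\<bar>Re w\<bar> + 1)\<^sup>2 / (2 * Re z)) * exp (- (Re z / 2) * x\<^sup>2))"
    using has_bochner_integral_gaussian[of "Re z / 2"] assms
    by (auto simp: has_bochner_integral_iff intro!: integrable_mult_right)
  show "AE x in lborel. norm (complex_of_real x ^ k * exp (- z * (complex_of_real x)\<^sup>2 + w * complex_of_real x))
    \<le> norm (fact k * exp ((\<bar>Re w\<bar> + 1)\<^sup>2 / (2 * Re z)) * exp (- (Re z / 2) * x\<^sup>2))"
    using norm_gaussian_le[OF assms order_refl, of _ k w] by (auto simp: abs_mult)
qed measurable

lemma gaussian_tendsto_0:
  assumes "0 < Re z"
  shows "((\<lambda>x::real. of_real x ^ k * exp (- z * (of_real x)\<^sup>2 + w * of_real x)) \<longlongrightarrow> 0) at_top"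
    and "((\<lambda>x::real. of_real x ^ k * exp (- z * (of_real x)\<^sup>2 + w * of_real x)) \<longlongrightarrow> 0) at_bot"
proof -
  have sq: "filterlim (\<lambda>x::real. x\<^sup>2) at_top at_bot"
    by (rule filterlim_compose[OF _ filterlim_uminus_at_top_at_bot, of "\<lambda>x. x\<^sup>2", simplified])
      (simp add: filterlim_pow_at_top filterlim_ident)
  have *: "((\<lambda>x::real. of_real x ^ k * exp (- z * (of_real x)\<^sup>2 + w * of_real x)) \<longlongrightarrow> 0) F"
    if "filterlim (\<lambda>x::real. x\<^sup>2) at_top F" for F
  proof (rule Lim_null_comparison)
    let ?g = "\<lambda>x. fact k * exp ((\<bar>Re w\<bar> + 1)\<^sup>2 / (2 * Re z)) * exp (- (Re z / 2) * x\<^sup>2)"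
    show "\<forall>\<^sub>F x in F. norm (complex_of_real x ^ k * exp (- z * (complex_of_real x)\<^sup>2 + w * complex_of_real x)) \<le> ?g x"
      using norm_gaussian_le[OF assms order_refl, of _ k w] by auto
    have "filterlim (\<lambda>x. (Re z / 2) * x\<^sup>2) at_top F"
      using assms that by (intro filterlim_tendsto_pos_mult_at_top[OF tendsto_const]) auto
    then have "filterlim (\<lambda>x. - (Re z / 2) * x\<^sup>2) at_bot F"
      by (simp add: filterlim_uminus_at_bot)
    then have "((\<lambda>x. exp (- (Re z / 2) * x\<^sup>2)) \<longlongrightarrow> 0) F"
      by (rule filterlim_compose[OF exp_at_bot])
    then show "(?g \<longlongrightarrow> 0) F"
      by (rule tendsto_mult_right_zero)
  qed
  show "((\<lambda>x::real. of_real x ^ k * exp (- z * (of_real x)\<^sup>2 + w * of_real x)) \<longlongrightarrow> 0) at_top"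
    by (rule *) (simp add: filterlim_pow_at_top filterlim_ident)
  show "((\<lambda>x::real. of_real x ^ k * exp (- z * (of_real x)\<^sup>2 + w * of_real x)) \<longlongrightarrow> 0) at_bot"
    by (rule *[OF sq])
qed

text \<open>The path \<open>Z t\<close> joins \<open>Re z\<close> to \<open>z\<close> with constant
  real part, so one Gaussian dominates all integrands and \<open>csqrt\<close> stays off its cut.
  Integration by parts gives J' = - Z' / (2 Z) * J, hence \<open>J t * csqrt (Z t)\<close> is
  constant, and its value at 0 is the real Gaussian integral.\<close>

lemma integral_gaussian_centred:
  assumes "0 < Re z"
  shows "(LINT x|lborel. exp (- z * (of_real x)\<^sup>2)) = of_real (sqrt pi) / csqrt z"
proof -
  define Z where "Z t = Complex (Re z) (t * Im z)" for t
  let ?e = "\<lambda>t (x::real). exp (- Z t * (of_real x)\<^sup>2)"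
  define J where "J t = (LINT x|lborel. ?e t x)" for t
  have ReZ [simp]: "Re (Z t) = Re z" for t by (simp add: Z_def)
  have Zn: "Z t \<notin> \<real>\<^sub>\<le>\<^sub>0" for t
    using assms by (auto simp: complex_nonpos_Reals_iff)
  have Z0: "Z t \<noteq> 0" for t using Zn[of t] by auto
  have Zd: "(Z has_vector_derivative \<i> * Im z) (at t)" for t
  proof -
    have "((\<lambda>u. of_real (Re z) + u * (\<i> * Im z)) has_field_derivative \<i> * Im z) (at (of_real t))"
      by (auto intro!: derivative_eq_intros)
    moreover have "Z = (\<lambda>x. of_real (Re z) + of_real x * (\<i> * Im z))"
      by (auto simp: Z_def complex_eq_iff)
    ultimately show ?thesis
      using has_vector_derivative_real_field[of "\<lambda>u. of_real (Re z) + u * (\<i> * Im z)" "\<i> * Im z" t UNIV]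
      by simp
  qed
  have int: "integrable lborel (\<lambda>x::real. of_real x ^ k * ?e t x)" for k t
    using integrable_gaussian[of "Z t" k 0] assms by simp
  have parts: "(LINT x|lborel. (of_real x)\<^sup>2 * ?e t x) = J t / (2 * Z t)" for t
  proof -
    have "(LINT x|lborel. ?e t x - 2 * Z t * ((of_real x)\<^sup>2 * ?e t x)) = 0"
    proof (rule integral_derivative_eq_0[where F="\<lambda>x. of_real x * ?e t x"])
      show "((\<lambda>x. of_real x * ?e t x) has_vector_derivative
          ?e t x - 2 * Z t * ((of_real x)\<^sup>2 * ?e t x)) (at x)" for x :: real
      proof -
        have "((\<lambda>x. x * exp (- Z t * x\<^sup>2)) has_field_derivative
          exp (- Z t * y\<^sup>2) - 2 * Z t * (y\<^sup>2 * exp (- Z t * y\<^sup>2))) (at y)" for y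
          by (auto intro!: derivative_eq_intros simp: algebra_simps power2_eq_square)
        then show ?thesis by (rule has_vector_derivative_real_field)
      qed
    qed (use int[of 0 t] int[of 2 t] gaussian_tendsto_0[of "Z t" 1 0] assms in
        \<open>auto intro!: continuous_intros\<close>)
    moreover have "(LINT x|lborel. ?e t x - 2 * Z t * ((of_real x)\<^sup>2 * ?e t x))
        = J t - 2 * Z t * (LINT x|lborel. (of_real x)\<^sup>2 * ?e t x)"
      using int[of 0 t] int[of 2 t] unfolding J_def by (subst Bochner_Integration.integral_diff) auto
    ultimately show ?thesis
      using Z0[of t] by (simp add: field_simps)
  qed
  have Jd: "(J has_vector_derivative - (\<i> * Im z) * (J t / (2 * Z t))) (at t)" for t
  proof -
    have "(J has_vector_derivative
        (LINT x|lborel. - (\<i> * Im z) * ((of_real x)\<^sup>2 * ?e t x))) (at t)"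
      unfolding J_def
    proof (rule has_vector_derivative_integral[where I=UNIV and
          B="\<lambda>x. \<bar>Im z\<bar> * norm ((of_real x)\<^sup>2 * exp (- Z 0 * (of_real x)\<^sup>2))"])
      show "((\<lambda>s. ?e s x) has_vector_derivative
          - (\<i> * Im z) * ((of_real x)\<^sup>2 * ?e s x)) (at s)" for x s :: real
      proof -
        have "((\<lambda>u. exp (- u * (of_real x)\<^sup>2)) has_field_derivative
          - (of_real x)\<^sup>2 * ?e s x) (at (Z s))"
          by (auto intro!: derivative_eq_intros)
        from field_vector_diff_chain_at[OF Zd this] show ?thesis
          by (simp add: o_def mult_ac)
      qed
      show "integrable lborel (\<lambda>x. \<bar>Im z\<bar> * norm ((complex_of_real x)\<^sup>2 * exp (- Z 0 * (complex_of_real x)\<^sup>2)))"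
        using int[of 2 0] by (intro integrable_mult_right integrable_norm) simp
    qed (use int[of 0] int[of 2] in \<open>auto simp: norm_mult norm_power norm_exp power2_eq_square\<close>)
    then show ?thesis by (simp only: Bochner_Integration.integral_mult_right_zero parts)
  qed
  have "((\<lambda>t. J t * csqrt (Z t)) has_vector_derivative 0) (at t)" for t
  proof -
    have "((\<lambda>t. csqrt (Z t)) has_vector_derivative (\<i> * Im z) * inverse (2 * csqrt (Z t))) (at t)"
      using field_vector_diff_chain_at[OF Zd has_field_derivative_csqrt[OF Zn]] by (simp add: o_def)
    from has_vector_derivative_mult[OF Jd this]
    have "((\<lambda>t. J t * csqrt (Z t)) has_vector_derivative
      J t * (\<i> * Im z * inverse (2 * csqrt (Z t))) - \<i> * Im z * (J t / (2 * Z t)) * csqrt (Z t)) (at t)"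
      by simp
    moreover have alg: "j * (c * inverse (2 * s)) - c * (j / (2 * s\<^sup>2)) * s = 0" if "s \<noteq> 0" for j c s :: complex
      using that by (simp add: field_simps power2_eq_square)
    have "J t * (\<i> * Im z * inverse (2 * csqrt (Z t))) - \<i> * Im z * (J t / (2 * Z t)) * csqrt (Z t) = 0"
      using alg[of "csqrt (Z t)" "J t" "\<i> * Im z"] Z0[of t] by (simp only: power2_csqrt csqrt_eq_0 not_False_eq_True simp_thms)
    ultimately show ?thesis by (simp only:)
  qed
  then obtain c where "\<And>t. t \<in> UNIV \<Longrightarrow> J t * csqrt (Z t) = c"
    using has_vector_derivative_zero_constant[of UNIV "\<lambda>t. J t * csqrt (Z t)"] by auto
  from this[of 1] this[of 0] have "J 1 * csqrt (Z 1) = J 0 * csqrt (Z 0)" by simp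
  also have "\<dots> = of_real (sqrt pi)"
  proof -
    have "J 0 = (LINT x|lborel. of_real (exp (- Re z * x\<^sup>2)))"
      unfolding J_def Z_def by (intro Bochner_Integration.integral_cong)
        (auto simp: exp_of_real[symmetric] complex_of_real_def[of "Re z"])
    also have "\<dots> = of_real (sqrt (pi / Re z))"
      using has_bochner_integral_gaussian[OF assms] has_bochner_integral_integral_eq
      by (simp add: integral_complex_of_real) blast
    finally have "J 0 = of_real (sqrt (pi / Re z))" .
    moreover have "csqrt (Z 0) = of_real (sqrt (Re z))"
      using assms csqrt_of_real_nonneg[of "Re z"] by (simp add: Z_def complex_of_real_def)
    ultimately show ?thesis using assms
      by (simp flip: of_real_mult real_sqrt_mult)
  qed
  moreover have "Z 1 = z" by (simp add: Z_def)
  moreover have "csqrt z \<noteq> 0" using assms by auto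
  ultimately show ?thesis by (simp add: J_def field_simps)
qed

text \<open>The same scheme in the linear coefficient: scaling \<open>w\<close> by \<open>t\<close>
  gives J' = t w^2 / (2 z) * J, starting from the centred integral at \<open>t = 0\<close>.\<close>

lemma integral_gaussian:
  assumes "0 < Re z"
  shows "(LINT x|lborel. exp (- z * (of_real x)\<^sup>2 + w * of_real x)) = of_real (sqrt pi) / csqrt z * exp (w\<^sup>2 / (4 * z))"
proof -
  let ?e = "\<lambda>(t::real) (x::real). exp (- z * (of_real x)\<^sup>2 + (of_real t * w) * of_real x)"
  define J where "J t = (LINT x|lborel. ?e t x)" for t :: real
  have z: "z \<noteq> 0" using assms by auto
  have int: "integrable lborel (\<lambda>x::real. of_real x ^ k * ?e t x)" for k and t :: real
    using integrable_gaussian[of z k "of_real t * w"] assms by simp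
  have parts: "(LINT x|lborel. of_real x * ?e t x) = of_real t * w * J t / (2 * z)" for t :: real
  proof -
    have "(LINT x|lborel. of_real t * w * ?e t x
        - 2 * z * (of_real x * ?e t x)) = 0"
    proof (rule integral_derivative_eq_0[where F="\<lambda>x. ?e t x"])
      show "((\<lambda>x. ?e t x) has_vector_derivative
          of_real t * w * ?e t x
        - 2 * z * (of_real x * ?e t x)) (at x)" for x :: real
      proof -
        have "((\<lambda>x. exp (- z * x\<^sup>2 + (of_real t * w) * x)) has_field_derivative
          of_real t * w * exp (- z * y\<^sup>2 + (of_real t * w) * y)
        - 2 * z * (y * exp (- z * y\<^sup>2 + (of_real t * w) * y))) (at y)" for y
          by (auto intro!: derivative_eq_intros simp: algebra_simps power2_eq_square)
        then show ?thesis by (rule has_vector_derivative_real_field)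
      qed
    qed (use int[of 0 t] int[of 1 t] gaussian_tendsto_0[of z 0 "of_real t * w"] assms in
        \<open>auto intro!: continuous_intros\<close>)
    moreover have "(LINT x|lborel. of_real t * w * ?e t x
        - 2 * z * (of_real x * ?e t x))
        = of_real t * w * J t - 2 * z * (LINT x|lborel. of_real x * ?e t x)"
      using int[of 0 t] int[of 1 t] unfolding J_def by (subst Bochner_Integration.integral_diff) auto
    ultimately show ?thesis
      using z by (simp add: field_simps)
  qed
  have Jd: "(J has_vector_derivative w * (of_real t * w * J t / (2 * z))) (at t)" if "t \<in> {-2<..<2}" for t
  proof -
    have "(J has_vector_derivative
        (LINT x|lborel. w * (of_real x * ?e t x))) (at t)"
      unfolding J_def
    \<comment> \<open>A bounded open interval around [0, 1] keeps the real part of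
      \<open>of_real t * w\<close> below \<open>2 * norm w\<close>, which supplies an integrable
      bound independent of \<open>t\<close>.\<close>
    proof (rule has_vector_derivative_integral[where I="{-2<..<2}" and
          B="\<lambda>x. norm w * (fact 1 * exp ((2 * norm w + 1)\<^sup>2 / (2 * Re z)) * exp (- (Re z / 2) * x\<^sup>2))"])
      show "((\<lambda>s. ?e s x) has_vector_derivative
          w * (of_real x * ?e s x)) (at s)" for x s :: real
      proof -
        have "((\<lambda>u. exp (- z * (of_real x)\<^sup>2 + (u * w) * of_real x)) has_field_derivative
          w * (of_real x * ?e s x)) (at (of_real s))"
          by (auto intro!: derivative_eq_intros simp: mult_ac)
        then show ?thesis by (rule has_vector_derivative_real_field)
      qed
      show "norm (w * (of_real x * ?e s x)) \<le>
         norm w * (fact 1 * exp ((2 * norm w + 1)\<^sup>2 / (2 * Re z)) * exp (- (Re z / 2) * x\<^sup>2))"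
        if "s \<in> {-2<..<2}" for s x
      proof -
        have "\<bar>Re (of_real s * w)\<bar> \<le> 2 * norm w"
          using that abs_Re_le_cmod[of w] by (auto simp: abs_mult intro!: mult_mono)
        from norm_gaussian_le[OF assms this, of x 1] show ?thesis
          unfolding norm_mult[of w] by (intro mult_left_mono) auto
      qed
      show "integrable lborel (\<lambda>x. norm w * (fact 1 * exp ((2 * norm w + 1)\<^sup>2 / (2 * Re z)) * exp (- (Re z / 2) * x\<^sup>2)))"
        using has_bochner_integral_gaussian[of "Re z / 2"] assms
        by (auto simp: has_bochner_integral_iff intro!: integrable_mult_right)
    qed (use that int[of 0] int[of 1] in auto)
    then show ?thesis by (simp only: Bochner_Integration.integral_mult_right_zero parts)
  qed
  have "((\<lambda>t. J t * exp (- (of_real t)\<^sup>2 * w\<^sup>2 / (4 * z))) has_vector_derivative 0) (at t within {-2<..<2})" if "t \<in> {-2<..<2}" for t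
  proof -
    have "((\<lambda>t. exp (- t\<^sup>2 * w\<^sup>2 / (4 * z))) has_field_derivative
        (- (2 * t) * w\<^sup>2 / (4 * z)) * exp (- t\<^sup>2 * w\<^sup>2 / (4 * z))) (at t)" for t
      by (auto intro!: derivative_eq_intros simp: z)
    then have "((\<lambda>t::real. exp (- (of_real t)\<^sup>2 * w\<^sup>2 / (4 * z))) has_vector_derivative
        (- (2 * of_real t) * w\<^sup>2 / (4 * z)) * exp (- (of_real t)\<^sup>2 * w\<^sup>2 / (4 * z))) (at t)"
      by (rule has_vector_derivative_real_field)
    from has_vector_derivative_mult[OF Jd[OF that] this] show ?thesis
      using z by (auto simp: field_simps power2_eq_square intro!: has_vector_derivative_at_within)
  qed
  then have "\<exists>c. \<forall>t\<in>{-2<..<2}. J t * exp (- (of_real t)\<^sup>2 * w\<^sup>2 / (4 * z)) = c"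
    using has_vector_derivative_zero_constant[of "{-2<..<2}" "\<lambda>t::real. J t * exp (- (of_real t)\<^sup>2 * w\<^sup>2 / (4 * z))"]
    by fastforce
  then obtain c where "\<forall>t\<in>{-2<..<2}. J t * exp (- (of_real t)\<^sup>2 * w\<^sup>2 / (4 * z)) = c" by blast
  from bspec[OF this, of 1] bspec[OF this, of 0] have "J 1 * exp (- w\<^sup>2 / (4 * z)) = J 0" by simp
  also have "J 0 = of_real (sqrt pi) / csqrt z"
    using integral_gaussian_centred[OF assms] by (simp add: J_def)
  finally have "J 1 * exp (- w\<^sup>2 / (4 * z)) * exp (w\<^sup>2 / (4 * z)) = of_real (sqrt pi) / csqrt z * exp (w\<^sup>2 / (4 * z))"
    by simp
  then show ?thesis by (simp add: J_def mult.assoc flip: exp_add)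
qed

section \<open>The Plancherel theorem\<close>

text \<open>The absolutely convergent transform, defined pointwise for integrable \<open>f\<close>
  and normalised like \<open>trunc_fourier\<close>. The work is done with it, and
  \<open>L2_fourier\<close> is reached through cutoffs.\<close>

definition ft :: "(real \<Rightarrow> complex) \<Rightarrow> real \<Rightarrow> complex" where
  "ft f \<xi> = complex_of_real (1 / sqrt (2 * pi)) * (LINT x|lborel. cis (- (x * \<xi>)) * f x)"

definition sqnorm :: "(real \<Rightarrow> complex) \<Rightarrow> ennreal" where
  "sqnorm f = (\<integral>\<^sup>+ x. ennreal ((cmod (f x))\<^sup>2) \<partial>lborel)"

lemma borel_measurable_cis [measurable]:
  "f \<in> borel_measurable M \<Longrightarrow> (\<lambda>x. cis (f x)) \<in> borel_measurable M"
  unfolding cis.ctr by (rule borel_measurable_complex_iff[THEN iffD2]) auto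

lemma borel_measurable_cnj [measurable]: "cnj \<in> borel_measurable borel"
  by (intro borel_measurable_continuous_onI continuous_intros)

lemma integrable_cis_mult:
  assumes "integrable lborel f"
  shows "integrable lborel (\<lambda>x. cis (- (x * \<xi>)) * f x)"
  by (rule Bochner_Integration.integrable_bound[OF assms])
    (use assms in \<open>auto simp: norm_mult\<close>)

lemma norm_ft_le:
  "cmod (ft f \<xi>) \<le> (LINT x|lborel. cmod (f x)) / sqrt (2 * pi)"
proof -
  have "cmod (LINT x|lborel. cis (- (x * \<xi>)) * f x) \<le> (LINT x|lborel. cmod (cis (- (x * \<xi>)) * f x))"
    by (rule integral_norm_bound)
  then show ?thesis
    by (simp add: ft_def norm_mult norm_divide divide_right_mono)
qed

lemma continuous_on_ft:
  assumes "integrable lborel f"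
  shows "continuous_on UNIV (ft f)"
  unfolding continuous_on_eq_continuous_at[OF open_UNIV] continuous_at_sequentially o_def
proof (intro ballI allI impI)
  fix \<xi> and X :: "nat \<Rightarrow> real" assume X: "X \<longlonglongrightarrow> \<xi>"
  have "(\<lambda>n. LINT x|lborel. cis (- (x * X n)) * f x) \<longlonglongrightarrow> (LINT x|lborel. cis (- (x * \<xi>)) * f x)"
    by (rule integral_dominated_convergence[where w="\<lambda>x. cmod (f x)"])
      (use assms X in \<open>auto simp: norm_mult intro!: AE_I2 tendsto_intros\<close>)
  then show "(\<lambda>n. ft f (X n)) \<longlonglongrightarrow> ft f \<xi>"
    unfolding ft_def by (rule tendsto_mult_left)
qed

lemma borel_measurable_ft [measurable]:
  "integrable lborel f \<Longrightarrow> ft f \<in> borel_measurable borel"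
  using continuous_on_ft by (rule borel_measurable_continuous_onI)

lemma ft_diff:
  assumes "integrable lborel f" "integrable lborel g"
  shows "ft (\<lambda>x. f x - g x) \<xi> = ft f \<xi> - ft g \<xi>"
  unfolding ft_def
  by (simp add: right_diff_distrib Bochner_Integration.integral_diff integrable_cis_mult assms)

section \<open>Square norms, approximation by continuous functions and continuity of translations in
  L^2\<close>

lemma sqnorm_diff_le:
  assumes [measurable]: "f \<in> borel_measurable borel" "g \<in> borel_measurable borel"
  shows "sqnorm f \<le> 2 * sqnorm g + 2 * sqnorm (\<lambda>x. f x - g x)"
proof -
  have "(cmod (f x))\<^sup>2 \<le> 2 * (cmod (g x))\<^sup>2 + 2 * (cmod (f x - g x))\<^sup>2" for x
  proof -
    have "cmod (f x) \<le> cmod (g x) + cmod (f x - g x)"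
      using norm_triangle_ineq[of "g x" "f x - g x"] by simp
    then have "(cmod (f x))\<^sup>2 \<le> (cmod (g x) + cmod (f x - g x))\<^sup>2" by (intro power_mono) auto
    then show ?thesis using sum_squares_bound[of "cmod (g x)" "cmod (f x - g x)"]
      by (simp add: power2_sum)
  qed
  then have "ennreal ((cmod (f x))\<^sup>2) \<le> 2 * ennreal ((cmod (g x))\<^sup>2) + 2 * ennreal ((cmod (f x - g x))\<^sup>2)" for x
    using ennreal_leI[of "(cmod (f x))\<^sup>2" "2 * (cmod (g x))\<^sup>2 + 2 * (cmod (f x - g x))\<^sup>2"]
    by (simp add: ennreal_mult)
  then have "sqnorm f \<le> (\<integral>\<^sup>+ x. 2 * ennreal ((cmod (g x))\<^sup>2) + 2 * ennreal ((cmod (f x - g x))\<^sup>2) \<partial>lborel)"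
    unfolding sqnorm_def by (intro nn_integral_mono)
  then show ?thesis
    by (simp add: nn_integral_add nn_integral_cmult sqnorm_def)
qed

lemma nn_integral_lborel_shift:
  assumes "f \<in> borel_measurable borel"
  shows "(\<integral>\<^sup>+ x. f (x - t) \<partial>lborel) = (\<integral>\<^sup>+ x. f x \<partial>(lborel :: real measure))"
  using nn_integral_real_affine[OF assms, of 1 "-t"] by (simp add: add.commute)

lemma sqnorm_cong_AE:
  "AE x in lborel. f x = g x \<Longrightarrow> sqnorm f = sqnorm g"
  unfolding sqnorm_def by (rule nn_integral_cong_AE) auto

lemma sqnorm_finite_integrable:
  assumes "f \<in> borel_measurable borel" "sqnorm f < \<infinity>"
  shows "integrable lborel (\<lambda>x. (cmod (f x))\<^sup>2)" "sqnorm f = ennreal (LINT x|lborel. (cmod (f x))\<^sup>2)"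
proof -
  show *: "integrable lborel (\<lambda>x. (cmod (f x))\<^sup>2)"
    by (rule integrableI_nonneg) (use assms in \<open>auto simp: sqnorm_def\<close>)
  show "sqnorm f = ennreal (LINT x|lborel. (cmod (f x))\<^sup>2)"
    unfolding sqnorm_def by (rule nn_integral_eq_integral[OF *]) auto
qed

lemma tendsto_sqnorm_0:
  assumes "\<And>n. f n \<in> borel_measurable borel" "w \<in> borel_measurable borel"
    and "\<And>n. AE x in lborel. (cmod (f n x))\<^sup>2 \<le> w x"
    and "(\<integral>\<^sup>+ x. ennreal (w x) \<partial>lborel) < \<infinity>"
    and "AE x in lborel. (\<lambda>n. f n x) \<longlonglongrightarrow> 0"
  shows "(\<lambda>n. sqnorm (f n)) \<longlonglongrightarrow> 0"
proof -
  have "(\<lambda>n. \<integral>\<^sup>+ x. ennreal ((cmod (f n x))\<^sup>2) \<partial>lborel) \<longlonglongrightarrow> (\<integral>\<^sup>+ x. 0 \<partial>(lborel::real measure))"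
  proof (rule nn_integral_dominated_convergence[where w="\<lambda>x. ennreal (w x)"])
    show "AE x in lborel. ennreal ((cmod (f j x))\<^sup>2) \<le> ennreal (w x)" for j
      using assms(3)[of j] by eventually_elim (rule ennreal_leI)
    show "AE x in lborel. (\<lambda>i. ennreal ((cmod (f i x))\<^sup>2)) \<longlonglongrightarrow> 0"
      using assms(5)
    proof eventually_elim
      case (elim x)
      then have "(\<lambda>i. (cmod (f i x))\<^sup>2) \<longlonglongrightarrow> (cmod 0)\<^sup>2" by (intro tendsto_intros)
      then show ?case using tendsto_ennrealI by fastforce
    qed
  qed (use assms in auto)
  then show ?thesis by (simp add: sqnorm_def)
qed

lemma sqnorm_truncate:
  assumes [measurable]: "f \<in> borel_measurable borel" and "sqnorm f < \<infinity>"
  shows "(\<lambda>k. sqnorm (\<lambda>x. f x - (if \<bar>x\<bar> \<le> real k \<and> cmod (f x) \<le> real k then f x else 0))) \<longlonglongrightarrow> 0"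
proof (rule tendsto_sqnorm_0[where w="\<lambda>x. (cmod (f x))\<^sup>2"])
  have "(\<lambda>k. f x - (if \<bar>x\<bar> \<le> real k \<and> cmod (f x) \<le> real k then f x else 0)) \<longlonglongrightarrow> 0" for x
  proof (rule tendsto_eventually)
    obtain K where "max \<bar>x\<bar> (cmod (f x)) \<le> real K" using real_arch_simple by blast
    then have "\<forall>k\<ge>K. f x - (if \<bar>x\<bar> \<le> real k \<and> cmod (f x) \<le> real k then f x else 0) = 0"
      by force
    then show "\<forall>\<^sub>F k in sequentially. f x - (if \<bar>x\<bar> \<le> real k \<and> cmod (f x) \<le> real k then f x else 0) = 0"
      unfolding eventually_sequentially by blast
  qed
  then show "AE x in lborel. (\<lambda>k. f x - (if \<bar>x\<bar> \<le> real k \<and> cmod (f x) \<le> real k then f x else 0)) \<longlonglongrightarrow> 0"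
    by simp
qed (use assms in \<open>auto simp: sqnorm_def\<close>)

text \<open>Lebesgue measurability provides continuous functions that converge to \<open>f\<close>
  off a null set. Clipping their values and cutting off their supports makes the convergence
  dominated, hence convergence in L^2.\<close>

lemma approx_bounded_by_continuous:
  fixes f :: "real \<Rightarrow> complex" and k :: nat
  assumes [measurable]: "f \<in> borel_measurable borel"
    and b: "\<And>x. cmod (f x) \<le> real k" "\<And>x. \<bar>x\<bar> > real k \<Longrightarrow> f x = 0" and "0 < e"
  obtains \<phi> where "continuous_on UNIV \<phi>" "\<And>x. \<bar>x\<bar> > real k + 1 \<Longrightarrow> \<phi> x = 0"
    "\<And>x. cmod (\<phi> x) \<le> real k + 1" "sqnorm (\<lambda>x. f x - \<phi> x) < e"
proof -
  have "f \<in> borel_measurable lebesgue" using assms(1) by (intro measurable_completion) simp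
  then have "f measurable_on UNIV" by (rule lebesgue_measurable_imp_measurable_on) auto
  then obtain N g where N: "negligible N" and g: "\<And>n. continuous_on UNIV (g n)"
    and lim: "\<And>x. x \<notin> N \<Longrightarrow> (\<lambda>n. g n x) \<longlonglongrightarrow> f x"
    unfolding measurable_on_def by auto
  \<comment> \<open>\<open>cl\<close> is the retraction onto the disc of radius
    \<open>k + 1\<close>, which fixes all values of \<open>f\<close>; \<open>\<psi>\<close> is a
    continuous cutoff equal to 1 wherever \<open>f\<close> may be nonzero.\<close>
  define cl where "cl z = of_real ((real k + 1) / max (real k + 1) (cmod z)) * z" for z :: complex
  define \<psi> where "\<psi> x = max 0 (min 1 (real k + 1 - \<bar>x\<bar>))" for x :: real
  define \<phi> where "\<phi> n x = of_real (\<psi> x) * cl (g n x)" for n x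
  have cl_cont: "continuous_on UNIV cl"
    unfolding cl_def by (intro continuous_intros) auto
  have cl_le: "cmod (cl z) \<le> real k + 1" for z
    unfolding cl_def norm_mult norm_of_real by (auto simp: divide_simps abs_mult mult_le_cancel_left max_def)
  have cl_id: "cl (f x) = f x" for x
  proof -
    have "max (real k + 1) (cmod (f x)) = real k + 1" using b(1)[of x] by simp
    then show ?thesis by (simp add: cl_def)
  qed
  have \<psi>: "0 \<le> \<psi> x" "\<psi> x \<le> 1" for x by (auto simp: \<psi>_def)
  have \<phi>_cont: "continuous_on UNIV (\<phi> n)" for n
    unfolding \<phi>_def \<psi>_def
    by (intro continuous_intros continuous_on_compose2[OF cl_cont g]) auto
  have \<phi>_le: "cmod (\<phi> n x) \<le> real k + 1" for n x
    using mult_mono[OF \<psi>(2)[of x] cl_le[of "g n x"]] \<psi> by (simp add: \<phi>_def norm_mult)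
  have \<phi>_0: "\<phi> n x = 0" if "\<bar>x\<bar> > real k + 1" for n x
    using that by (simp add: \<phi>_def \<psi>_def)
  have "(\<lambda>n. sqnorm (\<lambda>x. f x - \<phi> n x)) \<longlonglongrightarrow> 0"
  proof (rule tendsto_sqnorm_0[where w="\<lambda>x. (2 * real k + 1)\<^sup>2 * indicator {-(real k + 1)..real k + 1} x"])
    show "(\<lambda>x. f x - \<phi> n x) \<in> borel_measurable borel" for n
      using borel_measurable_continuous_onI[OF \<phi>_cont[of n]] by measurable
    show "AE x in lborel. (cmod (f x - \<phi> n x))\<^sup>2 \<le> (2 * real k + 1)\<^sup>2 * indicator {-(real k + 1)..real k + 1} x" for n
    proof (rule AE_I2)
      fix x
      show "(cmod (f x - \<phi> n x))\<^sup>2 \<le> (2 * real k + 1)\<^sup>2 * indicator {-(real k + 1)..real k + 1} x"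
      proof (cases "\<bar>x\<bar> > real k + 1")
        case True
        then show ?thesis using b(2)[of x] \<phi>_0[of x n] by (auto split: split_indicator)
      next
        case False
        have "cmod (f x - \<phi> n x) \<le> real k + (real k + 1)"
          using norm_triangle_ineq4[of "f x" "\<phi> n x"] b(1)[of x] \<phi>_le[of n x] by linarith
        then show ?thesis using False by (auto intro!: power_mono split: split_indicator)
      qed
    qed
    have "(\<integral>\<^sup>+ x. ennreal ((2 * real k + 1)\<^sup>2 * indicator {-(real k + 1)..real k + 1} x) \<partial>lborel)
      = ennreal ((2 * real k + 1)\<^sup>2) * emeasure lborel {-(real k + 1)..real k + 1}"
      by (simp add: ennreal_mult' nn_integral_cmult ennreal_indicator)
    then show "(\<integral>\<^sup>+ x. ennreal ((2 * real k + 1)\<^sup>2 * indicator {-(real k + 1)..real k + 1} x) \<partial>lborel) < \<infinity>"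
      by (simp add: ennreal_mult_less_top)
    have "AE x in lebesgue. x \<notin> N"
      using N by (simp add: negligible_iff_null_sets AE_not_in)
    then have "AE x in lborel. x \<notin> N" by (simp add: AE_completion_iff)
    then show "AE x in lborel. (\<lambda>n. f x - \<phi> n x) \<longlonglongrightarrow> 0"
    proof eventually_elim
      case (elim x)
      have "(\<lambda>n. cl (g n x)) \<longlonglongrightarrow> cl (f x)"
        using continuous_on_tendsto_compose[OF cl_cont lim[OF elim]] by simp
      then have "(\<lambda>n. f x - \<phi> n x) \<longlonglongrightarrow> f x - of_real (\<psi> x) * cl (f x)"
        unfolding \<phi>_def by (intro tendsto_intros)
      moreover have "of_real (\<psi> x) * cl (f x) = f x"
        using b(2)[of x] by (cases "\<bar>x\<bar> > real k") (auto simp: cl_id \<psi>_def cl_def[of 0])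
      ultimately show ?case by simp
    qed
  qed auto
  then have "\<forall>\<^sub>F n in sequentially. sqnorm (\<lambda>x. f x - \<phi> n x) < e"
    using assms(4) by (rule order_tendstoD)
  then obtain n where "sqnorm (\<lambda>x. f x - \<phi> n x) < e"
    unfolding eventually_sequentially by blast
  with that[of "\<phi> n"] show ?thesis using \<phi>_cont \<phi>_0 \<phi>_le by blast
qed


lemma sqnorm_sub_shift_le:
  assumes [measurable]: "f \<in> borel_measurable borel"
  shows "sqnorm (\<lambda>x. f x - f (x - t)) \<le> 4 * sqnorm f"
proof -
  have "sqnorm (\<lambda>x. f (x - t)) = sqnorm f"
    unfolding sqnorm_def by (rule nn_integral_lborel_shift[where f="\<lambda>x. ennreal ((cmod (f x))\<^sup>2)"]) auto
  then have "sqnorm (\<lambda>x. f x - f (x - t) - f x) = sqnorm f"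
    by (simp add: sqnorm_def)
  then show ?thesis
    using sqnorm_diff_le[of "\<lambda>x. f x - f (x - t)" f] by (simp flip: distrib_right)
qed

lemma sqnorm_approx_continuous:
  assumes [measurable]: "f \<in> borel_measurable borel" and fin: "sqnorm f < \<infinity>" and "0 < (d::real)"
  obtains \<phi> R M where "continuous_on UNIV \<phi>" "\<And>x. \<bar>x\<bar> > R \<Longrightarrow> \<phi> x = 0"
    "\<And>x. cmod (\<phi> x) \<le> M" "sqnorm (\<lambda>x. f x - \<phi> x) \<le> ennreal d"
proof -
  define F where "F k x = (if \<bar>x\<bar> \<le> real k \<and> cmod (f x) \<le> real k then f x else 0)" for k :: nat and x
  have [measurable]: "F k \<in> borel_measurable borel" for k unfolding F_def by measurable
  have "(\<lambda>k. sqnorm (\<lambda>x. f x - F k x)) \<longlonglongrightarrow> 0"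
    unfolding F_def using assms by (intro sqnorm_truncate)
  then have "\<forall>\<^sub>F k in sequentially. sqnorm (\<lambda>x. f x - F k x) < ennreal (d / 4)"
    using \<open>0 < d\<close> by (intro order_tendstoD) auto
  then obtain k where k: "sqnorm (\<lambda>x. f x - F k x) < ennreal (d / 4)"
    unfolding eventually_sequentially by blast
  obtain \<phi> where \<phi>: "continuous_on UNIV \<phi>" "\<And>x. \<bar>x\<bar> > real k + 1 \<Longrightarrow> \<phi> x = 0"
    "\<And>x. cmod (\<phi> x) \<le> real k + 1" "sqnorm (\<lambda>x. F k x - \<phi> x) < ennreal (d / 4)"
    by (rule approx_bounded_by_continuous[of "F k" k "ennreal (d / 4)"]) (use \<open>0 < d\<close> in \<open>auto simp: F_def\<close>)
  have [measurable]: "\<phi> \<in> borel_measurable borel" by (rule borel_measurable_continuous_onI[OF \<phi>(1)])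
  have "sqnorm (\<lambda>x. f x - \<phi> x) \<le> 2 * sqnorm (\<lambda>x. F k x - \<phi> x) + 2 * sqnorm (\<lambda>x. f x - F k x)"
    using sqnorm_diff_le[of "\<lambda>x. f x - \<phi> x" "\<lambda>x. F k x - \<phi> x"] by simp
  also have "\<dots> \<le> 2 * ennreal (d / 4) + 2 * ennreal (d / 4)"
    using k \<phi>(4) by (intro add_mono mult_left_mono) auto
  also have "\<dots> = ennreal (2 * (d / 4) + 2 * (d / 4))"
    using \<open>0 < d\<close> by (simp add: numeral_mult_ennreal flip: ennreal_plus del: ennreal_divide_numeral)
  also have "2 * (d / 4) + 2 * (d / 4) = d" by simp
  finally show ?thesis using that[OF \<phi>(1-3)] by blast
qed

lemma tendsto_sqnorm_shift_continuous:
  assumes \<phi>: "continuous_on UNIV \<phi>" "\<And>x. \<bar>x\<bar> > R \<Longrightarrow> \<phi> x = 0" "\<And>x. cmod (\<phi> x) \<le> M"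
    and X: "X \<longlonglongrightarrow> 0"
  shows "(\<lambda>n. sqnorm (\<lambda>x. \<phi> x - \<phi> (x - X n))) \<longlonglongrightarrow> 0"
proof -
  have [measurable]: "\<phi> \<in> borel_measurable borel" by (rule borel_measurable_continuous_onI[OF \<phi>(1)])
  have "\<forall>\<^sub>F n in sequentially. \<bar>X n\<bar> < 1"
    using tendsto_rabs[OF X] by (intro order_tendstoD) auto
  then obtain n0 where n0: "\<And>n. n \<ge> n0 \<Longrightarrow> \<bar>X n\<bar> < 1" unfolding eventually_sequentially by blast
  let ?w = "\<lambda>x. (2 * M)\<^sup>2 * indicator {-(R + 1)..R + 1} x"
  have "(\<lambda>n. sqnorm (\<lambda>x. \<phi> x - \<phi> (x - X (n + n0)))) \<longlonglongrightarrow> 0"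
  proof (rule tendsto_sqnorm_0[where w="?w"])
    show "AE x in lborel. (cmod (\<phi> x - \<phi> (x - X (n + n0))))\<^sup>2 \<le> ?w x" for n
    proof (rule AE_I2)
      fix x
      show "(cmod (\<phi> x - \<phi> (x - X (n + n0))))\<^sup>2 \<le> ?w x"
      proof (cases "\<bar>x\<bar> > R + 1")
        case True
        then have "\<phi> x = 0" "\<phi> (x - X (n + n0)) = 0" using \<phi>(2) n0[of "n + n0"] by auto
        then show ?thesis using True by (auto split: split_indicator)
      next
        case False
        have "cmod (\<phi> x - \<phi> (x - X (n + n0))) \<le> 2 * M"
          using norm_triangle_ineq4[of "\<phi> x" "\<phi> (x - X (n + n0))"] \<phi>(3)[of x] \<phi>(3)[of "x - X (n + n0)"] by linarith
        from power_mono[OF this, of 2] show ?thesis using False by (auto split: split_indicator)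
      qed
    qed
    have "(\<integral>\<^sup>+ x. ennreal (?w x) \<partial>lborel) = ennreal ((2 * M)\<^sup>2) * emeasure lborel {-(R + 1)..R + 1}"
      by (simp add: ennreal_mult' nn_integral_cmult ennreal_indicator)
    then show "(\<integral>\<^sup>+ x. ennreal (?w x) \<partial>lborel) < \<infinity>"
      by (cases "R + 1 < 0") (auto simp add: ennreal_mult_less_top)
    have "(\<lambda>n. x - X (n + n0)) \<longlonglongrightarrow> x - 0" for x
      by (intro tendsto_diff tendsto_const LIMSEQ_ignore_initial_segment X)
    then have "(\<lambda>n. \<phi> (x - X (n + n0))) \<longlonglongrightarrow> \<phi> (x - 0)" for x
      by (rule continuous_on_tendsto_compose[OF \<phi>(1)]) auto
    then show "AE x in lborel. (\<lambda>n. \<phi> x - \<phi> (x - X (n + n0))) \<longlonglongrightarrow> 0"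
      by (auto intro!: AE_I2 tendsto_eq_intros)
  qed auto
  then show ?thesis by (rule LIMSEQ_offset)
qed

text \<open>Replacing \<open>f\<close> by a compactly supported continuous function costs at most 4
  times the squared error, uniformly in the shift, by \<open>sqnorm_sub_shift_le\<close>; for the
  continuous function dominated convergence suffices.\<close>

lemma tendsto_sqnorm_shift:
  assumes [measurable]: "f \<in> borel_measurable borel" and fin: "sqnorm f < \<infinity>" and X: "X \<longlonglongrightarrow> 0"
  shows "(\<lambda>n. sqnorm (\<lambda>x. f x - f (x - X n))) \<longlonglongrightarrow> 0"
proof (rule order_tendstoI)
  fix e :: ennreal assume "0 < e"
  \<comment> \<open>\<open>e\<close> may be infinite; a finite \<open>e'\<close> below it allows
    real arithmetic.\<close>
  then obtain e' where e': "0 < e'" "e' < e" using dense by blast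
  then obtain r where r: "e' = ennreal r" "0 < r" by (cases e') auto
  obtain \<phi> R M where \<phi>: "continuous_on UNIV \<phi>" "\<And>x. \<bar>x\<bar> > R \<Longrightarrow> \<phi> x = 0"
    "\<And>x. cmod (\<phi> x) \<le> M" "sqnorm (\<lambda>x. f x - \<phi> x) \<le> ennreal (r / 16)"
    using sqnorm_approx_continuous[OF assms(1,2), of "r / 16"] r by auto
  have [measurable]: "\<phi> \<in> borel_measurable borel" by (rule borel_measurable_continuous_onI[OF \<phi>(1)])
  have "\<forall>\<^sub>F n in sequentially. sqnorm (\<lambda>x. \<phi> x - \<phi> (x - X n)) < ennreal (r / 4)"
    using tendsto_sqnorm_shift_continuous[OF \<phi>(1-3) X] r by (intro order_tendstoD) auto
  then show "\<forall>\<^sub>F n in sequentially. sqnorm (\<lambda>x. f x - f (x - X n)) < e"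
  proof eventually_elim
    case (elim n)
    let ?h = "\<lambda>x. f x - \<phi> x"
    have "sqnorm (\<lambda>x. f x - f (x - X n)) \<le> 2 * sqnorm (\<lambda>x. \<phi> x - \<phi> (x - X n)) + 2 * sqnorm (\<lambda>x. ?h x - ?h (x - X n))"
      using sqnorm_diff_le[of "\<lambda>x. f x - f (x - X n)" "\<lambda>x. \<phi> x - \<phi> (x - X n)"] by (simp add: algebra_simps)
    also have "\<dots> \<le> 2 * ennreal (r / 4) + 2 * (4 * ennreal (r / 16))"
      using elim \<phi>(4) by (intro add_mono mult_left_mono order_trans[OF sqnorm_sub_shift_le[of ?h "X n"]]) auto
    also have "\<dots> = ennreal (2 * (r / 4) + 2 * (4 * (r / 16)))"
      using r by (simp add: numeral_mult_ennreal flip: ennreal_plus)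
    also have "\<dots> = e'" using r by simp
    finally show ?case using e' by order
  qed
qed auto

section \<open>Product integrands, Fubini and the multiplication formula\<close>

lemma integrable_pair_mult:
  fixes f g :: "real \<Rightarrow> 'a :: {banach, second_countable_topology, real_normed_field}"
  assumes "integrable lborel f" "integrable lborel g"
  shows "integrable (lborel \<Otimes>\<^sub>M lborel) (\<lambda>(x, y). f x * g y)"
  by (rule lborel_pair.Fubini_integrable)
    (use assms in \<open>auto simp: norm_mult borel_measurable_integrable\<close>)

lemma integrable_pair_mult_shift:
  fixes f g :: "real \<Rightarrow> 'a :: {banach, second_countable_topology, real_normed_field}"
  assumes "integrable lborel f" "integrable lborel g"
  shows "integrable (lborel \<Otimes>\<^sub>M lborel) (\<lambda>(x, t). f (x - t) * g t)"
proof -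
  have [measurable]: "f \<in> borel_measurable borel" "g \<in> borel_measurable borel"
    using assms by (auto dest: borel_measurable_integrable)
  have sh: "integrable lborel (\<lambda>x. f (x - t))" for t
    using lborel_integrable_real_affine[OF assms(1), of 1 "-t"] by (simp add: add.commute)
  have "(LINT x|lborel. norm (f (x - t))) = (LINT x|lborel. norm (f x))" for t
    using lborel_integral_real_affine[of 1 "\<lambda>x. norm (f x)" "-t"] by (simp add: add.commute)
  then have "integrable (lborel \<Otimes>\<^sub>M lborel) (\<lambda>(t, x). f (x - t) * g t)"
    using assms sh
    by (intro lborel_pair.Fubini_integrable) (auto simp: norm_mult)
  from lborel_pair.integrable_product_swap[OF this] show ?thesis by (simp add: case_prod_beta)
qed

lemma ft_multiplication:
  assumes f: "integrable lborel f" and g: "integrable lborel g"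
  shows "(LINT \<xi>|lborel. ft f \<xi> * g \<xi>) = (LINT x|lborel. f x * ft g x)"
proof -
  have [measurable]: "f \<in> borel_measurable borel" "g \<in> borel_measurable borel"
    using assms by (auto dest: borel_measurable_integrable)
  have "integrable (lborel \<Otimes>\<^sub>M lborel) (\<lambda>(x, \<xi>). cis (- (x * \<xi>)) * f x * g \<xi>)"
    by (rule Bochner_Integration.integrable_bound[OF integrable_pair_mult[OF f g]])
      (auto simp: norm_mult case_prod_beta)
  from lborel_pair.Fubini_integral[OF this]
  have "(LINT \<xi>|lborel. (LINT x|lborel. cis (- (x * \<xi>)) * f x) * g \<xi>) =
    (LINT x|lborel. f x * (LINT \<xi>|lborel. cis (- (\<xi> * x)) * g \<xi>))"
    by (simp add: mult_ac flip: Bochner_Integration.integral_mult_right_zero Bochner_Integration.integral_mult_left_zero)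
  then show ?thesis
    unfolding ft_def by (simp add: mult_ac flip: Bochner_Integration.integral_mult_right_zero)
qed

lemma ft_gaussian:
  assumes "0 < Re z"
  shows "ft (\<lambda>x. exp (- z * (of_real x)\<^sup>2 + w * of_real x)) \<xi> = exp ((w - \<i> * \<xi>)\<^sup>2 / (4 * z)) / (of_real (sqrt 2) * csqrt z)"
proof -
  have "(LINT x|lborel. cis (- (x * \<xi>)) * exp (- z * (of_real x)\<^sup>2 + w * of_real x))
    = (LINT x|lborel. exp (- z * (of_real x)\<^sup>2 + (w - \<i> * \<xi>) * of_real x))"
    by (intro Bochner_Integration.integral_cong) (simp_all add: cis_conv_exp algebra_simps flip: exp_add)
  also have "\<dots> = of_real (sqrt pi) / csqrt z * exp ((w - \<i> * \<xi>)\<^sup>2 / (4 * z))"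
    by (rule integral_gaussian[OF assms])
  finally show ?thesis
    by (simp add: ft_def real_sqrt_mult)
qed

lemma ft_cnj_reflect: "ft (\<lambda>x. cnj (f (- x))) \<xi> = cnj (ft f \<xi>)"
proof -
  have "(LINT x|lborel. cis (- (x * \<xi>)) * cnj (f (- x))) = (LINT x|lborel. cis (x * \<xi>) * cnj (f x))"
    using lborel_integral_real_affine[of "-1" "\<lambda>x. cis (- (x * \<xi>)) * cnj (f (- x))" 0] by simp
  also have "\<dots> = (LINT x|lborel. cnj (cis (- (x * \<xi>)) * f x))"
    by (simp add: cis_cnj)
  also have "\<dots> = cnj (LINT x|lborel. cis (- (x * \<xi>)) * f x)"
    by (rule Bochner_Integration.integral_cnj)
  finally show ?thesis by (simp add: ft_def)
qed

text \<open>The Gaussian density of variance \<open>2 * s^2\<close>. Up to the factor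
  \<open>sqrt (2 * pi)\<close> it is the transform of exp(- s^2 x^2), the weight that regularises
  Plancherel's identity.\<close>

definition heat_kernel :: "real \<Rightarrow> real \<Rightarrow> real" where
  "heat_kernel s t = exp (- (t\<^sup>2 / (4 * s\<^sup>2))) / (2 * s * sqrt pi)"

lemma borel_measurable_heat_kernel [measurable]: "heat_kernel s \<in> borel_measurable borel"
  unfolding heat_kernel_def[abs_def] by measurable

lemma heat_kernel_nonneg: "0 < s \<Longrightarrow> 0 \<le> heat_kernel s t"
  by (simp add: heat_kernel_def)

lemma has_bochner_integral_heat_kernel:
  assumes "0 < s"
  shows "has_bochner_integral lborel (heat_kernel s) 1"
proof -
  have "has_bochner_integral lborel (\<lambda>t. exp (- (1 / (4 * s\<^sup>2)) * t\<^sup>2) / (2 * s * sqrt pi))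
    (sqrt (pi / (1 / (4 * s\<^sup>2))) / (2 * s * sqrt pi))"
    using assms by (intro has_bochner_integral_divide has_bochner_integral_gaussian) auto
  moreover have "sqrt (pi / (1 / (4 * s\<^sup>2))) = 2 * s * sqrt pi"
    using assms by (intro real_sqrt_unique) (auto simp: power_mult_distrib)
  ultimately show ?thesis using assms by (simp add: heat_kernel_def[abs_def])
qed

lemma ft_exp_scaled:
  assumes "0 < s"
  shows "ft (\<lambda>x. exp (- (of_real (s\<^sup>2) * (of_real x)\<^sup>2))) t = of_real (sqrt (2 * pi) * heat_kernel s t)"
proof -
  have "csqrt ((of_real s)\<^sup>2) = of_real s" using assms by (intro csqrt_unique) auto
  then show ?thesis using ft_gaussian[of "of_real (s\<^sup>2)" 0 t] assms
    by (simp add: heat_kernel_def real_sqrt_mult power_mult_distrib exp_of_real[symmetric])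
      (simp add: field_simps flip: of_real_mult, simp)
qed

text \<open>With the weight all integrals converge absolutely. The multiplication formula turns the
  left side into the integral of \<open>f x * cnj (f (x - t))\<close> against the heat kernel, and
  polarisation expresses that through the distances between \<open>f\<close> and its
  translates.\<close>

lemma plancherel_regularized:
  assumes f: "integrable lborel f" and fin: "sqnorm f < \<infinity>" and s: "0 < s"
  shows "(\<integral>\<^sup>+ \<xi>. ennreal ((cmod (ft f \<xi>))\<^sup>2 * exp (- (s\<^sup>2 * \<xi>\<^sup>2))) \<partial>lborel) =
    ennreal ((LINT x|lborel. (cmod (f x))\<^sup>2) - (LINT t|lborel. heat_kernel s t * (LINT x|lborel. (cmod (f x - f (x - t)))\<^sup>2)) / 2)"
proof -
  let ?B = "\<lambda>(x, t). (cmod (f (x - t)))\<^sup>2 * heat_kernel s t"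
  let ?A = "\<lambda>(x, t). (cmod (f x))\<^sup>2 * heat_kernel s t"
  let ?P = "\<lambda>(x, t). f x * (cnj (f (x - t)) * heat_kernel s t)"
  let ?Q = "\<lambda>(x, t). (cmod (f x - f (x - t)))\<^sup>2 * heat_kernel s t"
  have [measurable]: "f \<in> borel_measurable borel" using f by (auto dest: borel_measurable_integrable)
  define G :: "real \<Rightarrow> complex" where "G \<xi> = exp (- (of_real (s\<^sup>2) * (of_real \<xi>)\<^sup>2))" for \<xi>
  \<comment> \<open>The transform of \<open>f'\<close> is the conjugate of \<open>ft f\<close>, so
    \<open>ft f * ft f'\<close> is the squared modulus.\<close>
  define f' where "f' y = cnj (f (- y))" for y
  have f': "integrable lborel f'"
    using lborel_integrable_real_affine[OF f, of "-1" 0] unfolding f'_def by (intro integrable_cnj) simp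
  have G: "integrable lborel G"
    using integrable_gaussian[of "of_real (s\<^sup>2)" 0 0] s by (simp add: G_def[abs_def])
  have cisG: "integrable lborel (\<lambda>\<xi>. cis (- (\<xi> * x)) * G \<xi>)" for x
    using G by (rule integrable_cis_mult)
  have [measurable]: "ft f' \<in> borel_measurable borel" "G \<in> borel_measurable borel"
    using f' G by (auto intro: borel_measurable_ft dest: borel_measurable_integrable)
  have g: "integrable lborel (\<lambda>\<xi>. ft f' \<xi> * G \<xi>)"
  proof (rule Bochner_Integration.integrable_bound)
    show "integrable lborel (\<lambda>\<xi>. of_real ((LINT x|lborel. cmod (f' x)) / sqrt (2 * pi)) * G \<xi>)"
      using G by simp
    show "AE \<xi> in lborel. cmod (ft f' \<xi> * G \<xi>) \<le> cmod (of_real ((LINT x|lborel. cmod (f' x)) / sqrt (2 * pi)) * G \<xi>)"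
      unfolding norm_mult norm_of_real
      by (intro AE_I2 mult_right_mono order_trans[OF norm_ft_le]) auto
  qed measurable
  have ftg: "ft (\<lambda>\<xi>. ft f' \<xi> * G \<xi>) x = (LINT t|lborel. cnj (f (x - t)) * heat_kernel s t)" for x
  proof -
    have "(LINT \<xi>|lborel. cis (- (\<xi> * x)) * (ft f' \<xi> * G \<xi>)) = (LINT \<xi>|lborel. ft f' \<xi> * (cis (- (\<xi> * x)) * G \<xi>))"
      by (simp add: mult_ac)
    also have "\<dots> = (LINT y|lborel. f' y * ft (\<lambda>\<xi>. cis (- (\<xi> * x)) * G \<xi>) y)"
      by (rule ft_multiplication[OF f' cisG])
    also have "\<dots> = (LINT y|lborel. f' y * ft G (x + y))"
      by (simp add: ft_def cis_mult distrib_left add.commute flip: mult.assoc)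
    also have "\<dots> = (LINT t|lborel. f' (- x + t) * ft G (x + (- x + t)))"
      using lborel_integral_real_affine[of 1 "\<lambda>y. f' y * ft G (x + y)" "-x"] by simp
    also have "\<dots> = (LINT t|lborel. cnj (f (x - t)) * of_real (sqrt (2 * pi) * heat_kernel s t))"
      using ft_exp_scaled[OF s] by (simp add: f'_def G_def[abs_def])
    also have "\<dots> = of_real (sqrt (2 * pi)) * (LINT t|lborel. cnj (f (x - t)) * heat_kernel s t)"
      by (simp add: mult_ac flip: Bochner_Integration.integral_mult_right_zero)
    finally show ?thesis by (simp add: ft_def)
  qed
  note sq = sqnorm_finite_integrable[OF \<open>f \<in> borel_measurable borel\<close> fin]
  have hk: "integrable lborel (heat_kernel s)" "(LINT t|lborel. heat_kernel s t) = 1"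
    using has_bochner_integral_heat_kernel[OF s] by (auto simp: has_bochner_integral_iff)
  have i1: "integrable (lborel \<Otimes>\<^sub>M lborel) ?A"
    by (rule integrable_pair_mult[OF sq(1) hk(1)])
  have i2: "integrable (lborel \<Otimes>\<^sub>M lborel) ?B"
    by (rule integrable_pair_mult_shift[OF sq(1) hk(1)])
  have polar: "Re (f x * (cnj (f y) * of_real h)) = ((cmod (f x))\<^sup>2 * h + (cmod (f y))\<^sup>2 * h - (cmod (f x - f y))\<^sup>2 * h) / 2" for x y h
    unfolding cmod_power2 by (simp add: power2_eq_square algebra_simps)
  have bound: "cmod (f x * (cnj (f y) * of_real h)) \<le> ((cmod (f x))\<^sup>2 * h + (cmod (f y))\<^sup>2 * h) / 2" if "0 \<le> h" for x y h
    using mult_right_mono[OF sum_squares_bound[of "cmod (f x)" "cmod (f y)"] that] that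
    by (simp add: norm_mult algebra_simps)
  have i3: "integrable (lborel \<Otimes>\<^sub>M lborel) ?P"
  proof (rule Bochner_Integration.integrable_bound)
    show "integrable (lborel \<Otimes>\<^sub>M lborel) (\<lambda>p. (?A p + ?B p) / 2)"
      using i1 i2 by simp
    show "AE p in lborel \<Otimes>\<^sub>M lborel. norm (?P p) \<le>
       norm ((?A p + ?B p) / 2)"
      unfolding case_prod_beta real_norm_def
      by (intro AE_I2 order_trans[OF bound[OF heat_kernel_nonneg[OF s]] abs_ge_self])
  qed measurable
  have i4: "integrable (lborel \<Otimes>\<^sub>M lborel) ?Q"
  proof -
    have "integrable (lborel \<Otimes>\<^sub>M lborel) (\<lambda>p. ?A p
      + ?B p - 2 * Re (?P p))"
      using i1 i2 i3 by (intro Bochner_Integration.integrable_diff Bochner_Integration.integrable_add integrable_mult_right integrable_Re)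
    moreover have "?Q = (\<lambda>p. ?A p
      + ?B p - 2 * Re (?P p))"
      unfolding case_prod_beta polar by (simp add: field_simps)
    ultimately show ?thesis by (simp only:)
  qed
  define K where "K = (LINT \<xi>|lborel. ft f \<xi> * (ft f' \<xi> * G \<xi>))"
  have "K = (LINT x|lborel. f x * (LINT t|lborel. cnj (f (x - t)) * heat_kernel s t))"
    unfolding K_def by (simp add: ft_multiplication[OF f g] ftg)
  also have "\<dots> = (LINT x|lborel. LINT t|lborel. f x * (cnj (f (x - t)) * heat_kernel s t))"
    by simp
  also have "\<dots> = (LINT p|(lborel \<Otimes>\<^sub>M lborel). ?P p)"
    using lborel_pair.integral_fst[OF i3] by simp
  finally have "Re K = (LINT p|(lborel \<Otimes>\<^sub>M lborel). Re (?P p))"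
    using integral_Re[OF i3] by simp
  also have "\<dots> = (LINT p|(lborel \<Otimes>\<^sub>M lborel). (?A p
      + ?B p - ?Q p) / 2)"
    unfolding case_prod_beta polar ..
  also have "\<dots> = ((LINT p|(lborel \<Otimes>\<^sub>M lborel). ?A p)
      + (LINT p|(lborel \<Otimes>\<^sub>M lborel). ?B p)
      - (LINT p|(lborel \<Otimes>\<^sub>M lborel). ?Q p)) / 2"
    using i1 i2 i4 by simp
  also have "(LINT p|(lborel \<Otimes>\<^sub>M lborel). ?A p) = (LINT x|lborel. (cmod (f x))\<^sup>2)"
    using lborel_pair.integral_snd[OF i1] hk by simp
  also have "(LINT p|(lborel \<Otimes>\<^sub>M lborel). ?B p) = (LINT x|lborel. (cmod (f x))\<^sup>2)"
  proof -
    have "(LINT x|lborel. (cmod (f (x - t)))\<^sup>2) = (LINT x|lborel. (cmod (f x))\<^sup>2)" for t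
      using lborel_integral_real_affine[of 1 "\<lambda>x. (cmod (f x))\<^sup>2" "-t"] by (simp add: add.commute)
    then show ?thesis using lborel_pair.integral_snd[OF i2] hk by simp
  qed
  also have "(LINT p|(lborel \<Otimes>\<^sub>M lborel). ?Q p)
      = (LINT t|lborel. heat_kernel s t * (LINT x|lborel. (cmod (f x - f (x - t)))\<^sup>2))"
    using lborel_pair.integral_snd[OF i4] by (simp add: mult_ac)
  finally have ReK: "Re K = (LINT x|lborel. (cmod (f x))\<^sup>2) - (LINT t|lborel. heat_kernel s t * (LINT x|lborel. (cmod (f x - f (x - t)))\<^sup>2)) / 2"
    by simp
  have eq: "ft f \<xi> * (ft f' \<xi> * G \<xi>) = of_real ((cmod (ft f \<xi>))\<^sup>2 * exp (- (s\<^sup>2 * \<xi>\<^sup>2)))" for \<xi>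
    using complex_norm_square[of "ft f \<xi>"] ft_cnj_reflect[of f \<xi>]
    by (simp add: f'_def[abs_def] G_def exp_of_real[symmetric])
  have "integrable lborel (\<lambda>\<xi>. (cmod (ft f \<xi>))\<^sup>2 * exp (- (s\<^sup>2 * \<xi>\<^sup>2)))"
  proof (rule Bochner_Integration.integrable_bound)
    show "integrable lborel (\<lambda>\<xi>. of_real ((LINT x|lborel. cmod (f x)) / sqrt (2 * pi)) * (ft f' \<xi> * G \<xi>))"
      using g by simp
    show "AE \<xi> in lborel. norm ((cmod (ft f \<xi>))\<^sup>2 * exp (- (s\<^sup>2 * \<xi>\<^sup>2)))
      \<le> norm (of_real ((LINT x|lborel. cmod (f x)) / sqrt (2 * pi)) * (ft f' \<xi> * G \<xi>))"
    proof (rule AE_I2)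
      fix \<xi>
      have "norm ((cmod (ft f \<xi>))\<^sup>2 * exp (- (s\<^sup>2 * \<xi>\<^sup>2))) = cmod (ft f \<xi> * (ft f' \<xi> * G \<xi>))"
        unfolding eq norm_of_real by simp
      also have "\<dots> \<le> norm (of_real ((LINT x|lborel. cmod (f x)) / sqrt (2 * pi)) * (ft f' \<xi> * G \<xi>))"
        unfolding norm_mult norm_of_real
        by (intro mult_right_mono order_trans[OF norm_ft_le]) auto
      finally show "norm ((cmod (ft f \<xi>))\<^sup>2 * exp (- (s\<^sup>2 * \<xi>\<^sup>2)))
        \<le> norm (of_real ((LINT x|lborel. cmod (f x)) / sqrt (2 * pi)) * (ft f' \<xi> * G \<xi>))" .
    qed
  qed (use f in measurable)
  then have "(\<integral>\<^sup>+ \<xi>. ennreal ((cmod (ft f \<xi>))\<^sup>2 * exp (- (s\<^sup>2 * \<xi>\<^sup>2))) \<partial>lborel)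
    = ennreal (LINT \<xi>|lborel. (cmod (ft f \<xi>))\<^sup>2 * exp (- (s\<^sup>2 * \<xi>\<^sup>2)))"
    by (intro nn_integral_eq_integral) auto
  also have "(LINT \<xi>|lborel. (cmod (ft f \<xi>))\<^sup>2 * exp (- (s\<^sup>2 * \<xi>\<^sup>2))) = Re K"
    unfolding K_def eq integral_complex_of_real by simp
  finally show ?thesis by (simp add: ReK)
qed

text \<open>As \<open>s n\<close> decreases to 0 the weighted integrals increase to
  \<open>sqnorm (ft f)\<close>, while the correction term averages squared distances to translates
  and vanishes by continuity of translations.\<close>

theorem plancherel:
  assumes f: "integrable lborel f" and fin: "sqnorm f < \<infinity>"
  shows "sqnorm (ft f) = sqnorm f"
proof -
  have [measurable]: "f \<in> borel_measurable borel" using f by (auto dest: borel_measurable_integrable)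
  define s where "s n = 1 / real (Suc n)" for n
  have s: "0 < s n" for n by (simp add: s_def)
  have s_lim: "s \<longlonglongrightarrow> 0" unfolding s_def by (rule LIMSEQ_Suc[OF lim_1_over_n])
  define D where "D t = (LINT x|lborel. (cmod (f x - f (x - t)))\<^sup>2)" for t
  have sqD: "sqnorm (\<lambda>x. f x - f (x - t)) < \<infinity>" for t
    using le_less_trans[OF sqnorm_sub_shift_le[of f t]] fin by (simp add: ennreal_mult_less_top)
  have D: "sqnorm (\<lambda>x. f x - f (x - t)) = ennreal (D t)" "0 \<le> D t" for t
    unfolding D_def using sqnorm_finite_integrable(2)[OF _ sqD] by auto
  have D_le: "D t \<le> 4 * (LINT x|lborel. (cmod (f x))\<^sup>2)" for t
    using sqnorm_sub_shift_le[of f t] sqnorm_finite_integrable(2)[OF _ fin] D(1)[of t]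
    by (simp add: numeral_mult_ennreal)
  have D_lim: "(\<lambda>n. D (X n)) \<longlonglongrightarrow> 0" if "X \<longlonglongrightarrow> 0" for X
    using tendsto_sqnorm_shift[OF _ fin that] D(2) by (simp add: D(1) tendsto_ennreal_iff[where x=0, simplified])
  have [measurable]: "D \<in> borel_measurable borel" unfolding D_def by measurable
  \<comment> \<open>The substitution t = 2 s u freezes the kernel and moves \<open>s n\<close> into
    the shift, where dominated convergence can act.\<close>
  have I: "(LINT t|lborel. heat_kernel (s n) t * D t) = (LINT u|lborel. (exp (- u\<^sup>2) / sqrt pi) * D (2 * s n * u))" for n
  proof -
    have "(LINT t|lborel. heat_kernel (s n) t * D t) = (LINT u|lborel. 2 * s n * (heat_kernel (s n) (2 * s n * u) * D (2 * s n * u)))"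
      using lborel_integral_real_affine[of "2 * s n" "\<lambda>t. heat_kernel (s n) t * D t" 0] s[of n] by simp
    then show ?thesis using s[of n] by (simp add: heat_kernel_def power_mult_distrib)
  qed
  have "(\<lambda>n. LINT u|lborel. (exp (- u\<^sup>2) / sqrt pi) * D (2 * s n * u)) \<longlonglongrightarrow> (LINT u|(lborel::real measure). 0)"
  proof (rule integral_dominated_convergence[where w="\<lambda>u. (exp (- u\<^sup>2) / sqrt pi) * (4 * (LINT x|lborel. (cmod (f x))\<^sup>2))"])
    show "integrable lborel (\<lambda>u. (exp (- u\<^sup>2) / sqrt pi) * (4 * (LINT x|lborel. (cmod (f x))\<^sup>2)))"
      using has_bochner_integral_gaussian[of 1] by (auto simp: has_bochner_integral_iff)
    have "(\<lambda>n. 2 * s n * u) \<longlonglongrightarrow> 0" for u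
      using s_lim by (auto intro!: tendsto_eq_intros)
    then show "AE u in lborel. (\<lambda>n. (exp (- u\<^sup>2) / sqrt pi) * D (2 * s n * u)) \<longlonglongrightarrow> 0"
      by (intro AE_I2 tendsto_mult_right_zero D_lim)
    show "AE u in lborel. norm (exp (- u\<^sup>2) / sqrt pi * D (2 * s n * u)) \<le> exp (- u\<^sup>2) / sqrt pi * (4 * (LINT x|lborel. (cmod (f x))\<^sup>2))" for n
      using D(2) D_le by (intro AE_I2) (simp add: abs_mult divide_right_mono mult_left_mono)
  qed measurable
  then have "(\<lambda>n. (LINT x|lborel. (cmod (f x))\<^sup>2) - (LINT t|lborel. heat_kernel (s n) t * D t) / 2)
      \<longlonglongrightarrow> (LINT x|lborel. (cmod (f x))\<^sup>2) - 0 / 2"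
    unfolding I by (intro tendsto_intros) auto
  then have "(\<lambda>n. \<integral>\<^sup>+ \<xi>. ennreal ((cmod (ft f \<xi>))\<^sup>2 * exp (- ((s n)\<^sup>2 * \<xi>\<^sup>2))) \<partial>lborel) \<longlonglongrightarrow> sqnorm f"
    using plancherel_regularized[OF f fin s] sqnorm_finite_integrable(2)[OF _ fin]
    by (simp add: D_def tendsto_ennrealI)
  moreover have "(\<lambda>n. \<integral>\<^sup>+ \<xi>. ennreal ((cmod (ft f \<xi>))\<^sup>2 * exp (- ((s n)\<^sup>2 * \<xi>\<^sup>2))) \<partial>lborel) \<longlonglongrightarrow> sqnorm (ft f)"
    unfolding sqnorm_def
  proof (rule nn_integral_LIMSEQ)
    show "incseq (\<lambda>n \<xi>. ennreal ((cmod (ft f \<xi>))\<^sup>2 * exp (- ((s n)\<^sup>2 * \<xi>\<^sup>2))))"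
    proof (intro incseq_SucI le_funI ennreal_leI mult_left_mono)
      fix n \<xi>
      have "s (Suc n) \<le> s n" unfolding s_def by (intro divide_left_mono) auto
      then show "exp (- ((s n)\<^sup>2 * \<xi>\<^sup>2)) \<le> exp (- ((s (Suc n))\<^sup>2 * \<xi>\<^sup>2))"
        using s[of "Suc n"] by (auto intro!: mult_right_mono power_mono)
    qed auto
    fix \<xi>
    have "(\<lambda>n. (cmod (ft f \<xi>))\<^sup>2 * exp (- ((s n)\<^sup>2 * \<xi>\<^sup>2))) \<longlonglongrightarrow> (cmod (ft f \<xi>))\<^sup>2 * exp (- (0\<^sup>2 * \<xi>\<^sup>2))"
      by (intro tendsto_intros s_lim)
    then show "(\<lambda>n. ennreal ((cmod (ft f \<xi>))\<^sup>2 * exp (- ((s n)\<^sup>2 * \<xi>\<^sup>2)))) \<longlonglongrightarrow> ennreal ((cmod (ft f \<xi>))\<^sup>2)"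
      by (intro tendsto_ennrealI) simp
  qed (use f in measurable)
  ultimately show ?thesis by (rule LIMSEQ_unique[symmetric])
qed

section \<open>The Fourier transform on $L^2$ and the propagator\<close>

lemma lebesgue_ex_borel:
  fixes f :: "real \<Rightarrow> complex"
  assumes "f \<in> borel_measurable lebesgue"
  obtains g where "g \<in> borel_measurable borel" "AE x in lborel. f x = g x"
proof -
  have "(\<lambda>x. Re (f x)) \<in> borel_measurable lebesgue" "(\<lambda>x. Im (f x)) \<in> borel_measurable lebesgue"
    using assms by measurable
  then obtain p q where "p \<in> borel_measurable lborel" "AE x in lborel. Re (f x) = p x"
    and "q \<in> borel_measurable lborel" "AE x in lborel. Im (f x) = q x"
    using completion_ex_borel_measurable_real by blast
  then have "(\<lambda>x. Complex (p x) (q x)) \<in> borel_measurable borel" "AE x in lborel. f x = Complex (p x) (q x)"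
    by (auto simp: complex_eq_iff borel_measurable_complex_iff)
  then show ?thesis by (rule that)
qed

lemma borel_imp_lebesgue_measurable:
  "f \<in> borel_measurable borel \<Longrightarrow> f \<in> borel_measurable (lebesgue :: real measure)"
  by (intro measurable_completion) simp

lemma L2_norm_sq_eq_sqnorm: "L2_norm_sq f = sqnorm f"
  by (simp add: L2_norm_sq_def sqnorm_def nn_integral_completion)

definition cutoff :: "real \<Rightarrow> (real \<Rightarrow> complex) \<Rightarrow> real \<Rightarrow> complex" where
  "cutoff R f x = (if \<bar>x\<bar> \<le> R then f x else 0)"

lemma borel_measurable_cutoff [measurable]:
  assumes [measurable]: "f \<in> borel_measurable borel"
  shows "cutoff R f \<in> borel_measurable borel"
  unfolding cutoff_def[abs_def] by measurable

lemma sqnorm_cutoff_le: "sqnorm (cutoff R f) \<le> sqnorm f"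
  unfolding sqnorm_def cutoff_def by (intro nn_integral_mono ennreal_leI) auto

lemma integrable_cutoff:
  assumes [measurable]: "f \<in> borel_measurable borel" and "sqnorm f < \<infinity>"
  shows "integrable lborel (cutoff R f)"
proof (rule Bochner_Integration.integrable_bound)
  show "integrable lborel (\<lambda>x. indicator {-R..R} x + (cmod (f x))\<^sup>2)"
    using sqnorm_finite_integrable(1)[OF assms]
    by (intro Bochner_Integration.integrable_add integrable_real_indicator)
      (auto simp: emeasure_lborel_Icc_eq)
  have "cmod z \<le> 1 + (cmod z)\<^sup>2" for z
  proof -
    have "2 * cmod z \<le> 1 + (cmod z)\<^sup>2" using sum_squares_bound[of 1 "cmod z"] by simp
    then show ?thesis using norm_ge_zero[of z] by linarith
  qed
  then show "AE x in lborel. norm (cutoff R f x) \<le> norm (indicator {-R..R} x + (cmod (f x))\<^sup>2)"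
    by (intro AE_I2) (auto simp: cutoff_def split: split_indicator)
qed measurable

lemma trunc_fourier_eq_ft:
  assumes "f \<in> borel_measurable lebesgue" and [measurable]: "g \<in> borel_measurable borel"
    and "AE x in lborel. f x = g x"
  shows "trunc_fourier R f = ft (cutoff R g)"
proof
  fix \<xi>
  have "(LINT x:{-R..R}|lebesgue. cis (- (x * \<xi>)) * f x) = (LINT x|lebesgue. cis (- (x * \<xi>)) * cutoff R g x)"
    unfolding set_lebesgue_integral_def
  proof (rule integral_cong_AE)
    show "(\<lambda>x. indicator {- R..R} x *\<^sub>R (cis (- (x * \<xi>)) * f x)) \<in> borel_measurable lebesgue"
      by (intro borel_measurable_scaleR borel_measurable_times assms(1); rule borel_imp_lebesgue_measurable; measurable)
    show "(\<lambda>x. cis (- (x * \<xi>)) * cutoff R g x) \<in> borel_measurable lebesgue"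
      by (intro borel_imp_lebesgue_measurable) measurable
    have "AE x in lebesgue. f x = g x" using assms(3) by (simp add: AE_completion_iff)
    then show "AE x in lebesgue. indicator {- R..R} x *\<^sub>R (cis (- (x * \<xi>)) * f x) = cis (- (x * \<xi>)) * cutoff R g x"
      by eventually_elim (auto simp: cutoff_def split: split_indicator)
  qed
  also have "\<dots> = (LINT x|lborel. cis (- (x * \<xi>)) * cutoff R g x)"
    by (rule integral_completion) measurable
  finally show "trunc_fourier R f \<xi> = ft (cutoff R g) \<xi>"
    by (simp add: trunc_fourier_def ft_def)
qed

text \<open>By Plancherel the transforms of the cutoffs form a Cauchy family in L^2, controlled by
  the tails of \<open>f\<close>.\<close>

lemma sqnorm_ft_cutoff_diff:
  assumes [measurable]: "f \<in> borel_measurable borel" and fin: "sqnorm f < \<infinity>" and "R \<le> R'"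
  shows "sqnorm (\<lambda>\<xi>. ft (cutoff R' f) \<xi> - ft (cutoff R f) \<xi>) \<le> sqnorm (\<lambda>x. f x - cutoff R f x)"
proof -
  note int = integrable_cutoff[OF assms(1,2)]
  have le: "sqnorm (\<lambda>x. cutoff R' f x - cutoff R f x) \<le> sqnorm (\<lambda>x. f x - cutoff R f x)"
    unfolding sqnorm_def cutoff_def using \<open>R \<le> R'\<close>
    by (intro nn_integral_mono ennreal_leI power_mono) auto
  have "sqnorm (\<lambda>x. f x - cutoff R f x) \<le> sqnorm f"
    unfolding sqnorm_def cutoff_def by (intro nn_integral_mono ennreal_leI power_mono) auto
  then have fin': "sqnorm (\<lambda>x. cutoff R' f x - cutoff R f x) < \<infinity>"
    using le fin by (meson le_less_trans)
  have "(\<lambda>\<xi>. ft (cutoff R' f) \<xi> - ft (cutoff R f) \<xi>) = ft (\<lambda>x. cutoff R' f x - cutoff R f x)"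
    by (intro ext ft_diff[symmetric] int)
  then show ?thesis
    using plancherel[OF Bochner_Integration.integrable_diff[OF int int] fin'] le by simp
qed

lemma tendsto_sqnorm_cutoff:
  assumes [measurable]: "f \<in> borel_measurable borel" and fin: "sqnorm f < \<infinity>"
  shows "((\<lambda>R. sqnorm (\<lambda>x. f x - cutoff R f x)) \<longlongrightarrow> 0) at_top"
proof (rule order_tendstoI)
  fix e :: ennreal assume "0 < e"
  have "(\<lambda>n. sqnorm (\<lambda>x. f x - cutoff (real n) f x)) \<longlonglongrightarrow> 0"
  proof (rule tendsto_sqnorm_0[where w="\<lambda>x. (cmod (f x))\<^sup>2"])
    have "(\<lambda>n. f x - cutoff (real n) f x) \<longlonglongrightarrow> 0" for x
    proof (rule tendsto_eventually)
      obtain N where "\<bar>x\<bar> \<le> real N" using real_arch_simple by blast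
      then have "\<forall>n\<ge>N. f x - cutoff (real n) f x = 0" by (force simp: cutoff_def)
      then show "\<forall>\<^sub>F n in sequentially. f x - cutoff (real n) f x = 0"
        unfolding eventually_sequentially by blast
    qed
    then show "AE x in lborel. (\<lambda>n. f x - cutoff (real n) f x) \<longlonglongrightarrow> 0" by simp
    show "AE x in lborel. (cmod (f x - cutoff (real n) f x))\<^sup>2 \<le> (cmod (f x))\<^sup>2" for n
      by (intro AE_I2) (simp add: cutoff_def)
  qed (use fin in \<open>auto simp: sqnorm_def\<close>)
  then have "\<forall>\<^sub>F n in sequentially. sqnorm (\<lambda>x. f x - cutoff (real n) f x) < e"
    using \<open>0 < e\<close> by (rule order_tendstoD)
  then obtain n where n: "sqnorm (\<lambda>x. f x - cutoff (real n) f x) < e"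
    unfolding eventually_sequentially by blast
  have "sqnorm (\<lambda>x. f x - cutoff R f x) \<le> sqnorm (\<lambda>x. f x - cutoff (real n) f x)" if "real n \<le> R" for R
    unfolding sqnorm_def cutoff_def using that
    by (intro nn_integral_mono ennreal_leI power_mono) auto
  from le_less_trans[OF this n]
  show "\<forall>\<^sub>F R in at_top. sqnorm (\<lambda>x. f x - cutoff R f x) < e"
    using eventually_ge_at_top[of "real n"] by (rule eventually_mono[rotated])
qed auto

text \<open>AM-GM with the weight \<open>2 ^ k\<close>: \<open>2 * \<bar>d k\<bar>\<close> is at
  most \<open>2 ^ k * (d k)^2 + (1 / 2) ^ k\<close>.\<close>

lemma summable_if_weighted_squares:
  fixes d :: "nat \<Rightarrow> real"
  assumes "(\<Sum>k. ennreal (2 ^ k * (d k)\<^sup>2)) < \<infinity>"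
  shows "summable (\<lambda>k. \<bar>d k\<bar>)"
proof (rule summable_comparison_test')
  have "summable (\<lambda>k. 2 ^ k * (d k)\<^sup>2)"
    using assms by (intro summable_suminf_not_top) auto
  then show "summable (\<lambda>k. 2 ^ k * (d k)\<^sup>2 + (1 / 2) ^ k)"
    by (intro summable_add summable_geometric) auto
  fix k :: nat
  have "2 * (sqrt (2 ^ k) * \<bar>d k\<bar>) * (1 / sqrt (2 ^ k)) \<le> (sqrt (2 ^ k) * \<bar>d k\<bar>)\<^sup>2 + (1 / sqrt (2 ^ k))\<^sup>2"
    by (rule sum_squares_bound)
  then have "2 * \<bar>d k\<bar> \<le> 2 ^ k * (d k)\<^sup>2 + (1 / 2) ^ k"
    by (simp add: power_mult_distrib power_divide power_one_over)
  then show "norm \<bar>d k\<bar> \<le> 2 ^ k * (d k)\<^sup>2 + (1 / 2) ^ k" by simp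
qed

text \<open>Completeness of L^2 for this family: along rapidly chosen radii the transforms converge
  almost everywhere to \<open>G\<close>, and Fatou's lemma transfers the Cauchy bound to
  \<open>G\<close> for every \<open>R\<close>.\<close>

lemma ex_L2_fourier:
  assumes [measurable]: "f \<in> borel_measurable borel" and fin: "sqnorm f < \<infinity>"
  obtains G where "G \<in> borel_measurable borel"
    "\<And>R. sqnorm (\<lambda>\<xi>. G \<xi> - ft (cutoff R f) \<xi>) \<le> sqnorm (\<lambda>x. f x - cutoff R f x)"
proof -
  note int = integrable_cutoff[OF assms(1,2)]
  define T where "T R = sqnorm (\<lambda>x. f x - cutoff R f x)" for R
  have T: "(T \<longlongrightarrow> 0) at_top" unfolding T_def[abs_def] by (rule tendsto_sqnorm_cutoff[OF assms])
  have "\<exists>r. \<forall>R\<ge>r. T R \<le> ennreal ((1 / 8) ^ k)" for k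
  proof -
    have "\<forall>\<^sub>F R in at_top. T R < ennreal ((1 / 8) ^ k)"
      using T by (intro order_tendstoD) auto
    then show ?thesis unfolding eventually_at_top_linorder by (meson less_imp_le)
  qed
  then obtain r where r: "\<And>k R. r k \<le> R \<Longrightarrow> T R \<le> ennreal ((1 / 8) ^ k)" by metis
  \<comment> \<open>Increasing radii that dominate both \<open>r k\<close> and \<open>k\<close>.
    Along them the differences decay like 8^(-k), which beats the weight 2^k used below.\<close>
  define \<rho> where "\<rho> k = (\<Sum>i\<le>k. \<bar>r i\<bar>) + real k" for k
  have \<rho>_mono: "\<rho> k \<le> \<rho> (Suc k)" for k by (simp add: \<rho>_def)
  have "\<bar>r k\<bar> \<le> (\<Sum>i\<le>k. \<bar>r i\<bar>)" for k by (rule member_le_sum) auto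
  then have \<rho>_r: "r k \<le> \<rho> k" for k unfolding \<rho>_def by (smt (verit) of_nat_0_le_iff)
  have \<rho>_n: "real k \<le> \<rho> k" for k by (simp add: \<rho>_def sum_nonneg)
  define F where "F k = ft (cutoff (\<rho> k) f)" for k
  have [measurable]: "F k \<in> borel_measurable borel" for k unfolding F_def by (rule borel_measurable_ft[OF int])
  have FT: "sqnorm (\<lambda>\<xi>. F (Suc k) \<xi> - F k \<xi>) \<le> ennreal ((1 / 8) ^ k)" for k
    unfolding F_def using sqnorm_ft_cutoff_diff[OF assms \<rho>_mono[of k]] r[OF \<rho>_r[of k]]
    by (simp add: T_def)
  have "(\<integral>\<^sup>+ \<xi>. (\<Sum>k. ennreal (2 ^ k * (cmod (F (Suc k) \<xi> - F k \<xi>))\<^sup>2)) \<partial>lborel)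
      = (\<Sum>k. \<integral>\<^sup>+ \<xi>. ennreal (2 ^ k * (cmod (F (Suc k) \<xi> - F k \<xi>))\<^sup>2) \<partial>lborel)"
    by (intro nn_integral_suminf) measurable
  also have "\<dots> = (\<Sum>k. ennreal (2 ^ k) * sqnorm (\<lambda>\<xi>. F (Suc k) \<xi> - F k \<xi>))"
    by (simp add: ennreal_mult' nn_integral_cmult sqnorm_def)
  also have "\<dots> \<le> (\<Sum>k. ennreal ((1 / 4) ^ k))"
  proof (intro suminf_le allI)
    fix k
    have "ennreal (2 ^ k) * sqnorm (\<lambda>\<xi>. F (Suc k) \<xi> - F k \<xi>) \<le> ennreal (2 ^ k) * ennreal ((1 / 8) ^ k)"
      by (intro mult_left_mono FT) auto
    also have "\<dots> = ennreal ((1 / 4) ^ k)"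
      by (simp flip: ennreal_mult power_mult_distrib)
    finally show "ennreal (2 ^ k) * sqnorm (\<lambda>\<xi>. F (Suc k) \<xi> - F k \<xi>) \<le> ennreal ((1 / 4) ^ k)" .
  qed auto
  also have "\<dots> = ennreal (\<Sum>k. (1 / 4) ^ k)"
    by (intro suminf_ennreal_eq summable_sums summable_geometric) auto
  also have "\<dots> < \<infinity>" by simp
  finally have "AE \<xi> in lborel. (\<Sum>k. ennreal (2 ^ k * (cmod (F (Suc k) \<xi> - F k \<xi>))\<^sup>2)) \<noteq> \<infinity>"
    by (intro nn_integral_PInf_AE) auto
  then have conv: "AE \<xi> in lborel. convergent (\<lambda>k. F k \<xi>)"
  proof eventually_elim
    case (elim \<xi>)
    then have "summable (\<lambda>k. \<bar>cmod (F (Suc k) \<xi> - F k \<xi>)\<bar>)"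
      by (intro summable_if_weighted_squares) (simp add: top.not_eq_extremum)
    then have "summable (\<lambda>k. F (Suc k) \<xi> - F k \<xi>)"
      using summable_norm_cancel[of "\<lambda>k. F (Suc k) \<xi> - F k \<xi>"] by simp
    then have "convergent (\<lambda>n. \<Sum>k<n. F (Suc k) \<xi> - F k \<xi>)"
      by (simp add: summable_iff_convergent)
    then have "convergent (\<lambda>n. F n \<xi> - F 0 \<xi>)" by (simp only: sum_lessThan_telescope[of "\<lambda>k. F k \<xi>"])
    then have "convergent (\<lambda>n. (F n \<xi> - F 0 \<xi>) + F 0 \<xi>)" by (intro convergent_add convergent_const)
    then show ?case by simp
  qed
  define G where "G \<xi> = lim (\<lambda>k. F k \<xi>)" for \<xi>
  have [measurable]: "G \<in> borel_measurable borel" unfolding G_def by measurable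
  show ?thesis
  proof (rule that[OF \<open>G \<in> borel_measurable borel\<close>])
    fix R
    have [measurable]: "ft (cutoff R f) \<in> borel_measurable borel" by (rule borel_measurable_ft[OF int])
    have "sqnorm (\<lambda>\<xi>. G \<xi> - ft (cutoff R f) \<xi>)
        = (\<integral>\<^sup>+ \<xi>. liminf (\<lambda>k. ennreal ((cmod (F k \<xi> - ft (cutoff R f) \<xi>))\<^sup>2)) \<partial>lborel)"
      unfolding sqnorm_def
    proof (rule nn_integral_cong_AE, use conv in eventually_elim)
      case (elim \<xi>)
      then have "(\<lambda>k. F k \<xi>) \<longlonglongrightarrow> G \<xi>" by (simp add: G_def convergent_LIMSEQ_iff)
      then have "(\<lambda>k. ennreal ((cmod (F k \<xi> - ft (cutoff R f) \<xi>))\<^sup>2)) \<longlonglongrightarrow> ennreal ((cmod (G \<xi> - ft (cutoff R f) \<xi>))\<^sup>2)"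
        by (intro tendsto_intros tendsto_ennrealI)
      then show ?case by (subst lim_imp_Liminf) auto
    qed
    also have "\<dots> \<le> liminf (\<lambda>k. sqnorm (\<lambda>\<xi>. F k \<xi> - ft (cutoff R f) \<xi>))"
      unfolding sqnorm_def by (intro nn_integral_liminf) measurable
    also have "\<dots> \<le> sqnorm (\<lambda>x. f x - cutoff R f x)"
    proof (rule Liminf_le)
      obtain N where N: "R \<le> real N" using real_arch_simple by blast
      have "sqnorm (\<lambda>\<xi>. F k \<xi> - ft (cutoff R f) \<xi>) \<le> sqnorm (\<lambda>x. f x - cutoff R f x)" if "k \<ge> N" for k
        unfolding F_def using N \<rho>_n[of k] that by (intro sqnorm_ft_cutoff_diff[OF assms]) linarith
      then show "\<forall>\<^sub>F k in sequentially. sqnorm (\<lambda>\<xi>. F k \<xi> - ft (cutoff R f) \<xi>) \<le> sqnorm (\<lambda>x. f x - cutoff R f x)"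
        unfolding eventually_sequentially by blast
    qed simp
    finally show "sqnorm (\<lambda>\<xi>. G \<xi> - ft (cutoff R f) \<xi>) \<le> sqnorm (\<lambda>x. f x - cutoff R f x)" .
  qed
qed

text \<open>The choice in \<open>L2_fourier\<close> is made from a nonempty set, so its defining
  properties hold for whichever representative is chosen.\<close>

lemma L2_fourier_props:
  assumes "L2 f"
  shows "L2 (L2_fourier f)"
    and "((\<lambda>R. L2_norm_sq (\<lambda>\<xi>. L2_fourier f \<xi> - trunc_fourier R f \<xi>)) \<longlongrightarrow> 0) at_top"
proof -
  obtain g where g: "g \<in> borel_measurable borel" "AE x in lborel. f x = g x"
    using lebesgue_ex_borel assms unfolding L2_def by blast
  have fin: "sqnorm g < \<infinity>" using assms sqnorm_cong_AE[OF g(2)] by (simp add: L2_def L2_norm_sq_eq_sqnorm)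
  obtain G where G: "G \<in> borel_measurable borel"
    "\<And>R. sqnorm (\<lambda>\<xi>. G \<xi> - ft (cutoff R g) \<xi>) \<le> sqnorm (\<lambda>x. g x - cutoff R g x)"
    using ex_L2_fourier[OF g(1) fin] by blast
  have tr: "trunc_fourier R f = ft (cutoff R g)" for R
    using assms g by (intro trunc_fourier_eq_ft) (auto simp: L2_def)
  have int: "integrable lborel (cutoff 0 g)" by (rule integrable_cutoff[OF g(1) fin])
  have "sqnorm G \<le> 2 * sqnorm (ft (cutoff 0 g)) + 2 * sqnorm (\<lambda>\<xi>. G \<xi> - ft (cutoff 0 g) \<xi>)"
    by (rule sqnorm_diff_le[OF G(1) borel_measurable_ft[OF int]])
  also have "sqnorm (ft (cutoff 0 g)) = sqnorm (cutoff 0 g)"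
    using fin sqnorm_cutoff_le[of 0 g] by (intro plancherel int) (rule le_less_trans)
  also have "2 * sqnorm (cutoff 0 g) + 2 * sqnorm (\<lambda>\<xi>. G \<xi> - ft (cutoff 0 g) \<xi>) \<le> 2 * sqnorm g + 2 * sqnorm g"
    using G(2)[of 0] by (intro add_mono mult_left_mono sqnorm_cutoff_le order_trans[OF G(2)])
      (auto simp: sqnorm_def cutoff_def intro!: nn_integral_mono)
  also have "\<dots> < \<infinity>" using fin by (simp add: ennreal_mult_less_top)
  finally have "L2 G" using G(1) by (simp add: L2_def L2_norm_sq_eq_sqnorm borel_imp_lebesgue_measurable)
  moreover have "((\<lambda>R. L2_norm_sq (\<lambda>\<xi>. G \<xi> - trunc_fourier R f \<xi>)) \<longlongrightarrow> 0) at_top"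
    unfolding L2_norm_sq_eq_sqnorm tr
    by (rule tendsto_sandwich[OF _ _ tendsto_const tendsto_sqnorm_cutoff[OF g(1) fin]])
      (use G(2) in auto)
  ultimately have "\<exists>G. L2 G \<and> ((\<lambda>R. L2_norm_sq (\<lambda>\<xi>. G \<xi> - trunc_fourier R f \<xi>)) \<longlongrightarrow> 0) at_top" by blast
  then have "L2 (L2_fourier f) \<and> ((\<lambda>R. L2_norm_sq (\<lambda>\<xi>. L2_fourier f \<xi> - trunc_fourier R f \<xi>)) \<longlongrightarrow> 0) at_top"
    unfolding L2_fourier_def by (rule someI_ex)
  then show "L2 (L2_fourier f)"
    "((\<lambda>R. L2_norm_sq (\<lambda>\<xi>. L2_fourier f \<xi> - trunc_fourier R f \<xi>)) \<longlongrightarrow> 0) at_top" by auto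
qed

text \<open>The transforms of the cutoffs converge to \<open>v\<close>, and Plancherel for each
  cutoff passes to the limit. \<open>sqnorm_diff_le\<close> costs the factor 2, which ends up in the
  observability constant.\<close>

lemma L2_norm_sq_le_L2_fourier:
  assumes "L2 f" and v[measurable]: "v \<in> borel_measurable borel" "AE x in lborel. L2_fourier f x = v x"
  shows "L2_norm_sq f \<le> 2 * sqnorm v"
proof -
  obtain g where g[measurable]: "g \<in> borel_measurable borel" "AE x in lborel. f x = g x"
    using lebesgue_ex_borel assms unfolding L2_def by blast
  have fin: "sqnorm g < \<infinity>" using assms sqnorm_cong_AE[OF g(2)] by (simp add: L2_def L2_norm_sq_eq_sqnorm)
  have tr: "trunc_fourier R f = ft (cutoff R g)" for R
    using assms g by (intro trunc_fourier_eq_ft) (auto simp: L2_def)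
  note int = integrable_cutoff[OF g(1) fin]
  have "((\<lambda>R. sqnorm (\<lambda>\<xi>. L2_fourier f \<xi> - ft (cutoff R g) \<xi>)) \<longlongrightarrow> 0) at_top"
    using L2_fourier_props(2)[OF assms(1)] by (simp add: L2_norm_sq_eq_sqnorm tr)
  moreover have "sqnorm (\<lambda>\<xi>. L2_fourier f \<xi> - ft (cutoff R g) \<xi>) = sqnorm (\<lambda>\<xi>. ft (cutoff R g) \<xi> - v \<xi>)" for R
    unfolding sqnorm_def using v(2) by (intro nn_integral_cong_AE) (auto simp: norm_minus_commute)
  ultimately have lim: "((\<lambda>R. sqnorm (\<lambda>\<xi>. ft (cutoff R g) \<xi> - v \<xi>)) \<longlongrightarrow> 0) at_top" by simp
  have "(\<lambda>n. 2 * sqnorm v + 2 * sqnorm (\<lambda>\<xi>. ft (cutoff (real n) g) \<xi> - v \<xi>)) \<longlonglongrightarrow> 2 * sqnorm v + 2 * 0"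
    by (intro tendsto_add tendsto_const ennreal_tendsto_cmult filterlim_compose[OF lim filterlim_real_sequentially]) simp
  moreover have "(\<lambda>n. sqnorm (cutoff (real n) g)) \<longlonglongrightarrow> sqnorm g"
    unfolding sqnorm_def
  proof (rule nn_integral_LIMSEQ)
    show "incseq (\<lambda>n x. ennreal ((cmod (cutoff (real n) g x))\<^sup>2))"
      by (intro incseq_SucI le_funI ennreal_leI) (auto simp: cutoff_def)
    show "(\<lambda>n. ennreal ((cmod (cutoff (real n) g x))\<^sup>2)) \<longlonglongrightarrow> ennreal ((cmod (g x))\<^sup>2)" for x
    proof (rule tendsto_eventually)
      obtain N where "\<bar>x\<bar> \<le> real N" using real_arch_simple by blast
      then have "\<forall>n\<ge>N. ennreal ((cmod (cutoff (real n) g x))\<^sup>2) = ennreal ((cmod (g x))\<^sup>2)"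
        by (force simp: cutoff_def)
      then show "\<forall>\<^sub>F n in sequentially. ennreal ((cmod (cutoff (real n) g x))\<^sup>2) = ennreal ((cmod (g x))\<^sup>2)"
        unfolding eventually_sequentially by blast
    qed
  qed measurable
  moreover have "sqnorm (cutoff (real n) g) \<le> 2 * sqnorm v + 2 * sqnorm (\<lambda>\<xi>. ft (cutoff (real n) g) \<xi> - v \<xi>)" for n
  proof -
    have "sqnorm (cutoff (real n) g) = sqnorm (ft (cutoff (real n) g))"
      using fin sqnorm_cutoff_le[of "real n" g] by (intro plancherel[symmetric] int) (rule le_less_trans)
    then show ?thesis using sqnorm_diff_le[OF borel_measurable_ft[OF int] v(1)] by simp
  qed
  ultimately have "sqnorm g \<le> 2 * sqnorm v + 2 * 0"
    by (intro LIMSEQ_le) auto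
  then show ?thesis using sqnorm_cong_AE[OF g(2)] by (simp add: L2_norm_sq_eq_sqnorm)
qed

section \<open>Agreement of the two transforms, and the solution as a Fourier integral\<close>

lemma L2_fourier_cong:
  assumes "f \<in> borel_measurable lebesgue" "g \<in> borel_measurable borel" "AE x in lborel. f x = g x"
  shows "L2_fourier f = L2_fourier g"
proof -
  have "trunc_fourier R f = trunc_fourier R g" for R
    using assms by (simp add: trunc_fourier_eq_ft borel_imp_lebesgue_measurable)
  then show ?thesis unfolding L2_fourier_def by simp
qed

text \<open>Both functions are L^2 limits of the transforms of the cutoffs, one by the choice in
  \<open>L2_fourier\<close>, the other by Plancherel.\<close>

lemma L2_fourier_eq_ft:
  assumes f: "integrable lborel f" and fin: "sqnorm f < \<infinity>"
  shows "AE \<xi> in lborel. L2_fourier f \<xi> = ft f \<xi>"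
proof -
  have [measurable]: "f \<in> borel_measurable borel" using f by (auto dest: borel_measurable_integrable)
  have [measurable]: "ft f \<in> borel_measurable borel" using f by (rule borel_measurable_ft)
  have L2: "L2 f" using fin by (simp add: L2_def L2_norm_sq_eq_sqnorm borel_imp_lebesgue_measurable)
  obtain v where v[measurable]: "v \<in> borel_measurable borel" "AE x in lborel. L2_fourier f x = v x"
    using lebesgue_ex_borel L2_fourier_props(1)[OF L2] unfolding L2_def by blast
  note int = integrable_cutoff[OF \<open>f \<in> borel_measurable borel\<close> fin]
  have tr: "trunc_fourier R f = ft (cutoff R f)" for R
    by (intro trunc_fourier_eq_ft borel_imp_lebesgue_measurable) auto
  have "sqnorm (\<lambda>\<xi>. L2_fourier f \<xi> - trunc_fourier R f \<xi>) = sqnorm (\<lambda>\<xi>. v \<xi> - ft (cutoff R f) \<xi>)" for R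
    unfolding sqnorm_def using v(2) by (intro nn_integral_cong_AE) (auto simp: tr)
  then have lim1: "((\<lambda>R. sqnorm (\<lambda>\<xi>. v \<xi> - ft (cutoff R f) \<xi>)) \<longlongrightarrow> 0) at_top"
    using L2_fourier_props(2)[OF L2] by (simp add: L2_norm_sq_eq_sqnorm)
  have pl: "sqnorm (\<lambda>\<xi>. ft f \<xi> - ft (cutoff R f) \<xi>) = sqnorm (\<lambda>x. f x - cutoff R f x)" for R
  proof -
    have "sqnorm (\<lambda>x. f x - cutoff R f x) \<le> sqnorm f"
      unfolding sqnorm_def cutoff_def by (intro nn_integral_mono ennreal_leI power_mono) auto
    then have "sqnorm (ft (\<lambda>x. f x - cutoff R f x)) = sqnorm (\<lambda>x. f x - cutoff R f x)"
      using fin by (intro plancherel Bochner_Integration.integrable_diff f int) (rule le_less_trans)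
    then show ?thesis by (simp add: ft_diff[OF f int, abs_def])
  qed
  have "sqnorm (\<lambda>\<xi>. v \<xi> - ft f \<xi>) \<le> 2 * sqnorm (\<lambda>\<xi>. v \<xi> - ft (cutoff R f) \<xi>) + 2 * sqnorm (\<lambda>x. f x - cutoff R f x)" for R
  proof -
    have [measurable]: "ft (cutoff R f) \<in> borel_measurable borel" by (rule borel_measurable_ft[OF int])
    show ?thesis
      using sqnorm_diff_le[of "\<lambda>\<xi>. v \<xi> - ft f \<xi>" "\<lambda>\<xi>. v \<xi> - ft (cutoff R f) \<xi>"] pl[of R]
      by (simp add: sqnorm_def norm_minus_commute)
  qed
  moreover have "((\<lambda>R. 2 * sqnorm (\<lambda>\<xi>. v \<xi> - ft (cutoff R f) \<xi>) + 2 * sqnorm (\<lambda>x. f x - cutoff R f x)) \<longlongrightarrow> 2 * 0 + 2 * 0) at_top"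
    by (intro tendsto_add ennreal_tendsto_cmult lim1 tendsto_sqnorm_cutoff fin) auto
  ultimately have "sqnorm (\<lambda>\<xi>. v \<xi> - ft f \<xi>) \<le> 2 * 0 + 2 * 0"
    by (intro tendsto_lowerbound[where F=at_top]) auto
  then have "AE \<xi> in lborel. ennreal ((cmod (v \<xi> - ft f \<xi>))\<^sup>2) = 0"
    unfolding sqnorm_def by (subst nn_integral_0_iff_AE[symmetric]) auto
  then show ?thesis using v(2) by eventually_elim simp
qed

text \<open>A null open set is empty; this is the uniqueness behind the \<open>THE\<close> in
  \<open>continuous_representative\<close>.\<close>

lemma continuous_AE_eq:
  fixes f g :: "real \<Rightarrow> complex"
  assumes "continuous_on UNIV f" "continuous_on UNIV g" "AE x in lebesgue. f x = g x"
  shows "f = g"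
proof -
  have "open {x. f x \<noteq> g x}" by (intro open_Collect_neq assms)
  moreover have "negligible {x. f x \<noteq> g x}"
    unfolding negligible_iff_null_sets
    using assms(3) calculation by (subst AE_iff_null_sets) (simp_all add: borel_open)
  ultimately have "{x. f x \<noteq> g x} = {}" using open_not_negligible by blast
  then show ?thesis by auto
qed

lemma AE_lborel_uminus:
  assumes "AE x in lborel. P (x :: real)"
  shows "AE x in lborel. P (- x)"
proof -
  obtain N where N: "\<And>x. x \<in> space lborel - N \<Longrightarrow> P x" "N \<in> null_sets lborel"
    using AE_E3[OF assms] by blast
  have "AE x in distr lborel borel (uminus :: real \<Rightarrow> real). x \<notin> N"
    unfolding lborel_distr_uminus by (rule AE_not_in[OF N(2)])
  then have "AE x in lborel. - x \<notin> N"
    by (subst (asm) AE_distr_iff) (use N in auto)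
  then show ?thesis by eventually_elim (use N in auto)
qed

text \<open>For integrable \<open>v\<close> the inverse Fourier integral is continuous in
  \<open>x\<close>, so it is the representative that \<open>schrodinger_solution\<close> selects,
  and the formula holds at every point.\<close>

lemma schrodinger_solution_eq:
  assumes L2: "L2 u" and v: "integrable lborel v" "sqnorm v < \<infinity>"
    and eq: "AE \<xi> in lborel. L2_fourier u \<xi> = v \<xi>"
  shows "schrodinger_solution u t x = ft (\<lambda>\<xi>. cis (- (t * \<xi>\<^sup>2)) * v \<xi>) (- x)"
proof -
  define w where "w = (\<lambda>\<xi>. cis (- (t * \<xi>\<^sup>2)) * v \<xi>)"
  have [measurable]: "v \<in> borel_measurable borel" using v by (auto dest: borel_measurable_integrable)
  have w: "integrable lborel w"
    by (rule Bochner_Integration.integrable_bound[OF v(1)]) (auto simp: w_def norm_mult)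
  have wfin: "sqnorm w < \<infinity>" using v(2) by (simp add: sqnorm_def w_def norm_mult)
  have "L2_fourier (\<lambda>\<xi>. cis (- (t * \<xi>\<^sup>2)) * L2_fourier u \<xi>) = L2_fourier w"
  proof (rule L2_fourier_cong)
    show "(\<lambda>\<xi>. cis (- (t * \<xi>\<^sup>2)) * L2_fourier u \<xi>) \<in> borel_measurable lebesgue"
      using L2_fourier_props(1)[OF L2]
      by (intro borel_measurable_times borel_imp_lebesgue_measurable[of "\<lambda>\<xi>. cis (- (t * \<xi>\<^sup>2))"]) (auto simp: L2_def)
    show "AE x in lborel. cis (- (t * x\<^sup>2)) * L2_fourier u x = w x"
      using eq by eventually_elim (simp add: w_def)
  qed (simp add: w_def)
  then have prop_eq: "schrodinger_propagator t u = (\<lambda>x. L2_fourier w (- x))"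
    by (simp add: schrodinger_propagator_def L2_inverse_fourier_def)
  have ae: "AE x in lebesgue. ft w (- x) = L2_fourier w (- x)"
  proof -
    have "AE x in lborel. L2_fourier w (- x) = ft w (- x)"
      using L2_fourier_eq_ft[OF w wfin] by (rule AE_lborel_uminus)
    then show ?thesis unfolding AE_completion_iff by eventually_elim simp
  qed
  have cont: "continuous_on UNIV (\<lambda>x. ft w (- x))"
    by (intro continuous_on_compose2[OF continuous_on_ft[OF w]] continuous_intros) auto
  have "schrodinger_solution u t = (\<lambda>x. ft w (- x))"
    unfolding schrodinger_solution_def continuous_representative_def prop_eq
  proof (rule the_equality)
    show "continuous_on UNIV (\<lambda>x. ft w (- x)) \<and> (AE x in lebesgue. ft w (- x) = L2_fourier w (- x))"
      using cont ae by blast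
    fix g assume g: "continuous_on UNIV g \<and> (AE x in lebesgue. g x = L2_fourier w (- x))"
    have "AE x in lebesgue. g x = ft w (- x)"
      using ae conjunct2[OF g] by eventually_elim simp
    with g cont show "g = (\<lambda>x. ft w (- x))" by (intro continuous_AE_eq) auto
  qed
  then show ?thesis by (simp add: w_def)
qed

text \<open>The Sobolev bound with \<open>k = 1\<close> makes the transform integrable, by AM-GM
  between \<open>(1 + \<xi>^2) * |v|^2\<close> and \<open>1 / (1 + \<xi>^2)\<close>. In part (i) the
  data are then represented by \<open>v\<close> alone.\<close>

lemma sobolev_fourier_side:
  assumes "u \<in> (\<Inter>k. sobolev k)"
  obtains v where "integrable lborel v" "sqnorm v < \<infinity>" "L2_norm_sq u \<le> 2 * sqnorm v"
    "\<And>t x. schrodinger_solution u t x = ft (\<lambda>\<xi>. cis (- (t * \<xi>\<^sup>2)) * v \<xi>) (- x)"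
proof -
  have L2: "L2 u" and fin1: "(\<integral>\<^sup>+ \<xi>. ennreal ((1 + \<xi>\<^sup>2) ^ 1 * (cmod (L2_fourier u \<xi>))\<^sup>2) \<partial>lebesgue) < \<infinity>"
    using INT_D[OF assms UNIV_I, of 1] by (auto simp: sobolev_def)
  obtain v where v[measurable]: "v \<in> borel_measurable borel" "AE x in lborel. L2_fourier u x = v x"
    using lebesgue_ex_borel L2_fourier_props(1)[OF L2] unfolding L2_def by blast
  have fin: "sqnorm v < \<infinity>"
    using L2_fourier_props(1)[OF L2] sqnorm_cong_AE[OF v(2)] by (simp add: L2_def L2_norm_sq_eq_sqnorm)
  have "(\<integral>\<^sup>+ \<xi>. ennreal ((1 + \<xi>\<^sup>2) * (cmod (v \<xi>))\<^sup>2) \<partial>lborel)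
      = (\<integral>\<^sup>+ \<xi>. ennreal ((1 + \<xi>\<^sup>2) ^ 1 * (cmod (L2_fourier u \<xi>))\<^sup>2) \<partial>lborel)"
    using v(2) by (intro nn_integral_cong_AE) auto
  then have fin1': "(\<integral>\<^sup>+ \<xi>. ennreal ((1 + \<xi>\<^sup>2) * (cmod (v \<xi>))\<^sup>2) \<partial>lborel) < \<infinity>"
    using fin1 by (simp add: nn_integral_completion)
  have int: "integrable lborel v"
  proof (rule Bochner_Integration.integrable_bound)
    have "integrable lborel (\<lambda>\<xi>::real. inverse (1 + \<xi>\<^sup>2))"
      using integrable_inverse_1_plus_square by (simp add: set_integrable_def einterval_def)
    moreover have "integrable lborel (\<lambda>\<xi>. (1 + \<xi>\<^sup>2) * (cmod (v \<xi>))\<^sup>2)"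
      using fin1' by (intro integrableI_nonneg) auto
    ultimately show "integrable lborel (\<lambda>\<xi>. (1 + \<xi>\<^sup>2) * (cmod (v \<xi>))\<^sup>2 + inverse (1 + \<xi>\<^sup>2))"
      by (intro Bochner_Integration.integrable_add)
    have "cmod (v \<xi>) \<le> (1 + \<xi>\<^sup>2) * (cmod (v \<xi>))\<^sup>2 + inverse (1 + \<xi>\<^sup>2)" for \<xi>
    proof -
      define q where "q = sqrt (1 + \<xi>\<^sup>2)"
      have q: "q > 0" "q\<^sup>2 = 1 + \<xi>\<^sup>2" by (auto simp: q_def add_pos_nonneg)
      have "2 * (q * cmod (v \<xi>)) * (1 / q) \<le> (q * cmod (v \<xi>))\<^sup>2 + (1 / q)\<^sup>2" by (rule sum_squares_bound)
      then have "2 * cmod (v \<xi>) \<le> (1 + \<xi>\<^sup>2) * (cmod (v \<xi>))\<^sup>2 + inverse (1 + \<xi>\<^sup>2)"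
        using q by (simp add: power_mult_distrib power_divide inverse_eq_divide)
      then show ?thesis using norm_ge_zero[of "v \<xi>"] by linarith
    qed
    then show "AE \<xi> in lborel. norm (v \<xi>) \<le> norm ((1 + \<xi>\<^sup>2) * (cmod (v \<xi>))\<^sup>2 + inverse (1 + \<xi>\<^sup>2))"
      by (intro AE_I2) (simp add: order_trans[OF _ abs_ge_self])
  qed measurable
  show ?thesis
    using that[OF int fin L2_norm_sq_le_L2_fourier[OF L2 v] schrodinger_solution_eq[OF L2 int fin v(2)]] .
qed

section \<open>An uncertainty principle for thin sets\<close>

lemma has_bochner_integral_exp_halfline:
  assumes "0 < Re c"
  shows "has_bochner_integral lborel (\<lambda>s::real. indicator {0..} s *\<^sub>R exp (- c * of_real s)) (1 / c)"
proof -
  have c: "c \<noteq> 0" using assms by auto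
  have real: "integrable lborel (\<lambda>s::real. indicator {0..} s *\<^sub>R exp (- Re c * s))"
    using has_bochner_integral_I0i_power_exp_m'[of 0]
  proof -
    have "(\<integral>\<^sup>+ s. ennreal (exp (- Re c * s)) * indicator {0..} s \<partial>lborel) = ennreal (0 - (- exp (- Re c * 0) / Re c))"
    proof (rule nn_integral_FTC_atLeast)
      show "((\<lambda>s. - exp (- Re c * s) / Re c) has_real_derivative exp (- Re c * s)) (at s)" for s
        using assms by (auto intro!: derivative_eq_intros)
      have "filterlim (\<lambda>s. - (Re c * s)) at_bot at_top"
        unfolding filterlim_uminus_at_bot
        using assms by (auto intro!: filterlim_tendsto_pos_mult_at_top[OF tendsto_const] filterlim_ident)
      then have "((\<lambda>s. exp (- (Re c * s))) \<longlongrightarrow> 0) at_top" by (rule filterlim_compose[OF exp_at_bot])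
      from tendsto_divide[OF tendsto_minus[OF this] tendsto_const[of "Re c"]]
      show "((\<lambda>s. - exp (- Re c * s) / Re c) \<longlongrightarrow> 0) at_top" using assms by simp
    qed auto
    then show ?thesis
      by (intro integrableI_nonneg) (auto simp: ennreal_mult' ennreal_indicator mult.commute intro: le_less_trans)
  qed
  have int: "integrable lborel (\<lambda>s::real. indicator {0..} s *\<^sub>R exp (- c * of_real s))"
    by (rule Bochner_Integration.integrable_bound[OF real]) (auto simp: norm_mult split: split_indicator)
  have "(LBINT s=0..\<infinity>. exp (- c * of_real s)) = 0 - (- 1 / c)"
  proof (rule interval_integral_FTC_integrable[where F="\<lambda>s. - exp (- c * of_real s) / c"])
    show "((\<lambda>s::real. - exp (- c * of_real s) / c) has_vector_derivative exp (- c * of_real s)) (at s)" for s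
    proof -
      have "((\<lambda>s. - exp (- c * s) / c) has_field_derivative exp (- c * of_real s)) (at (of_real s))"
        using c by (auto intro!: derivative_eq_intros)
      then show ?thesis by (rule has_vector_derivative_real_field)
    qed
    show "isCont (\<lambda>s::real. exp (- c * of_real s)) s" for s by (intro continuous_intros)
    show "set_integrable lborel (einterval 0 \<infinity>) (\<lambda>s. exp (- c * of_real s))"
      unfolding set_integrable_def
      by (rule Bochner_Integration.integrable_bound[OF int]) (auto simp: einterval_def split: split_indicator)
    have "((\<lambda>s::real. - exp (- c * of_real s) / c) \<longlongrightarrow> - exp (- c * of_real 0) / c) (at_right 0)"
      using c by (intro tendsto_intros) auto
    then show "(((\<lambda>s::real. - exp (- c * of_real s) / c) \<circ> real_of_ereal) \<longlongrightarrow> - 1 / c) (at_right 0)"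
      unfolding zero_ereal_def by (simp add: ereal_tendsto_simps)
    have "filterlim (\<lambda>s. - (Re c * s)) at_bot at_top"
      unfolding filterlim_uminus_at_bot
      using assms by (auto intro!: filterlim_tendsto_pos_mult_at_top[OF tendsto_const] filterlim_ident)
    then have "((\<lambda>s. exp (- (Re c * s))) \<longlongrightarrow> 0) at_top" by (rule filterlim_compose[OF exp_at_bot])
    then have "((\<lambda>s::real. norm (exp (- c * of_real s))) \<longlongrightarrow> 0) at_top"
      by (simp add: norm_exp)
    then have "((\<lambda>s::real. exp (- c * of_real s)) \<longlongrightarrow> 0) at_top"
      by (rule tendsto_norm_zero_cancel)
    from tendsto_divide[OF tendsto_minus[OF this] tendsto_const[of c]]
    show "(((\<lambda>s::real. - exp (- c * of_real s) / c) \<circ> real_of_ereal) \<longlongrightarrow> 0) (at_left \<infinity>)"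
      using c by (simp add: ereal_tendsto_simps)
  qed auto
  then have "(LINT s|lborel. indicator {0<..} s *\<^sub>R exp (- c * of_real s)) = 1 / c"
    by (simp add: interval_lebesgue_integral_def set_lebesgue_integral_def einterval_def zero_ereal_def greaterThan_def)
  also have "(LINT s|lborel. indicator {0<..} s *\<^sub>R exp (- c * of_real s)) = (LINT s|lborel. indicator {0..} s *\<^sub>R exp (- c * of_real s))"
    using AE_lborel_singleton[of "0::real"]
    by (intro integral_cong_AE) (auto elim!: eventually_mono split: split_indicator)
  finally show ?thesis using int by (simp add: has_bochner_integral_iff)
qed

text \<open>With \<open>c\<close> = a + i \<xi> the two half-lines give \<open>1 / c\<close> and
  \<open>1 / cnj c\<close>, whose sum is \<open>2 * a / (a^2 + \<xi>^2)\<close>. At \<xi> = 0 this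
  says that the kernel has mass 1.\<close>

lemma has_bochner_integral_laplace_kernel:
  fixes a \<xi> :: real
  assumes "0 < a"
  shows "has_bochner_integral lborel (\<lambda>s. of_real (a / 2 * exp (- (a * \<bar>s\<bar>))) * cis (- (s * \<xi>)))
    (of_real (a\<^sup>2 / (a\<^sup>2 + \<xi>\<^sup>2)))"
proof -
  define c where "c = Complex a \<xi>"
  have c: "0 < Re c" "0 < Re (cnj c)" "c \<noteq> 0" using assms by (auto simp: c_def complex_eq_iff)
  let ?p = "\<lambda>s::real. indicator {0..} s *\<^sub>R exp (- c * of_real s) :: complex"
  let ?q = "\<lambda>s::real. indicator {0..} s *\<^sub>R exp (- cnj c * of_real s) :: complex"
  have q: "has_bochner_integral lborel (\<lambda>s. ?q (- s)) (1 / cnj c)"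
    using lborel_has_bochner_integral_real_affine_iff[of "-1" ?q "1 / cnj c" 0]
      has_bochner_integral_exp_halfline[OF c(2)] by simp
  have "has_bochner_integral lborel (\<lambda>s. of_real (a / 2) * (?p s + ?q (- s))) (of_real (a / 2) * (1 / c + 1 / cnj c))"
    by (intro has_bochner_integral_mult_right has_bochner_integral_add has_bochner_integral_exp_halfline c q)
  moreover have "of_real (a / 2) * (1 / c + 1 / cnj c) = of_real (a\<^sup>2 / (a\<^sup>2 + \<xi>\<^sup>2))"
  proof -
    have "1 / c + 1 / cnj c = (cnj c + c) / (c * cnj c)" using c by (simp add: field_simps)
    also have "c * cnj c = of_real (a\<^sup>2 + \<xi>\<^sup>2)" by (simp add: c_def complex_mult_cnj)
    also have "cnj c + c = of_real (2 * a)" by (simp add: c_def complex_eq_iff)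
    finally show ?thesis by (simp add: power2_eq_square)
  qed
  \<comment> \<open>At \<open>s = 0\<close> both closed half-lines count, hence equality only almost
    everywhere.\<close>
  moreover have "AE s in lborel. of_real (a / 2) * (?p s + ?q (- s)) = of_real (a / 2 * exp (- (a * \<bar>s\<bar>))) * cis (- (s * \<xi>))"
  proof (rule AE_mp[OF AE_lborel_singleton[of 0]], intro AE_I2 impI)
    fix s :: real assume "s \<noteq> 0"
    have e: "exp (- Complex a y * of_real r) = of_real (exp (- (a * r))) * cis (- (r * y))" for r y
      by (simp add: exp_of_real[symmetric] cis_conv_exp complex_eq_iff Complex_eq exp_add[symmetric] algebra_simps)
    show "of_real (a / 2) * (?p s + ?q (- s)) = of_real (a / 2 * exp (- (a * \<bar>s\<bar>))) * cis (- (s * \<xi>))"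
    proof (cases "0 < s")
      case True
      then show ?thesis using e[of \<xi> s] by (simp add: c_def)
    next
      case False
      then show ?thesis using e[of "-\<xi>" "-s"] \<open>s \<noteq> 0\<close> by (simp add: c_def complex_cnj)
    qed
  qed
  ultimately show ?thesis
    using has_bochner_integral_cong_AE[THEN iffD1, rotated 3,
        of lborel "\<lambda>s. of_real (a / 2) * (?p s + ?q (- s))" "of_real (a\<^sup>2 / (a\<^sup>2 + \<xi>\<^sup>2))"
          "\<lambda>s. of_real (a / 2 * exp (- (a * \<bar>s\<bar>))) * cis (- (s * \<xi>))"]
    by (simp only:) measurable
qed

lemma nn_integral_laplace_kernel:
  fixes a :: real
  assumes "0 \<le> a"
  shows "(\<integral>\<^sup>+ s. ennreal (a / 2 * exp (- (a * \<bar>s - t\<bar>))) \<partial>lborel) \<le> 1"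
proof (cases "a = 0")
  case False
  then have a: "0 < a" using assms by simp
  have "integrable lborel (\<lambda>s. Re (of_real (a / 2 * exp (- (a * \<bar>s\<bar>)))))"
    "(LINT s|lborel. Re (of_real (a / 2 * exp (- (a * \<bar>s\<bar>))))) = 1"
    using has_bochner_integral_Re[OF has_bochner_integral_laplace_kernel[OF a, of 0]] a
    by (auto simp: has_bochner_integral_iff power2_eq_square)
  then have "(\<integral>\<^sup>+ s. ennreal (a / 2 * exp (- (a * \<bar>s\<bar>))) \<partial>lborel) = 1"
    using a by (subst nn_integral_eq_integral) auto
  then show ?thesis
    using nn_integral_lborel_shift[of "\<lambda>s. ennreal (a / 2 * exp (- (a * \<bar>s\<bar>)))" t] by simp
qed simp

text \<open>The multiplier is an average of modulations, and a modulation of \<open>F\<close>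
  translates \<open>ft F\<close>; so it acts as convolution with the Laplace kernel. The estimate is
  pointwise in \<open>x\<close> because \<open>a\<close> will be chosen depending on
  \<open>x\<close>.\<close>

lemma low_pass_bound:
  assumes F: "integrable lborel F" and a: "0 \<le> (a::real)"
  shows "ennreal (cmod (of_real (1 / sqrt (2 * pi)) * (LINT \<xi>|lborel. cis (x * \<xi>) * F \<xi> * of_real (a\<^sup>2 / (a\<^sup>2 + \<xi>\<^sup>2)))))
    \<le> (\<integral>\<^sup>+ y. ennreal (a / 2 * exp (- (a * \<bar>y - x\<bar>)) * cmod (ft F (- y))) \<partial>lborel)"
proof (cases "a = 0")
  let ?I = "LINT \<xi>|lborel. cis (x * \<xi>) * F \<xi> * of_real (a\<^sup>2 / (a\<^sup>2 + \<xi>\<^sup>2))"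
  case False
  then have a: "0 < a" using assms by simp
  have [measurable]: "F \<in> borel_measurable borel" using F by (auto dest: borel_measurable_integrable)
  have [measurable]: "ft F \<in> borel_measurable borel" using F by (rule borel_measurable_ft)
  let ?k = "\<lambda>s. of_real (a / 2 * exp (- (a * \<bar>s\<bar>))) :: complex"
  have k: "integrable lborel ?k"
    using has_bochner_integral_laplace_kernel[OF a, of 0] by (simp add: has_bochner_integral_iff)
  have ip: "integrable (lborel \<Otimes>\<^sub>M lborel) (\<lambda>(\<xi>, s). cis (x * \<xi>) * F \<xi> * (?k s * cis (- (s * \<xi>))))"
    by (rule Bochner_Integration.integrable_bound[OF integrable_pair_mult[OF F k]])
      (auto simp: norm_mult)
  have "?I
      = (LINT \<xi>|lborel. LINT s|lborel. cis (x * \<xi>) * F \<xi> * (?k s * cis (- (s * \<xi>))))"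
    using has_bochner_integral_laplace_kernel[OF a, THEN has_bochner_integral_integral_eq]
    by (simp only: Bochner_Integration.integral_mult_right_zero)
  also have "\<dots> = (LINT s|lborel. LINT \<xi>|lborel. cis (x * \<xi>) * F \<xi> * (?k s * cis (- (s * \<xi>))))"
    using lborel_pair.Fubini_integral[OF ip] by simp
  also have "\<dots> = (LINT s|lborel. ?k s * (LINT \<xi>|lborel. cis (- (\<xi> * (s - x))) * F \<xi>))"
  proof -
    have "cis (x * \<xi>) * F \<xi> * (?k s * cis (- (s * \<xi>))) = ?k s * (cis (- (\<xi> * (s - x))) * F \<xi>)" for s \<xi>
    proof -
      have "cis (- (\<xi> * (s - x))) = cis (x * \<xi>) * cis (- (s * \<xi>))" by (simp add: cis_mult algebra_simps)
      then show ?thesis by simp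
    qed
    then show ?thesis by (simp only: Bochner_Integration.integral_mult_right_zero)
  qed
  finally have eq: "?I
    = (LINT s|lborel. ?k s * (LINT \<xi>|lborel. cis (- (\<xi> * (s - x))) * F \<xi>))" .
  have "of_real (1 / sqrt (2 * pi)) * ?I
    = (LINT s|lborel. ?k s * ft F (s - x))"
  proof -
    have "(LINT s|lborel. ?k s * ft F (s - x)) = (LINT s|lborel. of_real (1 / sqrt (2 * pi)) * (?k s * (LINT \<xi>|lborel. cis (- (\<xi> * (s - x))) * F \<xi>)))"
      unfolding ft_def by (simp only: mult.left_commute)
    then show ?thesis
      using eq
      by (simp only: Bochner_Integration.integral_mult_right_zero)
  qed
  moreover have "integrable lborel (\<lambda>s. ?k s * ft F (s - x))"
  proof (rule Bochner_Integration.integrable_bound)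
    show "integrable lborel (\<lambda>s. ?k s * of_real ((LINT x|lborel. cmod (F x)) / sqrt (2 * pi)))"
      using k by (rule integrable_mult_left)
    show "AE s in lborel. norm (?k s * ft F (s - x)) \<le> norm (?k s * of_real ((LINT x|lborel. cmod (F x)) / sqrt (2 * pi)))"
      unfolding norm_mult norm_of_real[of "_ / _"]
      by (intro AE_I2 mult_left_mono order_trans[OF norm_ft_le] abs_ge_self) auto
  qed measurable
  ultimately have "ennreal (cmod (of_real (1 / sqrt (2 * pi)) * ?I))
    \<le> (\<integral>\<^sup>+ s. ennreal (cmod (?k s * ft F (s - x))) \<partial>lborel)"
    by (simp only:) (rule integral_norm_bound_ennreal)
  also have "\<dots> = (\<integral>\<^sup>+ s. ennreal (a / 2 * exp (- (a * \<bar>s\<bar>)) * cmod (ft F (s - x))) \<partial>lborel)"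
    using a by (simp add: norm_mult)
  also have "\<dots> = (\<integral>\<^sup>+ y. ennreal (a / 2 * exp (- (a * \<bar>y - x\<bar>)) * cmod (ft F (- y))) \<partial>lborel)"
    using nn_integral_real_affine[of "\<lambda>s. ennreal (a / 2 * exp (- (a * \<bar>s\<bar>)) * cmod (ft F (s - x)))" "-1" x]
    by (simp add: abs_minus_commute)
  finally show ?thesis .
qed simp

text \<open>In \<open>y\<close> a Laplace density around \<open>x\<close> of width about 1 / (c
  |x|), and 0 for \<open>x = 0\<close>. It is not symmetric: its mass in \<open>y\<close> is at most
  1, while integrals in \<open>x\<close> require the estimates for thin sets below.\<close>

definition decay_kernel :: "real \<Rightarrow> real \<Rightarrow> real \<Rightarrow> real" where
  "decay_kernel c x y = c * \<bar>x\<bar> / 2 * exp (- (c * \<bar>x\<bar> * \<bar>y - x\<bar>))"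

lemma borel_measurable_decay_kernel [measurable]:
  assumes [measurable]: "f \<in> borel_measurable M" "g \<in> borel_measurable M"
  shows "(\<lambda>z. decay_kernel c (f z) (g z)) \<in> borel_measurable M"
  unfolding decay_kernel_def by measurable

lemma decay_kernel_nonneg: "0 \<le> c \<Longrightarrow> 0 \<le> decay_kernel c x y"
  by (simp add: decay_kernel_def)

lemma nn_integral_decay_kernel: "0 \<le> c \<Longrightarrow> (\<integral>\<^sup>+ y. ennreal (decay_kernel c x y) \<partial>lborel) \<le> 1"
  unfolding decay_kernel_def by (rule nn_integral_laplace_kernel) simp

definition kernel_form :: "real \<Rightarrow> (real \<Rightarrow> complex) \<Rightarrow> ennreal" where
  "kernel_form c f = (\<integral>\<^sup>+ x. \<integral>\<^sup>+ y. ennreal (cmod (f x) * decay_kernel c x y * cmod (f y)) \<partial>lborel \<partial>lborel)"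

text \<open>The phase space is split by the symbols \<open>x\<^sup>2 / (x\<^sup>2 + b\<^sup>2\<xi>\<^sup>2)\<close> and \<open>b\<^sup>2\<xi>\<^sup>2 / (x\<^sup>2 + b\<^sup>2\<xi>\<^sup>2)\<close>, whose sum is 1. For fixed
  \<open>x\<close> the first is a Fourier multiplier whose convolution kernel decays at scale \<open>b / \<bar>x\<bar>\<close>; the second has
  the same property with the two sides exchanged.\<close>

lemma sqnorm_le_kernel_forms:
  assumes h: "integrable lborel h" and H: "integrable lborel (ft h)" and b: "0 < b"
    and inv: "\<And>x. h x = ft (ft h) (- x)"
  shows "sqnorm h \<le> kernel_form (1 / b) h + kernel_form b (ft h)"
proof -
  define H where "H = ft h"
  have H: "integrable lborel H" and inv: "\<And>x. h x = ft H (- x)" using H inv by (auto simp: H_def)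
  have [measurable]: "h \<in> borel_measurable borel" "H \<in> borel_measurable borel"
    using h H by (auto dest: borel_measurable_integrable)
  define k where "k = complex_of_real (1 / sqrt (2 * pi))"
  define m where "m x \<xi> = x\<^sup>2 / (x\<^sup>2 + (b * \<xi>)\<^sup>2)" for x \<xi>
  define m' where "m' x \<xi> = (b * \<xi>)\<^sup>2 / ((b * \<xi>)\<^sup>2 + x\<^sup>2)" for x \<xi>
  have [measurable]: "(\<lambda>p. m (f p) (g p)) \<in> borel_measurable M" "(\<lambda>p. m' (f p) (g p)) \<in> borel_measurable M"
    if "f \<in> borel_measurable M" "g \<in> borel_measurable M" for f g and M :: "'x measure"
    using that unfolding m_def m'_def by measurable
  have m_bd: "0 \<le> m x \<xi>" "m x \<xi> \<le> 1" "0 \<le> m' x \<xi>" "m' x \<xi> \<le> 1" for x \<xi>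
  proof -
    have "0 \<le> p / (p + q) \<and> p / (p + q) \<le> 1" if "0 \<le> p" "0 \<le> q" for p q :: real
      using that by (cases "p + q = 0") (auto simp: divide_le_eq_1)
    then show "0 \<le> m x \<xi>" "m x \<xi> \<le> 1" "0 \<le> m' x \<xi>" "m' x \<xi> \<le> 1"
      unfolding m_def m'_def by (meson zero_le_power2)+
  qed
  \<comment> \<open>At x = \<xi> = 0 both quotients are \<open>0 / 0 = 0\<close>; since \<xi> = 0 is
    a null set, the symbols still add up to 1 under the integral.\<close>
  have m_sum: "m x \<xi> + m' x \<xi> = 1" if "\<xi> \<noteq> 0" for x \<xi>
  proof -
    have "x\<^sup>2 + (b * \<xi>)\<^sup>2 \<noteq> 0" using that b by (simp add: add_nonneg_eq_0_iff)
    then show ?thesis by (simp add: m_def m'_def add.commute flip: add_divide_distrib)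
  qed
  define L where "L x = k * (LINT \<xi>|lborel. cis (x * \<xi>) * H \<xi> * of_real (m x \<xi>))" for x
  define L' where "L' x = k * (LINT \<xi>|lborel. cis (x * \<xi>) * H \<xi> * of_real (m' x \<xi>))" for x
  \<comment> \<open>For fixed \<xi> the second symbol is a low-pass multiplier in \<open>x\<close>.
    Its part of the form is therefore moved to the frequency side by Fubini, where
    \<open>R \<xi>\<close> integrates over \<open>x\<close>.\<close>
  define R where "R \<xi> = k * (LINT x|lborel. cis (\<xi> * x) * cnj (h x) * of_real (m' x \<xi>))" for \<xi>
  have intH: "integrable lborel (\<lambda>\<xi>. cis (x * \<xi>) * H \<xi> * of_real (m x \<xi>))"
    "integrable lborel (\<lambda>\<xi>. cis (x * \<xi>) * H \<xi> * of_real (m' x \<xi>))" for x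
    using m_bd by (auto simp: norm_mult mult_left_le intro!: Bochner_Integration.integrable_bound[OF H])
  have split: "h x = L x + L' x" for x
  proof -
    have "(LINT \<xi>|lborel. cis (x * \<xi>) * H \<xi>) = (LINT \<xi>|lborel. cis (x * \<xi>) * H \<xi> * of_real (m x \<xi>) + cis (x * \<xi>) * H \<xi> * of_real (m' x \<xi>))"
    proof (rule integral_cong_AE)
      show "AE \<xi> in lborel. cis (x * \<xi>) * H \<xi> = cis (x * \<xi>) * H \<xi> * of_real (m x \<xi>) + cis (x * \<xi>) * H \<xi> * of_real (m' x \<xi>)"
        using AE_lborel_singleton[of 0]
        by eventually_elim (simp add: m_sum flip: distrib_left of_real_add)
    qed measurable
    then show ?thesis using intH[of x]
      by (simp add: inv ft_def L_def L'_def k_def mult.commute add_divide_distrib)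
  qed
  have Lb: "ennreal (cmod (L x)) \<le> (\<integral>\<^sup>+ y. ennreal (decay_kernel (1 / b) x y * cmod (h y)) \<partial>lborel)" for x
  proof -
    have "m x \<xi> = (\<bar>x\<bar> / b)\<^sup>2 / ((\<bar>x\<bar> / b)\<^sup>2 + \<xi>\<^sup>2)" for \<xi>
      using b by (simp add: m_def power_divide power_mult_distrib divide_simps mult.commute)
    then show ?thesis using low_pass_bound[OF H, of "\<bar>x\<bar> / b" x] b
      by (simp add: L_def k_def decay_kernel_def inv)
  qed
  have Rb: "ennreal (cmod (R \<xi>)) \<le> (\<integral>\<^sup>+ \<eta>. ennreal (decay_kernel b \<xi> \<eta> * cmod (H \<eta>)) \<partial>lborel)" for \<xi>
  proof -
    have ft_cnj: "ft (\<lambda>x. cnj (h x)) (- \<eta>) = cnj (H \<eta>)" for \<eta>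
      unfolding H_def ft_def by (simp add: cis_cnj flip: Bochner_Integration.integral_cnj)
    have "m' x \<xi> = (b * \<bar>\<xi>\<bar>)\<^sup>2 / ((b * \<bar>\<xi>\<bar>)\<^sup>2 + x\<^sup>2)" for x
      by (simp add: m'_def power_mult_distrib)
    then show ?thesis using low_pass_bound[of "\<lambda>x. cnj (h x)" "b * \<bar>\<xi>\<bar>" \<xi>] b h
      by (simp add: R_def k_def decay_kernel_def ft_cnj)
  qed
  have Lc: "cmod (L x) \<le> cmod k * (LINT \<xi>|lborel. cmod (H \<xi>))" "cmod (L' x) \<le> cmod k * (LINT \<xi>|lborel. cmod (H \<xi>))" for x
    unfolding L_def L'_def norm_mult[of k] using m_bd
    by (auto intro!: mult_left_mono order_trans[OF integral_norm_bound] integral_mono intH integrable_norm H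
        simp: norm_mult mult_left_le)
  have [measurable]: "L \<in> borel_measurable borel" "L' \<in> borel_measurable borel" "R \<in> borel_measurable borel"
    unfolding L_def L'_def R_def by measurable
  have iB: "integrable lborel (\<lambda>x. cnj (h x) * K x)"
    if [measurable]: "K \<in> borel_measurable borel" and K: "\<And>x. cmod (K x) \<le> M" for K M
  proof (rule Bochner_Integration.integrable_bound)
    show "integrable lborel (\<lambda>x. h x * of_real M)" using h by (rule integrable_mult_left)
    show "AE x in lborel. norm (cnj (h x) * K x) \<le> norm (h x * of_real M)"
      using order_trans[OF K abs_ge_self] by (intro AE_I2) (simp add: norm_mult mult_left_mono)
  qed measurable
  have iL: "integrable lborel (\<lambda>x. cnj (h x) * L x)" "integrable lborel (\<lambda>x. cnj (h x) * L' x)"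
    by (rule iB[OF _ Lc(1)] iB[OF _ Lc(2)], measurable)+
  have "(LINT x|lborel. cnj (h x) * h x) = (LINT x|lborel. cnj (h x) * L x) + (LINT x|lborel. cnj (h x) * L' x)"
    using iL by (simp add: split distrib_left del: complex_cnj_add)
  also have "(LINT x|lborel. cnj (h x) * L' x) = (LINT \<xi>|lborel. H \<xi> * R \<xi>)"
  proof -
    have "integrable (lborel \<Otimes>\<^sub>M lborel) (\<lambda>(x, \<xi>). cnj (h x) * (cis (x * \<xi>) * H \<xi> * of_real (m' x \<xi>)))"
      using m_bd by (intro Bochner_Integration.integrable_bound[OF integrable_pair_mult[OF integrable_cnj[OF h] H]])
        (auto simp: norm_mult mult_left_le mult_left_mono)
    from lborel_pair.Fubini_integral[OF this]
    have "(LINT \<xi>|lborel. LINT x|lborel. H \<xi> * (cis (\<xi> * x) * cnj (h x) * of_real (m' x \<xi>)))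
      = (LINT x|lborel. LINT \<xi>|lborel. cnj (h x) * (cis (x * \<xi>) * H \<xi> * of_real (m' x \<xi>)))"
      by (simp add: mult_ac)
    then show ?thesis by (simp add: L'_def R_def mult.left_commute[of _ k])
  qed
  finally have "cmod (LINT x|lborel. cnj (h x) * h x) \<le> cmod (LINT x|lborel. cnj (h x) * L x) + cmod (LINT \<xi>|lborel. H \<xi> * R \<xi>)"
    using norm_triangle_ineq by metis
  then have "ennreal (cmod (LINT x|lborel. cnj (h x) * h x)) \<le> ennreal (cmod (LINT x|lborel. cnj (h x) * L x)) + ennreal (cmod (LINT \<xi>|lborel. H \<xi> * R \<xi>))"
    by (simp flip: ennreal_plus add: ennreal_leI)
  also have "ennreal (cmod (LINT x|lborel. cnj (h x) * L x)) \<le> kernel_form (1 / b) h"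
  proof -
    have "ennreal (cmod (LINT x|lborel. cnj (h x) * L x)) \<le> (\<integral>\<^sup>+ x. ennreal (cmod (cnj (h x) * L x)) \<partial>lborel)"
      by (rule integral_norm_bound_ennreal[OF iL(1)])
    also have "\<dots> \<le> kernel_form (1 / b) h"
      unfolding kernel_form_def
    proof (intro nn_integral_mono)
      fix x
      have "ennreal (cmod (cnj (h x) * L x)) \<le> ennreal (cmod (h x)) * (\<integral>\<^sup>+ y. ennreal (decay_kernel (1 / b) x y * cmod (h y)) \<partial>lborel)"
        using Lb[of x] by (simp add: norm_mult ennreal_mult mult_left_mono)
      also have "\<dots> = (\<integral>\<^sup>+ y. ennreal (cmod (h x) * decay_kernel (1 / b) x y * cmod (h y)) \<partial>lborel)"
        by (subst nn_integral_cmult[symmetric]) (auto simp: mult.assoc ennreal_mult')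
      finally show "ennreal (cmod (cnj (h x) * L x)) \<le> (\<integral>\<^sup>+ y. ennreal (cmod (h x) * decay_kernel (1 / b) x y * cmod (h y)) \<partial>lborel)" .
    qed
    finally show ?thesis .
  qed
  also have "ennreal (cmod (LINT \<xi>|lborel. H \<xi> * R \<xi>)) \<le> kernel_form b H"
  proof (cases "integrable lborel (\<lambda>\<xi>. H \<xi> * R \<xi>)")
    case True
    have "ennreal (cmod (LINT \<xi>|lborel. H \<xi> * R \<xi>)) \<le> (\<integral>\<^sup>+ \<xi>. ennreal (cmod (H \<xi> * R \<xi>)) \<partial>lborel)"
      by (rule integral_norm_bound_ennreal[OF True])
    also have "\<dots> \<le> kernel_form b H"
      unfolding kernel_form_def
    proof (intro nn_integral_mono)
      fix \<xi>
      have "ennreal (cmod (H \<xi> * R \<xi>)) \<le> ennreal (cmod (H \<xi>)) * (\<integral>\<^sup>+ \<eta>. ennreal (decay_kernel b \<xi> \<eta> * cmod (H \<eta>)) \<partial>lborel)"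
        using Rb[of \<xi>] by (simp add: norm_mult ennreal_mult mult_left_mono)
      also have "\<dots> = (\<integral>\<^sup>+ \<eta>. ennreal (cmod (H \<xi>) * decay_kernel b \<xi> \<eta> * cmod (H \<eta>)) \<partial>lborel)"
        by (subst nn_integral_cmult[symmetric]) (auto simp: mult.assoc ennreal_mult')
      finally show "ennreal (cmod (H \<xi> * R \<xi>)) \<le> (\<integral>\<^sup>+ \<eta>. ennreal (cmod (H \<xi>) * decay_kernel b \<xi> \<eta> * cmod (H \<eta>)) \<partial>lborel)" .
    qed
    finally show ?thesis .
  next
    \<comment> \<open>A non-integrable integrand has Bochner integral 0, so the bound holds
      trivially.\<close>
    case False
    then show ?thesis by (simp add: not_integrable_integral_eq)
  qed
  also have "ennreal (cmod (LINT x|lborel. cnj (h x) * h x)) = sqnorm h"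
  proof -
    have "integrable lborel (\<lambda>x. Re (cnj (h x) * L x + cnj (h x) * L' x))"
      using iL by (intro integrable_Re Bochner_Integration.integrable_add)
    moreover have "Re (cnj (h x) * L x + cnj (h x) * L' x) = (cmod (h x))\<^sup>2" for x
      unfolding distrib_left[symmetric] split[symmetric] cmod_power2 by (simp add: power2_eq_square)
    ultimately have i: "integrable lborel (\<lambda>x. (cmod (h x))\<^sup>2)" by simp
    have "cnj (h x) * h x = of_real ((cmod (h x))\<^sup>2)" for x
      using complex_norm_square[of "h x"] by (simp add: mult.commute)
    then have "(LINT x|lborel. cnj (h x) * h x) = of_real (LINT x|lborel. (cmod (h x))\<^sup>2)"
      by (simp only: integral_complex_of_real)
    then show ?thesis using i by (simp add: sqnorm_def nn_integral_eq_integral)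
  qed
  finally show ?thesis by (simp add: H_def add_mono)
qed

text \<open>Schur's test restricted to rows in \<open>A\<close>. The AM-GM weight \<open>l\<close>
  balances the row integrals, at most 1, against the column integrals over \<open>A\<close>, at most
  \<open>D\<close>.\<close>

lemma kernel_form_le:
  assumes [measurable]: "f \<in> borel_measurable borel" "A \<in> sets borel" and c: "0 \<le> c" and l: "0 < l" and D: "0 \<le> D"
    and col: "\<And>y. (\<integral>\<^sup>+ x. ennreal (decay_kernel c x y) * indicator A x \<partial>lborel) \<le> ennreal D"
  shows "(\<integral>\<^sup>+ x. \<integral>\<^sup>+ y. ennreal (cmod (f x) * decay_kernel c x y * cmod (f y)) * indicator A x \<partial>lborel \<partial>lborel)
    \<le> ennreal (l / 2) * sqnorm (\<lambda>x. indicator A x * f x) + ennreal (D / (2 * l)) * sqnorm f"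
proof -
  have amgm: "cmod (f x) * decay_kernel c x y * cmod (f y)
      \<le> l / 2 * (cmod (f x))\<^sup>2 * decay_kernel c x y + 1 / (2 * l) * (cmod (f y))\<^sup>2 * decay_kernel c x y" for x y
  proof -
    have "2 * (sqrt l * cmod (f x)) * (cmod (f y) / sqrt l) \<le> (sqrt l * cmod (f x))\<^sup>2 + (cmod (f y) / sqrt l)\<^sup>2"
      by (rule sum_squares_bound)
    then have "cmod (f x) * cmod (f y) \<le> l / 2 * (cmod (f x))\<^sup>2 + 1 / (2 * l) * (cmod (f y))\<^sup>2"
      using l by (simp add: power_mult_distrib power_divide field_simps)
    from mult_right_mono[OF this decay_kernel_nonneg[OF c, of x y]] show ?thesis
      by (simp add: algebra_simps)
  qed
  have "(\<integral>\<^sup>+ x. \<integral>\<^sup>+ y. ennreal (cmod (f x) * decay_kernel c x y * cmod (f y)) * indicator A x \<partial>lborel \<partial>lborel)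
    \<le> (\<integral>\<^sup>+ x. \<integral>\<^sup>+ y. ennreal (l / 2 * (cmod (f x))\<^sup>2) * indicator A x * ennreal (decay_kernel c x y)
       + ennreal (1 / (2 * l) * (cmod (f y))\<^sup>2) * (ennreal (decay_kernel c x y) * indicator A x) \<partial>lborel \<partial>lborel)"
    using amgm l decay_kernel_nonneg[OF c]
    by (intro nn_integral_mono) (auto simp flip: ennreal_mult' ennreal_mult'' ennreal_plus intro!: ennreal_leI split: split_indicator)
  also have "\<dots> = (\<integral>\<^sup>+ x. ennreal (l / 2 * (cmod (f x))\<^sup>2) * indicator A x * (\<integral>\<^sup>+ y. ennreal (decay_kernel c x y) \<partial>lborel) \<partial>lborel)
      + (\<integral>\<^sup>+ x. \<integral>\<^sup>+ y. ennreal (1 / (2 * l) * (cmod (f y))\<^sup>2) * (ennreal (decay_kernel c x y) * indicator A x) \<partial>lborel \<partial>lborel)"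
    by (subst nn_integral_add[symmetric]; simp?) (simp add: nn_integral_add nn_integral_cmult)
  also have "(\<integral>\<^sup>+ x. \<integral>\<^sup>+ y. ennreal (1 / (2 * l) * (cmod (f y))\<^sup>2) * (ennreal (decay_kernel c x y) * indicator A x) \<partial>lborel \<partial>lborel)
      = (\<integral>\<^sup>+ y. \<integral>\<^sup>+ x. ennreal (1 / (2 * l) * (cmod (f y))\<^sup>2) * (ennreal (decay_kernel c x y) * indicator A x) \<partial>lborel \<partial>lborel)"
    by (rule lborel_pair.Fubini'[symmetric]) measurable
  also have "\<dots> = (\<integral>\<^sup>+ y. ennreal (1 / (2 * l) * (cmod (f y))\<^sup>2) * (\<integral>\<^sup>+ x. ennreal (decay_kernel c x y) * indicator A x \<partial>lborel) \<partial>lborel)"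
    by (simp add: nn_integral_cmult)
  also have "\<dots> \<le> (\<integral>\<^sup>+ y. ennreal (1 / (2 * l) * (cmod (f y))\<^sup>2) * ennreal D \<partial>lborel)"
    by (intro nn_integral_mono mult_left_mono col) auto
  also have "\<dots> = ennreal (D / (2 * l)) * sqnorm f"
  proof -
    have "ennreal (1 / (2 * l) * (cmod (f y))\<^sup>2) * ennreal D = ennreal (D / (2 * l)) * ennreal ((cmod (f y))\<^sup>2)" for y
      using l D by (simp flip: ennreal_mult)
    then show ?thesis by (simp add: sqnorm_def nn_integral_cmult)
  qed
  also have "(\<integral>\<^sup>+ x. ennreal (l / 2 * (cmod (f x))\<^sup>2) * indicator A x * (\<integral>\<^sup>+ y. ennreal (decay_kernel c x y) \<partial>lborel) \<partial>lborel)
      \<le> (\<integral>\<^sup>+ x. ennreal (l / 2 * (cmod (f x))\<^sup>2) * indicator A x * 1 \<partial>lborel)"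
    by (intro nn_integral_mono mult_left_mono nn_integral_decay_kernel c) auto
  also have "\<dots> = ennreal (l / 2) * sqnorm (\<lambda>x. indicator A x * f x)"
  proof -
    have "ennreal (l / 2 * (cmod (f x))\<^sup>2) * indicator A x * 1 = ennreal (l / 2) * ennreal ((cmod (indicator A x * f x))\<^sup>2)" for x
      using l ennreal_mult[of "l / 2" "(cmod (f x))\<^sup>2"] by (auto split: split_indicator)
    then show ?thesis by (simp add: sqnorm_def nn_integral_cmult del: mult_1_right)
  qed
  finally show ?thesis by (simp add: add_mono)
qed

section \<open>The scale \<open>rho\<close>, averages over its balls and thin sets\<close>

lemma rho_eq: "rho x = 1 / max 1 \<bar>x\<bar>"
  by (auto simp: rho_def min_def max_def divide_simps)

lemma rho_pos: "0 < rho x"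
  by (simp add: rho_eq)

lemma borel_measurable_rho [measurable]: "rho \<in> borel_measurable borel"
  unfolding rho_eq[abs_def] by measurable

text \<open>The form of \<open>thin\<close> used for Borel sets, in terms of \<open>lborel\<close>;
  the sets of the theorem are reduced to it by \<open>thin_rho_ex_borel\<close>.\<close>

definition thin_at_rho :: "real \<Rightarrow> real set \<Rightarrow> bool" where
  "thin_at_rho \<epsilon> E \<longleftrightarrow> (\<forall>x. emeasure lborel (E \<inter> ball x (rho x)) \<le> ennreal (\<epsilon> * rho x))"

text \<open>A ball of radius \<open>rho x\<close> has length \<open>2 * rho x\<close>. Column bounds
  over the whole line thereby become instances of those over thin sets.\<close>

lemma thin_at_rho_UNIV: "thin_at_rho 2 UNIV"
  unfolding thin_at_rho_def using rho_pos
  by (auto simp: ball_eq_greaterThanLessThan less_imp_le)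

text \<open>Centres within \<open>rho z / 2\<close> of \<open>z\<close> have \<open>rho\<close>
  comparable to \<open>rho z\<close>, so their balls contain \<open>z\<close>, and each contributes
  at least \<open>1 / (2 * rho z)\<close> over a total length \<open>rho z\<close>. This average
  does the work of a covering of the line by such balls.\<close>

lemma rho_average_ge:
  "1 \<le> 2 * (\<integral>\<^sup>+ x. ennreal (1 / rho x) * indicator (ball x (rho x)) z \<partial>lborel)"
proof -
  have m: "max 1 \<bar>x\<bar> \<le> max 1 \<bar>z\<bar> * (3 / 2)" "max 1 \<bar>z\<bar> \<le> max 1 \<bar>x\<bar> * 2" if "dist x z < rho z / 2" for x
  proof -
    have "rho z \<le> 1" by (simp add: rho_eq)
    then have "\<bar>x - z\<bar> < 1 / 2" using that by (simp add: dist_real_def)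
    then show "max 1 \<bar>x\<bar> \<le> max 1 \<bar>z\<bar> * (3 / 2)" "max 1 \<bar>z\<bar> \<le> max 1 \<bar>x\<bar> * 2" by linarith+
  qed
  have "ennreal (1 / (2 * rho z)) * indicator (ball z (rho z / 2)) x \<le> ennreal (1 / rho x) * indicator (ball x (rho x)) z" for x
  proof (cases "dist x z < rho z / 2")
    case True
    note m = m[OF this]
    have "rho z / 2 \<le> rho x"
    proof -
      have "max 1 \<bar>x\<bar> \<le> 2 * max 1 \<bar>z\<bar>" using m(1) by linarith
      then have "1 / (2 * max 1 \<bar>z\<bar>) \<le> 1 / max 1 \<bar>x\<bar>" by (intro divide_left_mono) auto
      then show ?thesis by (simp add: rho_eq)
    qed
    then have "dist x z < rho x" using True by simp
    moreover have "1 / (2 * rho z) \<le> 1 / rho x"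
      using m(2) by (simp add: rho_eq)
    ultimately show ?thesis by (auto simp: indicator_def dist_commute intro!: ennreal_leI)
  next
    case False
    then show ?thesis by (auto simp: indicator_def dist_commute)
  qed
  then have "(\<integral>\<^sup>+ x. ennreal (1 / (2 * rho z)) * indicator (ball z (rho z / 2)) x \<partial>lborel)
      \<le> (\<integral>\<^sup>+ x. ennreal (1 / rho x) * indicator (ball x (rho x)) z \<partial>lborel)"
    by (intro nn_integral_mono)
  moreover have "(\<integral>\<^sup>+ x. ennreal (1 / (2 * rho z)) * indicator (ball z (rho z / 2)) x \<partial>lborel) = ennreal (1 / 2)"
    using rho_pos[of z] by (simp add: nn_integral_cmult ball_eq_greaterThanLessThan flip: ennreal_mult del: ennreal_half)
  ultimately have "2 * ennreal (1 / 2) \<le> 2 * (\<integral>\<^sup>+ x. ennreal (1 / rho x) * indicator (ball x (rho x)) z \<partial>lborel)"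
    by (intro mult_left_mono) auto
  then show ?thesis by (simp add: numeral_mult_ennreal del: ennreal_half)
qed

text \<open>Insert the average over centres, exchange the integrals, and on each ball replace
  \<open>\<phi>\<close> by its bound \<open>\<psi> x\<close> at the centre, so that only the measure
  of \<open>E\<close> in the ball remains.\<close>

lemma nn_integral_thin_le:
  assumes [measurable]: "E \<in> sets borel" "\<phi> \<in> borel_measurable borel" "\<psi> \<in> borel_measurable borel"
    and thin: "thin_at_rho \<epsilon> E" and "0 \<le> \<epsilon>"
    and le: "\<And>x z. dist x z < rho x \<Longrightarrow> \<phi> z \<le> \<psi> x" and \<psi>: "\<And>x. 0 \<le> \<psi> x"
  shows "(\<integral>\<^sup>+ z. ennreal (\<phi> z) * indicator E z \<partial>lborel) \<le> ennreal (2 * \<epsilon>) * (\<integral>\<^sup>+ x. ennreal (\<psi> x) \<partial>lborel)"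
proof -
  have [measurable]: "(\<lambda>p. indicator (ball (f p) (rho (f p))) (g p) :: ennreal) \<in> borel_measurable M"
    if [measurable]: "f \<in> borel_measurable M" "g \<in> borel_measurable M" for f g and M :: "'x measure"
    unfolding indicator_def mem_ball by measurable
  have "(\<integral>\<^sup>+ z. ennreal (\<phi> z) * indicator E z \<partial>lborel)
    \<le> (\<integral>\<^sup>+ z. ennreal (\<phi> z) * indicator E z * (2 * (\<integral>\<^sup>+ x. ennreal (1 / rho x) * indicator (ball x (rho x)) z \<partial>lborel)) \<partial>lborel)"
  proof (rule nn_integral_mono)
    fix z
    show "ennreal (\<phi> z) * indicator E z \<le> ennreal (\<phi> z) * indicator E z * (2 * (\<integral>\<^sup>+ x. ennreal (1 / rho x) * indicator (ball x (rho x)) z \<partial>lborel))"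
      using mult_left_mono[OF rho_average_ge[of z], of "ennreal (\<phi> z) * indicator E z"] by simp
  qed
  also have "\<dots> = 2 * (\<integral>\<^sup>+ z. \<integral>\<^sup>+ x. ennreal (\<phi> z) * indicator E z * (ennreal (1 / rho x) * indicator (ball x (rho x)) z) \<partial>lborel \<partial>lborel)"
    by (subst nn_integral_cmult[symmetric]) (auto intro!: nn_integral_cong simp: nn_integral_cmult mult_ac)
  also have "\<dots> = 2 * (\<integral>\<^sup>+ x. \<integral>\<^sup>+ z. ennreal (\<phi> z) * indicator E z * (ennreal (1 / rho x) * indicator (ball x (rho x)) z) \<partial>lborel \<partial>lborel)"
    by (subst lborel_pair.Fubini') auto
  also have "\<dots> \<le> 2 * (\<integral>\<^sup>+ x. ennreal \<epsilon> * ennreal (\<psi> x) \<partial>lborel)"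
  proof (intro mult_left_mono nn_integral_mono)
    fix x
    have "(\<integral>\<^sup>+ z. ennreal (\<phi> z) * indicator E z * (ennreal (1 / rho x) * indicator (ball x (rho x)) z) \<partial>lborel)
      \<le> (\<integral>\<^sup>+ z. ennreal (\<psi> x) * ennreal (1 / rho x) * indicator (E \<inter> ball x (rho x)) z \<partial>lborel)"
      using le by (intro nn_integral_mono) (auto split: split_indicator intro!: mult_right_mono ennreal_leI)
    also have "\<dots> = ennreal (\<psi> x) * ennreal (1 / rho x) * emeasure lborel (E \<inter> ball x (rho x))"
      by (rule nn_integral_cmult_indicator) simp
    also have "\<dots> \<le> ennreal (\<psi> x) * ennreal (1 / rho x) * ennreal (\<epsilon> * rho x)"
      using thin by (intro mult_left_mono) (auto simp: thin_at_rho_def)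
    also have "\<dots> = ennreal \<epsilon> * ennreal (\<psi> x)"
      using rho_pos[of x] \<psi>[of x] \<open>0 \<le> \<epsilon>\<close> by (simp flip: ennreal_mult)
    finally show "(\<integral>\<^sup>+ z. ennreal (\<phi> z) * indicator E z * (ennreal (1 / rho x) * indicator (ball x (rho x)) z) \<partial>lborel) \<le> ennreal \<epsilon> * ennreal (\<psi> x)" .
  qed auto
  also have "\<dots> = ennreal (2 * \<epsilon>) * (\<integral>\<^sup>+ x. ennreal (\<psi> x) \<partial>lborel)"
    using \<open>0 \<le> \<epsilon>\<close> by (simp add: nn_integral_cmult ennreal_mult mult.assoc)
  finally show ?thesis .
qed

text \<open>For large \<bar>x\<bar> a shift by \<open>rho x\<close>, that is 1 / |x|, costs the
  exponent half of its size and a bounded amount: \<open>\<bar>z\<bar> * \<bar>y - z\<bar>\<close>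
  is at least \<open>\<bar>x\<bar> * \<bar>x - y\<bar> / 2 - 1\<close>. The majorant depends on
  \<open>z\<close> only through the centre \<open>x\<close>, and its integral in \<open>x\<close> is
  bounded uniformly in \<open>y\<close>.\<close>

lemma decay_kernel_nearby_le:
  assumes c: "0 < c" and xz: "dist x z < rho x"
  shows "decay_kernel c z y \<le> 3 * c / 2 * indicator {-2..2} x
    + c * exp c * (\<bar>x\<bar> * exp (- (c / 4) * x\<^sup>2) + 2 * \<bar>y\<bar> * exp (- (c / 3 * \<bar>y\<bar> * \<bar>x - y\<bar>)))"
proof (cases "\<bar>x\<bar> \<le> 2")
  case True
  have "rho x \<le> 1" by (simp add: rho_eq)
  then have "\<bar>z\<bar> \<le> 3" using xz True by (simp add: dist_real_def)
  have "decay_kernel c z y \<le> c * \<bar>z\<bar> / 2 * 1"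
    unfolding decay_kernel_def using c by (intro mult_left_mono) auto
  also have "\<dots> \<le> 3 * c / 2" using c \<open>\<bar>z\<bar> \<le> 3\<close> by simp
  finally have "decay_kernel c z y \<le> 3 * c / 2 * indicator {-2..2} x" using True by (simp add: indicator_def abs_le_iff)
  moreover have "0 \<le> c * exp c * (\<bar>x\<bar> * exp (- (c / 4) * x\<^sup>2) + 2 * \<bar>y\<bar> * exp (- (c / 3 * \<bar>y\<bar> * \<bar>x - y\<bar>)))"
    using c by (intro mult_nonneg_nonneg add_nonneg_nonneg) auto
  ultimately show ?thesis by linarith
next
  case False
  define r where "r = rho x"
  have r: "r * \<bar>x\<bar> = 1" "0 < r" "r \<le> 1 / 2" using False by (auto simp: r_def rho_eq max_def divide_simps)
  have z: "\<bar>x\<bar> - r \<le> \<bar>z\<bar>" "\<bar>z\<bar> \<le> 2 * \<bar>x\<bar>" "\<bar>x - y\<bar> - r \<le> \<bar>y - z\<bar>"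
    using xz False r by (auto simp: r_def[symmetric] dist_real_def)
  have "(\<bar>x\<bar> - r) * (\<bar>x - y\<bar> - r) \<le> (\<bar>x\<bar> - r) * \<bar>y - z\<bar>"
    using z r False by (intro mult_left_mono) auto
  also have "\<dots> \<le> \<bar>z\<bar> * \<bar>y - z\<bar>" using z by (intro mult_right_mono) auto
  finally have "\<bar>x\<bar> * \<bar>x - y\<bar> - 1 - r * \<bar>x - y\<bar> + r\<^sup>2 \<le> \<bar>z\<bar> * \<bar>y - z\<bar>"
    using r(1) by (simp add: algebra_simps power2_eq_square)
  moreover have "r * \<bar>x - y\<bar> \<le> \<bar>x\<bar> / 2 * \<bar>x - y\<bar>" using r False by (intro mult_right_mono) auto
  ultimately have prod: "\<bar>x\<bar> * \<bar>x - y\<bar> / 2 - 1 \<le> \<bar>z\<bar> * \<bar>y - z\<bar>"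
    using zero_le_power2[of r] by linarith
  have "decay_kernel c z y \<le> c * \<bar>x\<bar> * exp (- (c * (\<bar>x\<bar> * \<bar>x - y\<bar> / 2 - 1)))"
    unfolding decay_kernel_def using c z(2) mult_left_mono[OF prod less_imp_le[OF c]]
    by (intro mult_mono) (auto simp: mult.assoc)
  also have "\<dots> = c * exp c * (\<bar>x\<bar> * exp (- (c / 2 * (\<bar>x\<bar> * \<bar>x - y\<bar>))))"
    by (simp add: right_diff_distrib exp_add[symmetric] mult.assoc)
  also have "\<bar>x\<bar> * exp (- (c / 2 * (\<bar>x\<bar> * \<bar>x - y\<bar>)))
      \<le> \<bar>x\<bar> * exp (- (c / 4) * x\<^sup>2) + 2 * \<bar>y\<bar> * exp (- (c / 3 * \<bar>y\<bar> * \<bar>x - y\<bar>))"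
  \<comment> \<open>Away from \<open>y\<close> the exponent is at least of order \<open>x^2\<close>.
    Close to \<open>y\<close>, \<bar>x\<bar> and \<bar>y\<bar> are comparable, and a Laplace kernel
    with rate proportional to \<bar>y\<bar> takes over.\<close>
  proof (cases "\<bar>x\<bar> / 2 \<le> \<bar>x - y\<bar>")
    case True
    have "\<bar>x\<bar> * (\<bar>x\<bar> / 2) \<le> \<bar>x\<bar> * \<bar>x - y\<bar>" using True by (intro mult_left_mono) auto
    then have "c / 4 * x\<^sup>2 \<le> c / 2 * (\<bar>x\<bar> * \<bar>x - y\<bar>)"
      using c by (simp add: power2_eq_square)
    then have "\<bar>x\<bar> * exp (- (c / 2 * (\<bar>x\<bar> * \<bar>x - y\<bar>))) \<le> \<bar>x\<bar> * exp (- (c / 4) * x\<^sup>2)"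
      by (intro mult_left_mono) auto
    moreover have "0 \<le> 2 * \<bar>y\<bar> * exp (- (c / 3 * \<bar>y\<bar> * \<bar>x - y\<bar>))" by simp
    ultimately show ?thesis by linarith
  next
    case False
    then have xy: "\<bar>x\<bar> \<le> 2 * \<bar>y\<bar>" "2 / 3 * \<bar>y\<bar> \<le> \<bar>x\<bar>" by linarith+
    have "2 / 3 * \<bar>y\<bar> * \<bar>x - y\<bar> \<le> \<bar>x\<bar> * \<bar>x - y\<bar>" using xy(2) by (intro mult_right_mono) auto
    then have "c / 3 * \<bar>y\<bar> * \<bar>x - y\<bar> \<le> c / 2 * (\<bar>x\<bar> * \<bar>x - y\<bar>)"
      using mult_left_mono[of _ _ "c / 2"] c by fastforce
    then have "\<bar>x\<bar> * exp (- (c / 2 * (\<bar>x\<bar> * \<bar>x - y\<bar>))) \<le> 2 * \<bar>y\<bar> * exp (- (c / 3 * \<bar>y\<bar> * \<bar>x - y\<bar>))"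
      using xy(1) by (intro mult_mono) auto
    moreover have "0 \<le> \<bar>x\<bar> * exp (- (c / 4) * x\<^sup>2)" by simp
    ultimately show ?thesis by linarith
  qed
  finally have "decay_kernel c z y \<le> c * exp c * (\<bar>x\<bar> * exp (- (c / 4) * x\<^sup>2) + 2 * \<bar>y\<bar> * exp (- (c / 3 * \<bar>y\<bar> * \<bar>x - y\<bar>)))"
    using c by (simp add: mult_left_mono)
  then show ?thesis using False by (auto simp: indicator_def)
qed

text \<open>Integrating the majorant of \<open>decay_kernel_nearby_le\<close> over the centres gives
  a constant that depends on \<open>c\<close> only, and \<open>nn_integral_thin_le\<close> adds the
  factor \<epsilon>.\<close>

lemma thin_decay_kernel_bound:
  assumes c: "0 < c"
  obtains C where "0 < C"
    "\<And>E \<epsilon> y. E \<in> sets borel \<Longrightarrow> thin_at_rho \<epsilon> E \<Longrightarrow> 0 \<le> \<epsilon> \<Longrightarrow>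
      (\<integral>\<^sup>+ x. ennreal (decay_kernel c x y) * indicator E x \<partial>lborel) \<le> ennreal (C * \<epsilon>)"
proof -
  let ?h = "\<lambda>x y. exp (- (c / 3 * \<bar>y\<bar> * \<bar>x - y\<bar>))"
  define M where "M = (LINT x|lborel. \<bar>x\<bar> * exp (- (c / 4) * x\<^sup>2))"
  have Mi: "integrable lborel (\<lambda>x. \<bar>x\<bar> * exp (- (c / 4) * x\<^sup>2))"
  proof -
    have "integrable lborel (\<lambda>x::real. norm (of_real x ^ 1 * exp (- of_real (c / 4) * (of_real x)\<^sup>2 + 0 * of_real x) :: complex))"
      using c by (intro integrable_norm integrable_gaussian) simp
    moreover have "norm (of_real x ^ 1 * exp (- of_real (c / 4) * (of_real x)\<^sup>2 + 0 * of_real x) :: complex) = \<bar>x\<bar> * exp (- (c / 4) * x\<^sup>2)" for x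
      by (simp add: norm_mult power2_eq_square)
    ultimately show ?thesis by simp
  qed
  have M0: "0 \<le> M" unfolding M_def by (intro integral_nonneg_AE) auto
  define \<psi> where "\<psi> y x = 3 * c / 2 * indicator {-2..2} x
    + c * exp c * (\<bar>x\<bar> * exp (- (c / 4) * x\<^sup>2) + 2 * \<bar>y\<bar> * ?h x y)" for y x :: real
  have \<psi>0: "0 \<le> \<psi> y x" for y x unfolding \<psi>_def using c by (intro mult_nonneg_nonneg add_nonneg_nonneg) auto
  have [measurable]: "\<psi> y \<in> borel_measurable borel" for y unfolding \<psi>_def[abs_def] by measurable
  have \<psi>_int: "(\<integral>\<^sup>+ x. ennreal (\<psi> y x) \<partial>lborel) \<le> ennreal (6 * c + c * exp c * (M + 12 / c))" for y
  proof -
    have "ennreal (\<psi> y x) = ennreal (3 * c / 2) * indicator {-2..2} x + ennreal (c * exp c) *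
        (ennreal (\<bar>x\<bar> * exp (- (c / 4) * x\<^sup>2)) + ennreal (12 / c) * ennreal (c / 3 * \<bar>y\<bar> / 2 * ?h x y))" for x
    proof -
      \<comment> \<open>The factor \<open>12 / c\<close> normalises the last term to a Laplace
        density in \<open>x\<close> around \<open>y\<close> with rate
        \<open>c / 3 * \<bar>y\<bar>\<close>, whose mass is at most 1.\<close>
      have "12 / c * (c / 3 * \<bar>y\<bar> / 2 * ?h x y) = 2 * \<bar>y\<bar> * ?h x y"
        using c by simp
      then have "ennreal (12 / c) * ennreal (c / 3 * \<bar>y\<bar> / 2 * ?h x y) = ennreal (2 * \<bar>y\<bar> * ?h x y)"
        using c by (subst ennreal_mult[symmetric]) auto
      moreover have "ennreal (3 * c / 2) * indicator {-2..2} x = ennreal (3 * c / 2 * indicator {-2..2} x)"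
        by (auto simp: indicator_def)
      ultimately show ?thesis unfolding \<psi>_def using c
        by (simp add: ennreal_mult ennreal_plus)
    qed
    then have "(\<integral>\<^sup>+ x. ennreal (\<psi> y x) \<partial>lborel) = ennreal (3 * c / 2) * emeasure lborel {-2..2::real} + ennreal (c * exp c) *
        ((\<integral>\<^sup>+ x. ennreal (\<bar>x\<bar> * exp (- (c / 4) * x\<^sup>2)) \<partial>lborel) + ennreal (12 / c) * (\<integral>\<^sup>+ x. ennreal (c / 3 * \<bar>y\<bar> / 2 * ?h x y) \<partial>lborel))"
      by (simp only:) (simp add: nn_integral_add nn_integral_cmult)
    also have "\<dots> \<le> ennreal (3 * c / 2) * ennreal 4 + ennreal (c * exp c) * (ennreal M + ennreal (12 / c) * 1)"
    proof (intro add_mono mult_left_mono)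
      show "(\<integral>\<^sup>+ x. ennreal (\<bar>x\<bar> * exp (- (c / 4) * x\<^sup>2)) \<partial>lborel) \<le> ennreal M"
        unfolding M_def by (subst nn_integral_eq_integral[OF Mi]) auto
      show "(\<integral>\<^sup>+ x. ennreal (c / 3 * \<bar>y\<bar> / 2 * ?h x y) \<partial>lborel) \<le> 1"
        using c by (intro nn_integral_laplace_kernel) simp
    qed auto
    also have "\<dots> = ennreal (3 * c / 2 * 4 + c * exp c * (M + 12 / c))"
      using c M0 by (simp only: mult_1_right flip: ennreal_mult ennreal_plus) (simp flip: ennreal_mult ennreal_plus)
    also have "3 * c / 2 * 4 = 6 * c" by simp
    finally show ?thesis .
  qed
  let ?C = "2 * (6 * c + c * exp c * (M + 12 / c))"
  show ?thesis
  proof (rule that[of ?C])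
    show "0 < ?C" using c M0 by (simp add: add_pos_nonneg)
    fix E \<epsilon> y assume E: "E \<in> sets borel" "thin_at_rho \<epsilon> E" "0 \<le> (\<epsilon>::real)"
    have "(\<integral>\<^sup>+ x. ennreal (decay_kernel c x y) * indicator E x \<partial>lborel) \<le> ennreal (2 * \<epsilon>) * (\<integral>\<^sup>+ x. ennreal (\<psi> y x) \<partial>lborel)"
      using E \<psi>0 decay_kernel_nearby_le[OF c] unfolding \<psi>_def[symmetric]
      by (intro nn_integral_thin_le) auto
    also have "\<dots> \<le> ennreal (2 * \<epsilon>) * ennreal (6 * c + c * exp c * (M + 12 / c))"
      by (intro mult_left_mono \<psi>_int) simp
    also have "\<dots> = ennreal (?C * \<epsilon>)"
      using c M0 E(3) by (subst ennreal_mult[symmetric]) (auto simp: mult_ac)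
    finally show "(\<integral>\<^sup>+ x. ennreal (decay_kernel c x y) * indicator E x \<partial>lborel) \<le> ennreal (?C * \<epsilon>)" .
  qed
qed

text \<open>The AM-GM weight is 1/8 for rows in \<open>A\<close> and \<open>16 * C\<close> for the
  other rows. This produces three terms with coefficient 1/16 of the full norm, so the two forms
  together return 3/8 of it, less than 1.\<close>

lemma kernel_form_le_complement:
  assumes [measurable]: "f \<in> borel_measurable borel" "A \<in> sets borel" and c: "0 \<le> c" and C: "0 < C"
    and small: "\<And>y. (\<integral>\<^sup>+ x. ennreal (decay_kernel c x y) * indicator A x \<partial>lborel) \<le> ennreal (1 / 64)"
    and all: "\<And>y. (\<integral>\<^sup>+ x. ennreal (decay_kernel c x y) \<partial>lborel) \<le> ennreal (2 * C)"
  shows "kernel_form c f \<le> ennreal (3 / 16) * sqnorm f + ennreal (8 * C) * sqnorm (\<lambda>x. indicator (- A) x * f x)"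
proof -
  let ?k = "\<lambda>x y. ennreal (cmod (f x) * decay_kernel c x y * cmod (f y))"
  have "kernel_form c f = (\<integral>\<^sup>+ x. (\<integral>\<^sup>+ y. ?k x y * indicator A x \<partial>lborel) + (\<integral>\<^sup>+ y. ?k x y * indicator (- A) x \<partial>lborel) \<partial>lborel)"
    unfolding kernel_form_def
    by (intro nn_integral_cong) (auto simp: indicator_def)
  also have "\<dots> = (\<integral>\<^sup>+ x. \<integral>\<^sup>+ y. ?k x y * indicator A x \<partial>lborel \<partial>lborel) + (\<integral>\<^sup>+ x. \<integral>\<^sup>+ y. ?k x y * indicator (- A) x \<partial>lborel \<partial>lborel)"
    by (intro nn_integral_add) measurable
  also have "(\<integral>\<^sup>+ x. \<integral>\<^sup>+ y. ?k x y * indicator A x \<partial>lborel \<partial>lborel)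
      \<le> ennreal (1 / 8 / 2) * sqnorm (\<lambda>x. indicator A x * f x) + ennreal (1 / 64 / (2 * (1 / 8))) * sqnorm f"
    using c small by (intro kernel_form_le) auto
  also have "\<dots> \<le> ennreal (1 / 16) * sqnorm f + ennreal (1 / 16) * sqnorm f"
    by (intro add_mono mult_mono) (auto simp: sqnorm_def intro!: nn_integral_mono ennreal_leI split: split_indicator)
  also have "(\<integral>\<^sup>+ x. \<integral>\<^sup>+ y. ?k x y * indicator (- A) x \<partial>lborel \<partial>lborel)
      \<le> ennreal (16 * C / 2) * sqnorm (\<lambda>x. indicator (- A) x * f x) + ennreal (2 * C / (2 * (16 * C))) * sqnorm f"
  proof (intro kernel_form_le)
    fix y
    have "(\<integral>\<^sup>+ x. ennreal (decay_kernel c x y) * indicator (- A) x \<partial>lborel) \<le> (\<integral>\<^sup>+ x. ennreal (decay_kernel c x y) \<partial>lborel)"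
      by (intro nn_integral_mono) (auto simp: indicator_def)
    also have "\<dots> \<le> ennreal (2 * C)" by (rule all)
    finally show "(\<integral>\<^sup>+ x. ennreal (decay_kernel c x y) * indicator (- A) x \<partial>lborel) \<le> ennreal (2 * C)" .
  qed (use c C in auto)
  also have "ennreal (1 / 16) * sqnorm f + ennreal (1 / 16) * sqnorm f + (ennreal (16 * C / 2) * sqnorm (\<lambda>x. indicator (- A) x * f x) + ennreal (2 * C / (2 * (16 * C))) * sqnorm f)
      = (ennreal (1 / 16) + ennreal (1 / 16) + ennreal (1 / 16)) * sqnorm f + ennreal (8 * C) * sqnorm (\<lambda>x. indicator (- A) x * f x)"
    using C by (simp add: distrib_right add_ac)
  also have "ennreal (1 / 16) + ennreal (1 / 16) + ennreal (1 / 16) = ennreal (3 / 16)"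
    by (simp only: ennreal_plus[symmetric]) simp
  finally show ?thesis by (simp add: add_mono)
qed

text \<open>\<open>F\<close> is tested at \<open>b * \<xi>\<close> because the frequency \<xi> of
  \<open>h\<close> will correspond to the position \<open>b * \<xi>\<close> at the later time, and
  thinness is a condition on positions.\<close>

lemma thin_uncertainty:
  assumes b: "0 < (b::real)"
  obtains \<epsilon> C where "0 < \<epsilon>" "\<epsilon> \<le> 1" "0 < C"
    "\<And>E F h. E \<in> sets borel \<Longrightarrow> F \<in> sets borel \<Longrightarrow> thin_at_rho \<epsilon> E \<Longrightarrow> thin_at_rho \<epsilon> F \<Longrightarrow>
      integrable lborel h \<Longrightarrow> integrable lborel (ft h) \<Longrightarrow> (\<And>x. h x = ft (ft h) (- x)) \<Longrightarrow> sqnorm h < \<infinity> \<Longrightarrow>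
      sqnorm h \<le> ennreal C * (sqnorm (\<lambda>x. indicator (- E) x * h x) + sqnorm (\<lambda>\<xi>. indicator (- F) (b * \<xi>) * ft h \<xi>))"
proof -
  obtain C where C: "0 < C" and bound: "\<And>E \<epsilon> y. E \<in> sets borel \<Longrightarrow> thin_at_rho \<epsilon> E \<Longrightarrow> 0 \<le> \<epsilon> \<Longrightarrow>
      (\<integral>\<^sup>+ x. ennreal (decay_kernel (1 / b) x y) * indicator E x \<partial>lborel) \<le> ennreal (C * \<epsilon>)"
    using thin_decay_kernel_bound[of "1 / b"] b by auto
  define \<epsilon> where "\<epsilon> = min 1 (1 / (64 * C))"
  have \<epsilon>: "0 < \<epsilon>" "\<epsilon> \<le> 1" "C * \<epsilon> \<le> 1 / 64"
    using C by (auto simp: \<epsilon>_def min_def field_simps)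
  have small: "(\<integral>\<^sup>+ x. ennreal (decay_kernel (1 / b) x y) * indicator E x \<partial>lborel) \<le> ennreal (1 / 64)"
    if "E \<in> sets borel" "thin_at_rho \<epsilon> E" for E y
    using bound[OF that, of y] \<epsilon> by (auto intro: order_trans ennreal_leI)
  have all: "(\<integral>\<^sup>+ x. ennreal (decay_kernel (1 / b) x y) \<partial>lborel) \<le> ennreal (2 * C)" for y
    using bound[OF _ thin_at_rho_UNIV, of y] by (simp add: mult.commute)
  \<comment> \<open>The substitution x = b \<xi> carries the kernel with constant \<open>b\<close>
    to the one with constant \<open>1 / b\<close>, so one column bound serves both forms.\<close>
  have scale: "(\<integral>\<^sup>+ \<xi>. ennreal (decay_kernel b \<xi> \<eta>) * indicator A (b * \<xi>) \<partial>lborel)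
      = (\<integral>\<^sup>+ x. ennreal (decay_kernel (1 / b) x (b * \<eta>)) * indicator A x \<partial>lborel)" if [measurable]: "A \<in> sets borel" for A \<eta>
  proof -
    have "decay_kernel (1 / b) (b * \<xi>) (b * \<eta>) * b = decay_kernel b \<xi> \<eta>" for \<xi>
      using b by (simp add: decay_kernel_def abs_mult right_diff_distrib[symmetric])
    then have "ennreal b * (ennreal (decay_kernel (1 / b) (b * \<xi>) (b * \<eta>)) * indicator A (b * \<xi>)) = ennreal (decay_kernel b \<xi> \<eta>) * indicator A (b * \<xi>)" for \<xi>
      using ennreal_mult''[of b "decay_kernel (1 / b) (b * \<xi>) (b * \<eta>)"] b by (simp add: mult_ac)
    then show ?thesis
      using nn_integral_real_affine[of "\<lambda>x. ennreal (decay_kernel (1 / b) x (b * \<eta>)) * indicator A x" b 0] b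
      by (simp add: nn_integral_cmult[symmetric])
  qed
  show ?thesis
  proof (rule that[OF \<epsilon>(1,2)])
    show "0 < 16 * C" using C by simp
    fix E F h
    assume [measurable]: "E \<in> sets borel" "F \<in> sets borel" and thin: "thin_at_rho \<epsilon> E" "thin_at_rho \<epsilon> F"
      and h: "integrable lborel h" "integrable lborel (ft h)" "\<And>x. h x = ft (ft h) (- x)" "sqnorm h < \<infinity>"
    have [measurable]: "h \<in> borel_measurable borel" "ft h \<in> borel_measurable borel"
      using h by (auto dest: borel_measurable_integrable)
    let ?F = "{\<xi>. b * \<xi> \<in> F}"
    have iF: "indicator ?F \<xi> = indicator F (b * \<xi>)" "indicator (- ?F) \<xi> = indicator (- F) (b * \<xi>)" for \<xi>
      by (auto simp: indicator_def)
    have [measurable]: "?F \<in> sets borel"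
      using measurable_sets[of "\<lambda>\<xi>. b * \<xi>" borel borel F] by (simp add: vimage_def)
    let ?X = "sqnorm (\<lambda>x. indicator (- E) x * h x)" and ?Y = "sqnorm (\<lambda>\<xi>. indicator (- F) (b * \<xi>) * ft h \<xi>)"
    have pl: "sqnorm (ft h) = sqnorm h" by (rule plancherel[OF h(1,4)])
    have "sqnorm h \<le> kernel_form (1 / b) h + kernel_form b (ft h)"
      by (rule sqnorm_le_kernel_forms[OF h(1,2) b h(3)])
    also have "kernel_form (1 / b) h \<le> ennreal (3 / 16) * sqnorm h + ennreal (8 * C) * ?X"
      using b C small[OF _ thin(1)] all by (intro kernel_form_le_complement) auto
    also have "kernel_form b (ft h) \<le> ennreal (3 / 16) * sqnorm (ft h) + ennreal (8 * C) * sqnorm (\<lambda>\<xi>. indicator (- ?F) \<xi> * ft h \<xi>)"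
      using b C small[OF _ thin(2)] all scale[of F] scale[of UNIV]
      by (intro kernel_form_le_complement) (auto simp: iF)
    finally have main: "sqnorm h \<le> ennreal (3 / 16) * sqnorm h + ennreal (8 * C) * ?X + (ennreal (3 / 16) * sqnorm h + ennreal (8 * C) * ?Y)"
      by (simp add: pl iF add_mono)
    have XY: "?X \<le> sqnorm h" "?Y \<le> sqnorm (ft h)"
      unfolding sqnorm_def by (intro nn_integral_mono ennreal_leI; simp add: indicator_def)+
    \<comment> \<open>Finiteness permits real arithmetic, where 3/8 of \<open>n\<close> is
      subtracted and 5/8 n <= 8 C (p + q) remains.\<close>
    obtain n where n: "sqnorm h = ennreal n" "0 \<le> n" using h(4) by (cases "sqnorm h") auto
    obtain p where p: "?X = ennreal p" "0 \<le> p" using XY(1) n by (cases ?X) (auto simp: top_unique)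
    obtain q where q: "?Y = ennreal q" "0 \<le> q" using XY(2) n pl by (cases ?Y) (auto simp: top_unique)
    have "ennreal n \<le> ennreal (3 / 16 * n + 8 * C * p + (3 / 16 * n + 8 * C * q))"
      using main n(2) p(2) q(2) C unfolding n(1) p(1) q(1)
      by (simp only: ennreal_mult ennreal_plus mult_nonneg_nonneg add_nonneg_nonneg)
    then have "n \<le> 3 / 16 * n + 8 * C * p + (3 / 16 * n + 8 * C * q)"
      using n(2) p(2) q(2) C by (subst (asm) ennreal_le_iff) auto
    then have "5 * n \<le> 64 * (C * p + C * q)" by (simp add: mult.assoc)
    moreover have "0 \<le> C * p + C * q" using C p q by simp
    ultimately have "n \<le> 16 * C * (p + q)" by (simp add: distrib_left mult.assoc)
    then show "sqnorm h \<le> ennreal (16 * C) * (?X + ?Y)"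
      unfolding n(1) p(1) q(1) using p(2) q(2) C by (simp add: ennreal_leI flip: ennreal_mult ennreal_plus)
  qed
qed

section \<open>Gaussian windows and their evolution\<close>

lemma ft_cmult: "ft (\<lambda>x. c * f x) \<xi> = c * ft f \<xi>"
  by (simp add: ft_def mult.left_commute[of _ c])

lemma ft_convolution:
  assumes G: "integrable lborel G" and w: "integrable lborel w"
  shows "integrable lborel (\<lambda>\<xi>. LINT \<eta>|lborel. G (\<xi> - \<eta>) * w \<eta>)"
    and "ft (\<lambda>\<xi>. LINT \<eta>|lborel. G (\<xi> - \<eta>) * w \<eta>) x = of_real (sqrt (2 * pi)) * ft G x * ft w x"
proof -
  have [measurable]: "G \<in> borel_measurable borel" "w \<in> borel_measurable borel"
    using G w by (auto dest: borel_measurable_integrable)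
  have ip: "integrable (lborel \<Otimes>\<^sub>M lborel) (\<lambda>(\<xi>, \<eta>). G (\<xi> - \<eta>) * w \<eta>)"
    by (rule integrable_pair_mult_shift[OF G w])
  from lborel_pair.integrable_fst[OF this]
  show "integrable lborel (\<lambda>\<xi>. LINT \<eta>|lborel. G (\<xi> - \<eta>) * w \<eta>)" .
  have ip': "integrable (lborel \<Otimes>\<^sub>M lborel) (\<lambda>(\<xi>, \<eta>). cis (- (\<xi> * x)) * (G (\<xi> - \<eta>) * w \<eta>))"
    by (rule Bochner_Integration.integrable_bound[OF ip]) (auto simp: norm_mult)
  have inner: "(LINT \<xi>|lborel. cis (- (\<xi> * x)) * (G (\<xi> - \<eta>) * w \<eta>))
      = (LINT \<xi>|lborel. cis (- (\<xi> * x)) * G \<xi>) * (cis (- (\<eta> * x)) * w \<eta>)" for \<eta>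
  proof -
    have "(LINT \<xi>|lborel. cis (- (\<xi> * x)) * (G (\<xi> - \<eta>) * w \<eta>)) = (LINT \<xi>|lborel. cis (- ((\<eta> + \<xi>) * x)) * (G \<xi> * w \<eta>))"
      using lborel_integral_real_affine[of 1 "\<lambda>\<xi>. cis (- (\<xi> * x)) * (G (\<xi> - \<eta>) * w \<eta>)" \<eta>] by simp
    also have "\<dots> = (LINT \<xi>|lborel. (cis (- (\<xi> * x)) * G \<xi>) * (cis (- (\<eta> * x)) * w \<eta>))"
      by (intro Bochner_Integration.integral_cong refl) (simp add: cis_mult distrib_right add.commute)
    finally show ?thesis by (simp only: Bochner_Integration.integral_mult_left_zero)
  qed
  have "(LINT \<xi>|lborel. cis (- (\<xi> * x)) * (LINT \<eta>|lborel. G (\<xi> - \<eta>) * w \<eta>))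
      = (LINT \<xi>|lborel. LINT \<eta>|lborel. cis (- (\<xi> * x)) * (G (\<xi> - \<eta>) * w \<eta>))"
    by (simp only: Bochner_Integration.integral_mult_right_zero)
  also have "\<dots> = (LINT \<eta>|lborel. LINT \<xi>|lborel. cis (- (\<xi> * x)) * (G (\<xi> - \<eta>) * w \<eta>))"
    using lborel_pair.Fubini_integral[OF ip'] by simp
  also have "\<dots> = (LINT \<xi>|lborel. cis (- (\<xi> * x)) * G \<xi>) * (LINT \<eta>|lborel. cis (- (\<eta> * x)) * w \<eta>)"
    by (simp only: inner Bochner_Integration.integral_mult_right_zero)
  finally show "ft (\<lambda>\<xi>. LINT \<eta>|lborel. G (\<xi> - \<eta>) * w \<eta>) x = of_real (sqrt (2 * pi)) * ft G x * ft w x"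
    unfolding ft_def by (simp add: field_simps flip: of_real_mult)
qed

definition gauss :: "complex \<Rightarrow> complex \<Rightarrow> real \<Rightarrow> complex" where
  "gauss z w x = exp (- z * (of_real x)\<^sup>2 + w * of_real x)"

lemma borel_measurable_gauss [measurable]: "gauss z w \<in> borel_measurable borel"
  unfolding gauss_def[abs_def] by measurable

lemma integrable_gauss: "0 < Re z \<Longrightarrow> integrable lborel (gauss z w)"
  unfolding gauss_def[abs_def] using integrable_gaussian[of z 0 w] by simp

lemma csqrt_quarter_inverse:
  assumes "0 < Re z"
  shows "csqrt (1 / (4 * z)) = 1 / (2 * csqrt z)"
proof -
  have "1 / (4 * z) = inverse (of_real 4 * z)" by (simp add: inverse_eq_divide)
  moreover have "of_real 4 * z \<notin> \<real>\<^sub>\<le>\<^sub>0" using assms by (auto simp: complex_nonpos_Reals_iff)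
  moreover have "csqrt (of_real 4 * z) = 2 * csqrt z"
    using csqrt_principal[of z] by (intro csqrt_unique) (auto simp: power_mult_distrib)
  ultimately show ?thesis using csqrt_inverse[of "of_real 4 * z"] by (simp add: inverse_eq_divide)
qed

lemma Re_quarter_inverse: "0 < Re z \<Longrightarrow> 0 < Re (1 / (4 * z))"
  by (auto simp: Re_divide complex_eq_iff intro!: divide_pos_pos add_pos_nonneg)

lemma ft_gauss:
  "0 < Re z \<Longrightarrow> ft (gauss z w) \<xi> = exp ((w - \<i> * \<xi>)\<^sup>2 / (4 * z)) / (of_real (sqrt 2) * csqrt z)"
  unfolding gauss_def[abs_def] by (rule ft_gaussian)

text \<open>Up to a constant the propagator has the kernel e^{iy^2/4\<tau>} e^{-ixy/2\<tau>}
  e^{ix^2/4\<tau>}; for Gaussians this becomes an identity of exponents. That one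
  \<open>\<kappa>\<close> serves all \<open>w\<close> lets the formula pass to
  superpositions.\<close>

lemma gauss_evolution:
  assumes z0: "0 < Re z0" and \<tau>: "0 < \<tau>" and z: "z = z0 - \<i> / (4 * of_real \<tau>)"
  obtains \<kappa> where "(cmod \<kappa>)\<^sup>2 = 1 / (2 * \<tau>)"
    "\<And>w y. ft (\<lambda>\<xi>. cis (- (\<tau> * \<xi>\<^sup>2)) * ft (gauss z0 w) \<xi>) (- y) = \<kappa> * cis (y\<^sup>2 / (4 * \<tau>)) * ft (gauss z w) (y / (2 * \<tau>))"
proof -
  define q where "q = 1 / (4 * z0) + \<i> * of_real \<tau>"
  have Rez: "0 < Re z" using z0 by (simp add: z)
  have Req: "0 < Re q" using Re_quarter_inverse[OF z0] by (simp add: q_def)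
  have nz: "z0 \<noteq> 0" "z \<noteq> 0" "q \<noteq> 0" "csqrt z0 \<noteq> 0" "csqrt z \<noteq> 0" "csqrt q \<noteq> 0"
    using z0 Rez Req by auto
  \<comment> \<open>This relation is used twice: it gives the modulus of \<open>\<kappa>\<close>,
    and it eliminates \<open>q\<close> from the exponent.\<close>
  have qz: "q * z0 = \<i> * of_real \<tau> * z"
    using nz \<tau> by (simp add: q_def z field_simps)
  define \<kappa> where "\<kappa> = csqrt z / (of_real (sqrt 2) * csqrt z0 * csqrt q)"
  have "(cmod \<kappa>)\<^sup>2 = cmod z / (2 * (cmod q * cmod z0))"
    by (simp add: \<kappa>_def norm_divide norm_mult power_divide power_mult_distrib norm_power[symmetric] mult_ac)
  also have "cmod q * cmod z0 = \<tau> * cmod z"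
    using arg_cong[OF qz, of cmod] \<tau> by (simp add: norm_mult)
  finally have \<kappa>: "(cmod \<kappa>)\<^sup>2 = 1 / (2 * \<tau>)" using nz \<tau> by simp
  show ?thesis
  proof (rule that[OF \<kappa>])
    fix w y
    have "(\<lambda>\<xi>. cis (- (\<tau> * \<xi>\<^sup>2)) * ft (gauss z0 w) \<xi>)
        = (\<lambda>\<xi>. exp (w\<^sup>2 / (4 * z0)) / (of_real (sqrt 2) * csqrt z0) * gauss q (- \<i> * w / (2 * z0)) \<xi>)"
    proof
      fix \<xi>
      have "\<i> * of_real (- (\<tau> * \<xi>\<^sup>2)) + (w - \<i> * \<xi>)\<^sup>2 / (4 * z0) = w\<^sup>2 / (4 * z0) + (- q * (of_real \<xi>)\<^sup>2 + (- \<i> * w / (2 * z0)) * of_real \<xi>)"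
        using nz(1) by (simp add: q_def field_simps power2_eq_square)
      then have "cis (- (\<tau> * \<xi>\<^sup>2)) * exp ((w - \<i> * \<xi>)\<^sup>2 / (4 * z0)) = exp (w\<^sup>2 / (4 * z0)) * gauss q (- \<i> * w / (2 * z0)) \<xi>"
        by (simp only: cis_conv_exp gauss_def flip: exp_add)
      then show "cis (- (\<tau> * \<xi>\<^sup>2)) * ft (gauss z0 w) \<xi> = exp (w\<^sup>2 / (4 * z0)) / (of_real (sqrt 2) * csqrt z0) * gauss q (- \<i> * w / (2 * z0)) \<xi>"
        by (simp add: ft_gauss[OF z0])
    qed
    then have "ft (\<lambda>\<xi>. cis (- (\<tau> * \<xi>\<^sup>2)) * ft (gauss z0 w) \<xi>) (- y)
        = exp (w\<^sup>2 / (4 * z0)) / (of_real (sqrt 2) * csqrt z0) * ft (gauss q (- \<i> * w / (2 * z0))) (- y)"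
      by (simp only: ft_cmult)
    also have "\<dots> = \<kappa> * (exp (w\<^sup>2 / (4 * z0)) * exp ((- \<i> * w / (2 * z0) + \<i> * of_real y)\<^sup>2 / (4 * q))) / (of_real (sqrt 2) * csqrt z)"
      using nz by (simp add: ft_gauss[OF Req] \<kappa>_def)
    also have "exp (w\<^sup>2 / (4 * z0)) * exp ((- \<i> * w / (2 * z0) + \<i> * of_real y)\<^sup>2 / (4 * q))
        = cis (y\<^sup>2 / (4 * \<tau>)) * exp ((w - \<i> * of_real (y / (2 * \<tau>)))\<^sup>2 / (4 * z))"
    proof -
      have "w\<^sup>2 / (4 * z0) + (- \<i> * w / (2 * z0) + \<i> * of_real y)\<^sup>2 / (4 * q)
          = \<i> * of_real (y\<^sup>2 / (4 * \<tau>)) + (w - \<i> * of_real (y / (2 * \<tau>)))\<^sup>2 / (4 * z)"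
      proof -
        define t where "t = complex_of_real \<tau>"
        define v where "v = complex_of_real y"
        have t: "t \<noteq> 0" using \<tau> by (simp add: t_def)
        have z0': "z0 = z + \<i> / (4 * t)" by (simp add: z t_def)
        have tz: "4 * t * z + \<i> \<noteq> 0" using nz(1) t unfolding z0' by (auto simp: field_simps)
        have q': "q = \<i> * t * z / z0" using qz nz by (simp add: t_def field_simps)
        have "w\<^sup>2 / (4 * z0) + (- \<i> * w / (2 * z0) + \<i> * v)\<^sup>2 / (4 * q) = \<i> * (v\<^sup>2 / (4 * t)) + (w - \<i> * (v / (2 * t)))\<^sup>2 / (4 * z)"
        proof -
          have "(- \<i> * w / (2 * z0) + \<i> * v)\<^sup>2 / (4 * q) = \<i> * (w / (2 * z0) - v)\<^sup>2 * z0 / (4 * t * z)"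
            using nz t unfolding q' by (simp add: field_simps power2_eq_square)
          also have "\<dots> = \<i> * (w\<^sup>2 / (4 * z0) - w * v + v\<^sup>2 * z0) / (4 * t * z)"
            using nz t by (simp add: field_simps power2_eq_square)
          finally have 1: "(- \<i> * w / (2 * z0) + \<i> * v)\<^sup>2 / (4 * q) = \<i> * (w\<^sup>2 / (4 * z0) - w * v + v\<^sup>2 * z0) / (4 * t * z)" .
          have "w\<^sup>2 / (4 * z0) * (1 + \<i> / (4 * t * z)) = w\<^sup>2 / (4 * z)"
          proof -
            have "1 + \<i> / (4 * t * z) = z0 / z" using nz t by (simp add: z0' field_simps)
            then show ?thesis using nz by simp
          qed
          moreover have "\<i> * (v\<^sup>2 * z0) / (4 * t * z) = \<i> * (v\<^sup>2 / (4 * t)) - (v / (2 * t))\<^sup>2 / (4 * z)"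
            using nz t unfolding z0' by (simp add: field_simps power2_eq_square)
          moreover have "(w - \<i> * (v / (2 * t)))\<^sup>2 / (4 * z) = w\<^sup>2 / (4 * z) - \<i> * (w * v) / (4 * t * z) - (v / (2 * t))\<^sup>2 / (4 * z)"
            using nz t by (simp add: field_simps power2_eq_square)
          ultimately show ?thesis unfolding 1 by (simp add: distrib_left diff_divide_distrib add_divide_distrib right_diff_distrib mult_ac)
        qed
        then show ?thesis by (simp add: t_def v_def)
      qed
      then show ?thesis by (simp only: cis_conv_exp flip: exp_add)
    qed
    also have "\<kappa> * (cis (y\<^sup>2 / (4 * \<tau>)) * exp ((w - \<i> * of_real (y / (2 * \<tau>)))\<^sup>2 / (4 * z))) / (of_real (sqrt 2) * csqrt z)
        = \<kappa> * cis (y\<^sup>2 / (4 * \<tau>)) * ft (gauss z w) (y / (2 * \<tau>))"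
      by (simp add: ft_gauss[OF Rez])
    finally show "ft (\<lambda>\<xi>. cis (- (\<tau> * \<xi>\<^sup>2)) * ft (gauss z0 w) \<xi>) (- y) = \<kappa> * cis (y\<^sup>2 / (4 * \<tau>)) * ft (gauss z w) (y / (2 * \<tau>))" .
  qed
qed

text \<open>The inverse transform of \<open>w\<close> times a Gaussian. The real part of
  \<open>z\<close> damps, the imaginary part carries the chirp.\<close>

definition window :: "complex \<Rightarrow> (real \<Rightarrow> complex) \<Rightarrow> real \<Rightarrow> complex" where
  "window z w x = exp (- z * (of_real x)\<^sup>2) * ft w (- x)"

lemma ft_window:
  assumes w: "integrable lborel w" and z: "0 < Re z"
  shows "ft (window z w) \<xi> = of_real (1 / sqrt (2 * pi)) * (LINT \<eta>|lborel. w \<eta> * ft (gauss z (\<i> * \<eta>)) \<xi>)"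
proof -
  have g: "integrable lborel (gauss z (\<i> * \<xi>))" by (rule integrable_gauss[OF z])
  have "(LINT x|lborel. cis (- (x * \<xi>)) * window z w x) = (LINT x|lborel. ft w x * gauss z (\<i> * \<xi>) x)"
  proof -
    have "(LINT x|lborel. cis (- (x * \<xi>)) * window z w x) = (LINT x|lborel. cis (x * \<xi>) * window z w (- x))"
      using lborel_integral_real_affine[of "-1" "\<lambda>x. cis (- (x * \<xi>)) * window z w x" 0] by simp
    also have "\<dots> = (LINT x|lborel. ft w x * gauss z (\<i> * \<xi>) x)"
      by (intro Bochner_Integration.integral_cong refl) (simp add: window_def gauss_def cis_conv_exp mult_ac exp_diff exp_minus divide_inverse)
    finally show ?thesis .
  qed
  also have "\<dots> = (LINT \<eta>|lborel. w \<eta> * ft (gauss z (\<i> * \<xi>)) \<eta>)"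
    by (rule ft_multiplication[OF w g])
  also have "\<dots> = (LINT \<eta>|lborel. w \<eta> * ft (gauss z (\<i> * \<eta>)) \<xi>)"
  proof -
    have "(\<i> * complex_of_real \<xi> - \<i> * complex_of_real \<eta>)\<^sup>2 = (\<i> * complex_of_real \<eta> - \<i> * complex_of_real \<xi>)\<^sup>2" for \<eta>
      by (rule power2_commute)
    then show ?thesis by (simp add: ft_gauss[OF z])
  qed
  finally show ?thesis by (simp add: ft_def)
qed

lemma ft_gauss_modulated:
  assumes "0 < Re z"
  shows "ft (gauss z (\<i> * \<eta>)) \<xi> = gauss (1 / (4 * z)) 0 (\<xi> - \<eta>) / (of_real (sqrt 2) * csqrt z)"
proof -
  have "(\<i> * complex_of_real \<eta> - \<i> * complex_of_real \<xi>)\<^sup>2 = - ((complex_of_real \<xi> - complex_of_real \<eta>)\<^sup>2)"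
    by (simp add: power2_eq_square algebra_simps)
  then show ?thesis by (simp add: ft_gauss[OF assms] gauss_def)
qed

text \<open>The source of integrability and inversion for windows: a convolution of two integrable
  functions, to which \<open>ft_convolution\<close> applies.\<close>

lemma ft_window_eq_convolution:
  assumes w: "integrable lborel w" and z: "0 < Re z"
  shows "ft (window z w) = (\<lambda>\<xi>. of_real (1 / sqrt (2 * pi)) / (of_real (sqrt 2) * csqrt z)
    * (LINT \<eta>|lborel. gauss (1 / (4 * z)) 0 (\<xi> - \<eta>) * w \<eta>))"
proof
  fix \<xi>
  have "(LINT \<eta>|lborel. w \<eta> * ft (gauss z (\<i> * \<eta>)) \<xi>)
    = (LINT \<eta>|lborel. 1 / (of_real (sqrt 2) * csqrt z) * (gauss (1 / (4 * z)) 0 (\<xi> - \<eta>) * w \<eta>))"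
    by (intro Bochner_Integration.integral_cong refl) (simp only: ft_gauss_modulated[OF z], simp)
  then show "ft (window z w) \<xi> = of_real (1 / sqrt (2 * pi)) / (of_real (sqrt 2) * csqrt z)
    * (LINT \<eta>|lborel. gauss (1 / (4 * z)) 0 (\<xi> - \<eta>) * w \<eta>)"
    unfolding ft_window[OF w z] by (simp only: Bochner_Integration.integral_mult_right_zero) simp
qed

lemma integrable_ft_window:
  assumes "integrable lborel w" and "0 < Re z"
  shows "integrable lborel (ft (window z w))"
  unfolding ft_window_eq_convolution[OF assms]
  by (intro integrable_mult_right ft_convolution(1) integrable_gauss Re_quarter_inverse assms)

text \<open>The second transform turns the convolution into a product, in which the factor exp(-z
  x^2) reappears as the transform of the convolving Gaussian.\<close>

lemma ft_ft_window:
  assumes w: "integrable lborel w" and z: "0 < Re z"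
  shows "ft (ft (window z w)) (- x) = window z w x"
proof -
  have nz: "csqrt z \<noteq> 0" "z \<noteq> 0" using z by auto
  have "ft (gauss (1 / (4 * z)) 0) (- x) = exp (- ((of_real x)\<^sup>2 * z)) * (2 * csqrt z) / of_real (sqrt 2)"
    using ft_gauss[OF Re_quarter_inverse[OF z], of 0 "- x"] nz
    by (simp add: csqrt_quarter_inverse[OF z] power_mult_distrib)
  moreover have "ft (ft (window z w)) (- x) = of_real (1 / sqrt (2 * pi)) / (of_real (sqrt 2) * csqrt z)
      * (of_real (sqrt (2 * pi)) * ft (gauss (1 / (4 * z)) 0) (- x) * ft w (- x))"
    unfolding ft_window_eq_convolution[OF assms]
    by (subst ft_convolution(2)[OF integrable_gauss[OF Re_quarter_inverse[OF z]] w, symmetric])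
      (rule ft_cmult)
  moreover have "exp (- ((complex_of_real x)\<^sup>2 * z)) = exp (- (z * (complex_of_real x)\<^sup>2))"
    by (simp only: mult.commute)
  ultimately show ?thesis
    using nz by (simp add: window_def flip: of_real_mult)
qed

lemma window_integrable:
  assumes w: "integrable lborel w" and z: "0 < Re z"
  shows "integrable lborel (window z w)"
proof (rule Bochner_Integration.integrable_bound)
  show "integrable lborel (\<lambda>x. gauss z 0 x * of_real ((LINT x|lborel. cmod (w x)) / sqrt (2 * pi)))"
    by (intro integrable_mult_left integrable_gauss z)
  have [measurable]: "ft w \<in> borel_measurable borel" using w by (rule borel_measurable_ft)
  show "window z w \<in> borel_measurable lborel" unfolding window_def[abs_def] by measurable
  show "AE x in lborel. norm (window z w x) \<le> norm (gauss z 0 x * of_real ((LINT x|lborel. cmod (w x)) / sqrt (2 * pi)))"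
    unfolding window_def norm_mult norm_of_real
    by (intro AE_I2 mult_mono order_trans[OF norm_ft_le abs_ge_self]) (auto simp: gauss_def)
qed

text \<open>\<open>ft_window\<close> writes both sides as superpositions over \<eta> of modulated
  Gaussians, to which \<open>gauss_evolution\<close> applies with a common \<open>\<kappa>\<close>;
  Fubini exchanges the superposition with the outer transform.\<close>

lemma window_evolution:
  assumes w: "integrable lborel w" and z0: "0 < Re z0" and \<tau>: "0 < \<tau>" and z: "z = z0 - \<i> / (4 * of_real \<tau>)"
  shows "(cmod (ft (\<lambda>\<xi>. cis (- (\<tau> * \<xi>\<^sup>2)) * ft (window z0 w) \<xi>) (- y)))\<^sup>2 = (cmod (ft (window z w) (y / (2 * \<tau>))))\<^sup>2 / (2 * \<tau>)"
proof -
  have [measurable]: "w \<in> borel_measurable borel" using w by (auto dest: borel_measurable_integrable)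
  have Rez: "0 < Re z" using z0 by (simp add: z)
  obtain \<kappa> where \<kappa>: "(cmod \<kappa>)\<^sup>2 = 1 / (2 * \<tau>)"
    "\<And>w y. ft (\<lambda>\<xi>. cis (- (\<tau> * \<xi>\<^sup>2)) * ft (gauss z0 w) \<xi>) (- y) = \<kappa> * cis (y\<^sup>2 / (4 * \<tau>)) * ft (gauss z w) (y / (2 * \<tau>))"
    using gauss_evolution[OF z0 \<tau> z] by blast
  let ?k = "complex_of_real (1 / sqrt (2 * pi))"
  let ?p = "\<lambda>\<xi> \<eta>. cis (- (\<xi> * (- y))) * (cis (- (\<tau> * \<xi>\<^sup>2)) * (w \<eta> * ft (gauss z0 (\<i> * \<eta>)) \<xi>))"
  have "integrable (lborel \<Otimes>\<^sub>M lborel) (\<lambda>(\<xi>, \<eta>). gauss (1 / (4 * z0)) 0 (\<xi> - \<eta>) * w \<eta>)"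
    by (rule integrable_pair_mult_shift[OF integrable_gauss[OF Re_quarter_inverse[OF z0]] w])
  then have "integrable (lborel \<Otimes>\<^sub>M lborel) (\<lambda>p. (\<lambda>(\<xi>, \<eta>). gauss (1 / (4 * z0)) 0 (\<xi> - \<eta>) * w \<eta>) p * (1 / (of_real (sqrt 2) * csqrt z0)))"
    by (rule integrable_mult_left)
  then have ip: "integrable (lborel \<Otimes>\<^sub>M lborel) (\<lambda>(\<xi>, \<eta>). ?p \<xi> \<eta>)"
  proof (rule Bochner_Integration.integrable_bound)
    show "(\<lambda>(\<xi>, \<eta>). ?p \<xi> \<eta>) \<in> borel_measurable (lborel \<Otimes>\<^sub>M lborel)"
      unfolding ft_gauss_modulated[OF z0] by measurable
    show "AE p in lborel \<Otimes>\<^sub>M lborel. norm ((\<lambda>(\<xi>, \<eta>). ?p \<xi> \<eta>) p)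
      \<le> norm ((\<lambda>(\<xi>, \<eta>). gauss (1 / (4 * z0)) 0 (\<xi> - \<eta>) * w \<eta>) p * (1 / (of_real (sqrt 2) * csqrt z0)))"
      by (intro AE_I2) (simp add: case_prod_beta norm_mult norm_divide ft_gauss_modulated[OF z0] mult.commute)
  qed
  have "ft (\<lambda>\<xi>. cis (- (\<tau> * \<xi>\<^sup>2)) * ft (window z0 w) \<xi>) (- y) = ?k * (?k * (LINT \<xi>|lborel. LINT \<eta>|lborel. ?p \<xi> \<eta>))"
  proof -
    have "ft (\<lambda>\<xi>. cis (- (\<tau> * \<xi>\<^sup>2)) * ft (window z0 w) \<xi>) (- y)
      = ft (\<lambda>\<xi>. ?k * (cis (- (\<tau> * \<xi>\<^sup>2)) * (LINT \<eta>|lborel. w \<eta> * ft (gauss z0 (\<i> * \<eta>)) \<xi>))) (- y)"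
      unfolding ft_window[OF w z0] by (simp only: mult.left_commute)
    also have "\<dots> = ?k * ft (\<lambda>\<xi>. cis (- (\<tau> * \<xi>\<^sup>2)) * (LINT \<eta>|lborel. w \<eta> * ft (gauss z0 (\<i> * \<eta>)) \<xi>)) (- y)"
      by (rule ft_cmult)
    also have "ft (\<lambda>\<xi>. cis (- (\<tau> * \<xi>\<^sup>2)) * (LINT \<eta>|lborel. w \<eta> * ft (gauss z0 (\<i> * \<eta>)) \<xi>)) (- y)
      = ?k * (LINT \<xi>|lborel. cis (- (\<xi> * (- y))) * (cis (- (\<tau> * \<xi>\<^sup>2)) * (LINT \<eta>|lborel. w \<eta> * ft (gauss z0 (\<i> * \<eta>)) \<xi>)))"
      by (rule ft_def)
    finally show ?thesis by (simp only: Bochner_Integration.integral_mult_right_zero)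
  qed
  also have "(LINT \<xi>|lborel. LINT \<eta>|lborel. ?p \<xi> \<eta>) = (LINT \<eta>|lborel. LINT \<xi>|lborel. ?p \<xi> \<eta>)"
    using lborel_pair.Fubini_integral[OF ip] by simp
  also have "?k * \<dots> = (LINT \<eta>|lborel. w \<eta> * ft (\<lambda>\<xi>. cis (- (\<tau> * \<xi>\<^sup>2)) * ft (gauss z0 (\<i> * \<eta>)) \<xi>) (- y))"
  proof -
    have "?k * (LINT \<xi>|lborel. ?p \<xi> \<eta>) = w \<eta> * ft (\<lambda>\<xi>. cis (- (\<tau> * \<xi>\<^sup>2)) * ft (gauss z0 (\<i> * \<eta>)) \<xi>) (- y)" for \<eta>
    proof -
      have "w \<eta> * ft (\<lambda>\<xi>. cis (- (\<tau> * \<xi>\<^sup>2)) * ft (gauss z0 (\<i> * \<eta>)) \<xi>) (- y)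
          = ft (\<lambda>\<xi>. w \<eta> * (cis (- (\<tau> * \<xi>\<^sup>2)) * ft (gauss z0 (\<i> * \<eta>)) \<xi>)) (- y)"
        by (rule ft_cmult[symmetric])
      also have "\<dots> = ?k * (LINT \<xi>|lborel. cis (- (\<xi> * (- y))) * (w \<eta> * (cis (- (\<tau> * \<xi>\<^sup>2)) * ft (gauss z0 (\<i> * \<eta>)) \<xi>)))"
        by (rule ft_def)
      finally show ?thesis by (simp only: mult.left_commute[of "w \<eta>"])
    qed
    then show ?thesis by (simp only: flip: Bochner_Integration.integral_mult_right_zero)
  qed
  also have "\<dots> = \<kappa> * cis (y\<^sup>2 / (4 * \<tau>)) * (LINT \<eta>|lborel. w \<eta> * ft (gauss z (\<i> * \<eta>)) (y / (2 * \<tau>)))"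
    unfolding \<kappa>(2) by (simp only: mult.left_commute[of "w _"] Bochner_Integration.integral_mult_right_zero)
  finally have "ft (\<lambda>\<xi>. cis (- (\<tau> * \<xi>\<^sup>2)) * ft (window z0 w) \<xi>) (- y) = \<kappa> * cis (y\<^sup>2 / (4 * \<tau>)) * ft (window z w) (y / (2 * \<tau>))"
    unfolding ft_window[OF w Rez] by (simp only: mult_ac)
  then show ?thesis by (simp add: norm_mult power_mult_distrib \<kappa>(1))
qed

section \<open>Observability from complements of thin sets\<close>

lemma sqnorm_reflect:
  assumes [measurable]: "f \<in> borel_measurable borel"
  shows "sqnorm (\<lambda>x. f (- x)) = sqnorm f"
  using nn_integral_real_affine[of "\<lambda>x. ennreal ((cmod (f x))\<^sup>2)" "-1" 0] by (simp add: sqnorm_def)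

lemma norm_window_le:
  assumes "0 \<le> d"
  shows "cmod (window (of_real d) w x) \<le> cmod (ft w (- x))"
    and "cmod (ft w (- x) - window (of_real d) w x) \<le> cmod (ft w (- x))"
proof -
  define r where "r = exp (- (d * x\<^sup>2))"
  have e: "exp (- (of_real d * (of_real x)\<^sup>2)) = complex_of_real r"
    by (simp add: r_def exp_of_real[symmetric])
  have r: "0 \<le> r" "r \<le> 1" using assms by (auto simp: r_def)
  have "ft w (- x) - window (of_real d) w x = of_real (1 - r) * ft w (- x)"
    by (simp add: window_def e left_diff_distrib)
  then have "cmod (ft w (- x) - window (of_real d) w x) = \<bar>1 - r\<bar> * cmod (ft w (- x))"
    by (simp only: norm_mult norm_of_real)
  then show "cmod (ft w (- x) - window (of_real d) w x) \<le> cmod (ft w (- x))"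
    using r by (simp add: mult_left_le_one_le)
  show "cmod (window (of_real d) w x) \<le> cmod (ft w (- x))"
    using r by (simp add: window_def e norm_mult mult_left_le_one_le)
qed

lemma borel_measurable_window [measurable]:
  assumes "integrable lborel w"
  shows "window z w \<in> borel_measurable borel"
proof -
  have [measurable]: "ft w \<in> borel_measurable borel" using assms by (rule borel_measurable_ft)
  show ?thesis unfolding window_def[abs_def] by measurable
qed

lemma tendsto_sqnorm_window:
  assumes w: "integrable lborel w" and fin: "sqnorm w < \<infinity>"
  shows "(\<lambda>n. sqnorm (\<lambda>x. ft w (- x) - window (of_real (1 / real (Suc n))) w x)) \<longlonglongrightarrow> 0"
proof (rule tendsto_sqnorm_0[where w="\<lambda>x. (cmod (ft w (- x)))\<^sup>2"])
  have [measurable]: "ft w \<in> borel_measurable borel" using w by (rule borel_measurable_ft)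
  show "(\<lambda>x. ft w (- x) - window (of_real (1 / real (Suc n))) w x) \<in> borel_measurable borel" for n
    using w by measurable
  show "(\<lambda>x. (cmod (ft w (- x)))\<^sup>2) \<in> borel_measurable borel" by measurable
  show "AE x in lborel. (cmod (ft w (- x) - window (of_real (1 / real (Suc n))) w x))\<^sup>2 \<le> (cmod (ft w (- x)))\<^sup>2" for n
    by (intro AE_I2 power_mono norm_window_le(2)) auto
  show "(\<integral>\<^sup>+ x. ennreal ((cmod (ft w (- x)))\<^sup>2) \<partial>lborel) < \<infinity>"
    using sqnorm_reflect[of "ft w"] plancherel[OF w fin] fin by (simp add: sqnorm_def)
  have "(\<lambda>n. exp (- of_real (1 / real (Suc n)) * (of_real x)\<^sup>2) * ft w (- x)) \<longlonglongrightarrow> exp (- of_real 0 * (of_real x)\<^sup>2) * ft w (- x)" for x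
    by (intro tendsto_intros LIMSEQ_Suc[OF lim_1_over_n])
  then have "(\<lambda>n. ft w (- x) - window (of_real (1 / real (Suc n))) w x) \<longlonglongrightarrow> ft w (- x) - exp (- of_real 0 * (of_real x)\<^sup>2) * ft w (- x)" for x
    unfolding window_def by (intro tendsto_diff tendsto_const)
  then show "AE x in lborel. (\<lambda>n. ft w (- x) - window (of_real (1 / real (Suc n))) w x) \<longlonglongrightarrow> 0"
    by simp
qed

text \<open>Plancherel is applied to the difference of \<open>w\<close> and the transform of its
  window, whose own transform is known from \<open>ft_ft_window\<close>. Thus inversion is used for
  the window only.\<close>

lemma sqnorm_ft_window_diff:
  assumes w: "integrable lborel w" and fin: "sqnorm w < \<infinity>" and d: "0 < d"
  shows "sqnorm (\<lambda>\<xi>. w \<xi> - ft (window (of_real d) w) \<xi>) = sqnorm (\<lambda>x. ft w (- x) - window (of_real d) w x)"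
    and "sqnorm (\<lambda>\<xi>. w \<xi> - ft (window (of_real d) w) \<xi>) < \<infinity>"
proof -
  let ?p = "window (of_real d) w"
  have Re: "0 < Re (of_real d)" using d by simp
  have [measurable]: "ft w \<in> borel_measurable borel" "w \<in> borel_measurable borel" "?p \<in> borel_measurable borel"
    using w by (auto intro: borel_measurable_ft borel_measurable_window dest: borel_measurable_integrable)
  have p: "integrable lborel ?p" by (rule window_integrable[OF w Re])
  have fp: "integrable lborel (ft ?p)" by (rule integrable_ft_window[OF w Re])
  have [measurable]: "ft ?p \<in> borel_measurable borel" using fp by (auto dest: borel_measurable_integrable)
  have pfin: "sqnorm ?p < \<infinity>"
  proof -
    have "sqnorm ?p \<le> sqnorm (\<lambda>x. ft w (- x))"
      unfolding sqnorm_def using d by (intro nn_integral_mono ennreal_leI power_mono norm_window_le(1)) auto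
    also have "\<dots> < \<infinity>" using sqnorm_reflect[of "ft w"] plancherel[OF w fin] fin by simp
    finally show ?thesis .
  qed
  have "sqnorm (\<lambda>\<xi>. w \<xi> - ft ?p \<xi>) \<le> 2 * sqnorm w + 2 * sqnorm (\<lambda>\<xi>. (w \<xi> - ft ?p \<xi>) - w \<xi>)"
    by (rule sqnorm_diff_le) measurable
  also have "sqnorm (\<lambda>\<xi>. (w \<xi> - ft ?p \<xi>) - w \<xi>) = sqnorm ?p"
    using plancherel[OF p pfin] by (simp add: sqnorm_def)
  finally show finite: "sqnorm (\<lambda>\<xi>. w \<xi> - ft ?p \<xi>) < \<infinity>"
    using fin pfin by (auto simp: ennreal_mult_less_top intro: le_less_trans)
  have "sqnorm (\<lambda>\<xi>. w \<xi> - ft ?p \<xi>) = sqnorm (ft (\<lambda>\<xi>. w \<xi> - ft ?p \<xi>))"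
    by (intro plancherel[symmetric] Bochner_Integration.integrable_diff w fp finite)
  also have "\<dots> = sqnorm (\<lambda>x. ft (\<lambda>\<xi>. w \<xi> - ft ?p \<xi>) (- x))"
    by (intro sqnorm_reflect[symmetric] borel_measurable_ft Bochner_Integration.integrable_diff w fp)
  also have "\<dots> = sqnorm (\<lambda>x. ft w (- x) - ?p x)"
    by (simp add: ft_diff[OF w fp] ft_ft_window[OF w Re])
  finally show "sqnorm (\<lambda>\<xi>. w \<xi> - ft ?p \<xi>) = sqnorm (\<lambda>x. ft w (- x) - ?p x)" .
qed

lemma integrable_multiplier:
  assumes "integrable lborel w"
  shows "integrable lborel (\<lambda>\<xi>. cis (- (t * \<xi>\<^sup>2)) * w \<xi>)"
  by (rule Bochner_Integration.integrable_bound[OF assms])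
    (use assms in \<open>auto simp: norm_mult dest: borel_measurable_integrable\<close>)

lemma sqnorm_multiplier: "sqnorm (\<lambda>\<xi>. cis (- (t * \<xi>\<^sup>2)) * w \<xi>) = sqnorm w"
  by (simp add: sqnorm_def norm_mult)

text \<open>\<open>thin_uncertainty\<close> is applied to the damped and chirped state
  \<open>window (z n) w\<close>. By \<open>window_evolution\<close> the modulus of its transform is,
  after scaling, that of the evolved damped state \<open>gn n\<close>, and the damped states
  converge in L^2 to the undamped ones at both times.\<close>

lemma thin_L2_observability:
  assumes \<tau>: "0 < (\<tau>::real)"
  obtains \<epsilon> C where "0 < \<epsilon>" "\<epsilon> \<le> 1" "0 < C"
    "\<And>E F w. E \<in> sets borel \<Longrightarrow> F \<in> sets borel \<Longrightarrow> thin_at_rho \<epsilon> E \<Longrightarrow> thin_at_rho \<epsilon> F \<Longrightarrow>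
      integrable lborel w \<Longrightarrow> sqnorm w < \<infinity> \<Longrightarrow>
      sqnorm w \<le> ennreal C * (sqnorm (\<lambda>x. indicator (- E) x * ft w (- x)) +
        sqnorm (\<lambda>y. indicator (- F) y * ft (\<lambda>\<xi>. cis (- (\<tau> * \<xi>\<^sup>2)) * w \<xi>) (- y)))"
proof -
  define b where "b = 2 * \<tau>"
  have b: "0 < b" using \<tau> by (simp add: b_def)
  obtain \<epsilon> C where \<epsilon>: "0 < \<epsilon>" "\<epsilon> \<le> 1" and C: "0 < C" and main: "\<And>E F h. E \<in> sets borel \<Longrightarrow> F \<in> sets borel \<Longrightarrow> thin_at_rho \<epsilon> E \<Longrightarrow> thin_at_rho \<epsilon> F \<Longrightarrow>
      integrable lborel h \<Longrightarrow> integrable lborel (ft h) \<Longrightarrow> (\<And>x. h x = ft (ft h) (- x)) \<Longrightarrow> sqnorm h < \<infinity> \<Longrightarrow>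
      sqnorm h \<le> ennreal C * (sqnorm (\<lambda>x. indicator (- E) x * h x) + sqnorm (\<lambda>\<xi>. indicator (- F) (b * \<xi>) * ft h \<xi>))"
    using thin_uncertainty[OF b] by blast
  show ?thesis
  proof (rule that[OF \<epsilon>])
    show "0 < 4 * C" using C by simp
    fix E F w
    assume EF[measurable]: "E \<in> sets borel" "F \<in> sets borel" and thin: "thin_at_rho \<epsilon> E" "thin_at_rho \<epsilon> F"
      and w: "integrable lborel w" and fin: "sqnorm w < \<infinity>"
    define d where "d n = 1 / real (Suc n)" for n
    define p where "p n = window (of_real (d n)) w" for n
    \<comment> \<open>The real part damps, and the imaginary part is the chirp e^{ix^2/4\<tau>},
      which leaves moduli unchanged.\<close>
    define z where "z n = of_real (d n) - \<i> / (4 * of_real \<tau>)" for n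
    define g where "g y = ft (\<lambda>\<xi>. cis (- (\<tau> * \<xi>\<^sup>2)) * w \<xi>) (- y)" for y
    define gn where "gn n y = ft (\<lambda>\<xi>. cis (- (\<tau> * \<xi>\<^sup>2)) * ft (p n) \<xi>) (- y)" for n y
    define e where "e n = sqnorm (\<lambda>x. ft w (- x) - p n x)" for n
    have d: "0 < d n" for n by (simp add: d_def)
    have Re: "0 < Re (of_real (d n))" "0 < Re (z n)" for n using d[of n] by (auto simp: z_def)
    have e0: "e \<longlonglongrightarrow> 0" unfolding e_def p_def d_def using tendsto_sqnorm_window[OF w fin] by simp
    have ifp: "integrable lborel (ft (p n))" for n unfolding p_def by (rule integrable_ft_window[OF w Re(1)])
    have [measurable]: "ft w \<in> borel_measurable borel" "p n \<in> borel_measurable borel" "w \<in> borel_measurable borel" "window (z n) w \<in> borel_measurable borel" for n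
      unfolding p_def using w by (auto intro: borel_measurable_ft borel_measurable_window dest: borel_measurable_integrable)
    have [measurable]: "g \<in> borel_measurable borel" "gn n \<in> borel_measurable borel" for n
      unfolding g_def[abs_def] gn_def[abs_def]
      by (rule measurable_compose[OF _ borel_measurable_ft[OF integrable_multiplier[OF w]]]
          measurable_compose[OF _ borel_measurable_ft[OF integrable_multiplier[OF ifp]]], simp)+
    have nrm: "cmod (window (z n) w x) = cmod (p n x)" for n x
      by (simp add: window_def p_def z_def norm_mult norm_exp power2_eq_square)
    have le: "cmod (p n x) \<le> cmod (ft w (- x))" for n x
      unfolding p_def using d[of n] by (intro norm_window_le(1)) simp
    have sqf: "sqnorm (\<lambda>x. ft w (- x)) = sqnorm w"
      using sqnorm_reflect[of "ft w"] plancherel[OF w fin] by simp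
    \<comment> \<open>The multiplier is unimodular, so the evolution preserves the damping
      error.\<close>
    have gdiff: "sqnorm (\<lambda>y. gn n y - g y) = e n" for n
    proof -
      note D = sqnorm_ft_window_diff[OF w fin d[of n], folded p_def]
      let ?u = "\<lambda>\<xi>. cis (- (\<tau> * \<xi>\<^sup>2)) * (w \<xi> - ft (p n) \<xi>)"
      have u: "integrable lborel ?u" by (intro integrable_multiplier Bochner_Integration.integrable_diff w ifp)
      have "sqnorm (\<lambda>y. gn n y - g y) = sqnorm (\<lambda>y. ft ?u (- y))"
        unfolding g_def gn_def right_diff_distrib
        by (simp add: ft_diff[OF integrable_multiplier[OF w] integrable_multiplier[OF ifp]] sqnorm_def norm_minus_commute)
      also have "\<dots> = sqnorm (ft ?u)" using u by (intro sqnorm_reflect borel_measurable_ft)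
      also have "\<dots> = sqnorm ?u" using D(2) by (intro plancherel u) (simp add: sqnorm_multiplier)
      also have "\<dots> = e n" using D(1) by (simp add: sqnorm_multiplier e_def)
      finally show ?thesis .
    qed
    have step: "sqnorm w \<le> 2 * (ennreal C * (sqnorm (\<lambda>x. indicator (- E) x * ft w (- x)) +
        (2 * sqnorm (\<lambda>y. indicator (- F) y * g y) + 2 * e n))) + 2 * e n" for n
    proof -
      let ?h = "window (z n) w"
      have sqh: "sqnorm ?h = sqnorm (p n)" by (simp add: sqnorm_def nrm)
      have "sqnorm (p n) \<le> sqnorm (\<lambda>x. ft w (- x))"
        unfolding sqnorm_def using le by (intro nn_integral_mono ennreal_leI power_mono) auto
      then have hfin: "sqnorm ?h < \<infinity>" using fin sqf sqh by (auto intro: le_less_trans)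
      have "sqnorm ?h \<le> ennreal C * (sqnorm (\<lambda>x. indicator (- E) x * ?h x) + sqnorm (\<lambda>\<xi>. indicator (- F) (b * \<xi>) * ft ?h \<xi>))"
        using ft_ft_window[OF w Re(2)] hfin
        by (intro main EF thin window_integrable integrable_ft_window w Re(2)) auto
      also have "sqnorm (\<lambda>x. indicator (- E) x * ?h x) \<le> sqnorm (\<lambda>x. indicator (- E) x * ft w (- x))"
        unfolding sqnorm_def using le[of n]
        by (intro nn_integral_mono ennreal_leI power_mono) (auto simp: norm_mult nrm intro!: mult_left_mono)
      also have "sqnorm (\<lambda>\<xi>. indicator (- F) (b * \<xi>) * ft ?h \<xi>) = sqnorm (\<lambda>y. indicator (- F) y * gn n y)"
      proof -
        have [measurable]: "ft ?h \<in> borel_measurable borel"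
          by (intro borel_measurable_ft window_integrable w Re(2))
        have eq: "(cmod (gn n y))\<^sup>2 = (cmod (ft ?h (y / b)))\<^sup>2 / b" for y
          unfolding gn_def p_def b_def by (rule window_evolution[OF w Re(1) \<tau>]) (simp add: z_def)
        have "sqnorm (\<lambda>y. indicator (- F) y * gn n y) = (\<integral>\<^sup>+ y. ennreal ((cmod (indicator (- F) y * ft ?h (y / b)))\<^sup>2 / b) \<partial>lborel)"
          unfolding sqnorm_def by (intro nn_integral_cong) (simp add: norm_mult power_mult_distrib eq)
        also have "\<dots> = ennreal b * (\<integral>\<^sup>+ \<xi>. ennreal ((cmod (indicator (- F) (b * \<xi>) * ft ?h \<xi>))\<^sup>2 / b) \<partial>lborel)"
          using nn_integral_real_affine[of "\<lambda>y. ennreal ((cmod (indicator (- F) y * ft ?h (y / b)))\<^sup>2 / b)" b 0] b by simp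
        also have "\<dots> = (\<integral>\<^sup>+ \<xi>. ennreal b * ennreal ((cmod (indicator (- F) (b * \<xi>) * ft ?h \<xi>))\<^sup>2 / b) \<partial>lborel)"
          by (rule nn_integral_cmult[symmetric]) measurable
        also have "\<dots> = sqnorm (\<lambda>\<xi>. indicator (- F) (b * \<xi>) * ft ?h \<xi>)"
          unfolding sqnorm_def using b by (intro nn_integral_cong) (simp flip: ennreal_mult)
        finally show ?thesis ..
      qed
      also have "sqnorm (\<lambda>y. indicator (- F) y * gn n y) \<le> 2 * sqnorm (\<lambda>y. indicator (- F) y * g y) + 2 * e n"
      proof -
        have "sqnorm (\<lambda>y. indicator (- F) y * gn n y) \<le> 2 * sqnorm (\<lambda>y. indicator (- F) y * g y)
            + 2 * sqnorm (\<lambda>y. indicator (- F) y * gn n y - indicator (- F) y * g y)"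
          by (rule sqnorm_diff_le) measurable
        also have "sqnorm (\<lambda>y. indicator (- F) y * gn n y - indicator (- F) y * g y) \<le> sqnorm (\<lambda>y. gn n y - g y)"
          unfolding sqnorm_def by (intro nn_integral_mono ennreal_leI) (auto simp: indicator_def)
        finally show ?thesis by (simp add: gdiff add_left_mono mult_left_mono)
      qed
      finally have 1: "sqnorm (p n) \<le> ennreal C * (sqnorm (\<lambda>x. indicator (- E) x * ft w (- x)) +
        (2 * sqnorm (\<lambda>y. indicator (- F) y * g y) + 2 * e n))"
        by (simp add: sqh add_left_mono add_right_mono mult_left_mono)
      have "sqnorm (\<lambda>x. ft w (- x)) \<le> 2 * sqnorm (p n) + 2 * e n"
        unfolding e_def by (rule sqnorm_diff_le) measurable
      also have "\<dots> \<le> 2 * (ennreal C * (sqnorm (\<lambda>x. indicator (- E) x * ft w (- x)) +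
        (2 * sqnorm (\<lambda>y. indicator (- F) y * g y) + 2 * e n))) + 2 * e n"
        using 1 by (intro add_right_mono mult_left_mono) auto
      finally show ?thesis by (simp add: sqf)
    qed
    have "(\<lambda>n. 2 * (ennreal C * (sqnorm (\<lambda>x. indicator (- E) x * ft w (- x)) +
        (2 * sqnorm (\<lambda>y. indicator (- F) y * g y) + 2 * e n))) + 2 * e n)
      \<longlonglongrightarrow> 2 * (ennreal C * (sqnorm (\<lambda>x. indicator (- E) x * ft w (- x)) +
        (2 * sqnorm (\<lambda>y. indicator (- F) y * g y) + 2 * 0))) + 2 * 0"
      by (intro tendsto_add tendsto_const ennreal_tendsto_cmult e0) auto
    then have "sqnorm w \<le> 2 * (ennreal C * (sqnorm (\<lambda>x. indicator (- E) x * ft w (- x)) +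
        (2 * sqnorm (\<lambda>y. indicator (- F) y * g y) + 2 * 0))) + 2 * 0"
      using step by (intro LIMSEQ_le_const) auto
    also have "\<dots> \<le> 2 * (ennreal C * (2 * sqnorm (\<lambda>x. indicator (- E) x * ft w (- x)) + 2 * sqnorm (\<lambda>y. indicator (- F) y * g y)))"
      by (simp, intro mult_left_mono add_right_mono) (auto simp: mult_2)
    also have "\<dots> = ennreal (4 * C) * (sqnorm (\<lambda>x. indicator (- E) x * ft w (- x)) + sqnorm (\<lambda>y. indicator (- F) y * g y))"
    proof -
      have "2 * (c * (2 * X + 2 * Y)) = 4 * c * (X + Y)" for c X Y :: ennreal
      proof -
        have "c * (2 * X + 2 * Y) = 2 * (c * (X + Y))" by (simp add: distrib_left mult.left_commute)
        then show ?thesis by (simp add: mult.assoc[symmetric])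
      qed
      moreover have "ennreal (4 * C) = 4 * ennreal C" using C by (simp add: ennreal_mult)
      ultimately show ?thesis by simp
    qed
    finally show "sqnorm w \<le> ennreal (4 * C) * (sqnorm (\<lambda>x. indicator (- E) x * ft w (- x)) +
        sqnorm (\<lambda>y. indicator (- F) y * ft (\<lambda>\<xi>. cis (- (\<tau> * \<xi>\<^sup>2)) * w \<xi>) (- y)))"
      by (simp add: g_def)
  qed
qed

text \<open>A null set is added to obtain a Borel hull. Enlarging the exceptional set only shrinks
  the region whose L^2 norm is used.\<close>

lemma thin_rho_ex_borel:
  assumes "thin rho \<epsilon> E"
  obtains E' where "E' \<in> sets borel" "E \<subseteq> E'" "thin_at_rho \<epsilon> E'"
proof -
  have E: "E \<in> sets lebesgue" and thin: "\<And>x. emeasure lebesgue (E \<inter> ball x (rho x)) \<le> ennreal (\<epsilon> * rho x)"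
    using assms by (auto simp: thin_def)
  obtain S N N' where S: "E = S \<union> N" "N \<subseteq> N'" "N' \<in> null_sets lborel" "S \<in> sets lborel"
    using sets_completionE[OF E] by metis
  let ?E = "S \<union> N'"
  have N': "N' \<in> sets lborel" using S(3) by auto
  have "emeasure lborel (?E \<inter> ball x (rho x)) \<le> ennreal (\<epsilon> * rho x)" for x
  proof -
    have "emeasure lborel (?E \<inter> ball x (rho x)) \<le> emeasure lborel ((S \<inter> ball x (rho x)) \<union> N')"
      using S N' by (intro emeasure_mono) auto
    also have "\<dots> = emeasure lborel (S \<inter> ball x (rho x))"
      using S by (intro emeasure_Un_null_set) auto
    also have "\<dots> = emeasure lebesgue (S \<inter> ball x (rho x))"
      using S(4) by simp
    also have "\<dots> \<le> emeasure lebesgue (E \<inter> ball x (rho x))"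
      using S E by (intro emeasure_mono sets.Int) auto
    finally show ?thesis using thin[of x] by order
  qed
  then show ?thesis using S N' by (intro that[of ?E]) (auto simp: thin_at_rho_def)
qed

lemma finite_sum_le_infsum_ennreal:
  fixes a :: "int \<Rightarrow> ennreal"
  assumes "finite A"
  shows "sum a A \<le> (\<Sum>\<^sub>\<infinity>k. a k)"
proof -
  have "infsum a UNIV = (SUP F\<in>{F. finite F \<and> F \<subseteq> UNIV}. sum a F)"
    by (rule nonneg_infsum_complete) simp
  then show ?thesis using assms by (simp add: SUP_upper)
qed

text \<open>Points off \<open>E'\<close> lie in \<open>E\<close>, and cells have length 1, so each
  cell contributes at most its squared supremum. The line is exhausted by the intervals
  \<open>I n\<close>, which meet finitely many cells.\<close>

lemma sqnorm_le_local_sup: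
  assumes [measurable]: "f \<in> borel_measurable borel" "E' \<in> sets borel" and E: "- E \<subseteq> E'"
  shows "sqnorm (\<lambda>x. indicator (- E') x * f x) \<le> l2_norm_sq (local_sup E f)"
proof -
  let ?F = "\<lambda>x. ennreal ((cmod (indicator (- E') x * f x))\<^sup>2)"
  define I where "I n = {- real n ..< real n}" for n
  have UI: "\<exists>n. x \<in> I n" for x :: real
  proof -
    obtain n where "\<bar>x\<bar> < real n" using reals_Archimedean2 by blast
    then show ?thesis by (intro exI[of _ n]) (auto simp: I_def)
  qed
  have "(\<lambda>n. \<integral>\<^sup>+ x. ?F x * indicator (I n) x \<partial>lborel) \<longlonglongrightarrow>
    (\<integral>\<^sup>+ x. ?F x \<partial>lborel)"
  proof (rule nn_integral_LIMSEQ)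
    show "incseq (\<lambda>n x. ?F x * indicator (I n) x)"
      by (intro incseq_SucI le_funI mult_left_mono) (auto simp: I_def indicator_def)
    show "(\<lambda>x. ?F x * indicator (I n) x) \<in> borel_measurable lborel" for n
      unfolding I_def by measurable
    fix x
    obtain N where "x \<in> I N" using UI by blast
    then have "\<forall>n\<ge>N. ?F x * indicator (I n) x = ?F x"
      by (auto simp: I_def indicator_def)
    then show "(\<lambda>n. ?F x * indicator (I n) x) \<longlonglongrightarrow> ?F x"
      by (intro tendsto_eventually) (auto simp: eventually_sequentially)
  qed
  moreover have "(\<integral>\<^sup>+ x. ?F x * indicator (I n) x \<partial>lborel) \<le> l2_norm_sq (local_sup E f)" for n
  proof -
    let ?J = "{- int n ..< int n}"
    \<comment> \<open>Half-open cells partition the line, while \<open>local_sup\<close> is taken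
      over closed ones.\<close>
    let ?c = "\<lambda>k::int. {of_int k ..< of_int k + 1 :: real}"
    have "?F x * indicator (I n) x \<le> (\<Sum>k\<in>?J. (local_sup E f k)\<^sup>2 * indicator (?c k) x)" for x
    proof (cases "x \<in> I n \<and> x \<notin> E'")
      case True
      define k where "k = \<lfloor>x\<rfloor>"
      have k: "k \<in> ?J" "x \<in> ?c k"
        using True by (auto simp: k_def I_def le_floor_iff floor_less_iff)
      have "x \<in> E \<inter> {of_int k .. of_int k + 1}" using True E k(2) by auto
      then have "ennreal (cmod (f x)) \<le> local_sup E f k"
        unfolding local_sup_def by (rule SUP_upper)
      then have "(ennreal (cmod (f x)))\<^sup>2 \<le> (local_sup E f k)\<^sup>2" by (intro power_mono) auto
      then have "?F x * indicator (I n) x \<le> (local_sup E f k)\<^sup>2 * indicator (?c k) x"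
        using True k(2) by (simp add: ennreal_power)
      also have "\<dots> \<le> (\<Sum>k\<in>?J. (local_sup E f k)\<^sup>2 * indicator (?c k) x)"
        using k(1) by (intro member_le_sum) auto
      finally show ?thesis .
    qed (auto simp: indicator_def)
    then have "(\<integral>\<^sup>+ x. ?F x * indicator (I n) x \<partial>lborel)
      \<le> (\<integral>\<^sup>+ x. (\<Sum>k\<in>?J. (local_sup E f k)\<^sup>2 * indicator (?c k) x) \<partial>lborel)"
      by (intro nn_integral_mono)
    also have "\<dots> = (\<Sum>k\<in>?J. (local_sup E f k)\<^sup>2)"
      by (subst nn_integral_sum) (auto simp: nn_integral_cmult_indicator)
    also have "\<dots> \<le> l2_norm_sq (local_sup E f)"
      unfolding l2_norm_sq_def by (rule finite_sum_le_infsum_ennreal) simp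
    finally show ?thesis .
  qed
  ultimately show ?thesis unfolding sqnorm_def by (intro LIMSEQ_le_const2) auto
qed

lemma observability_from_thin_sets:
  fixes S T :: real
  assumes "S < T"
  shows "\<exists>\<epsilon> C. 0 < \<epsilon> \<and> \<epsilon> \<le> 1 \<and> 0 < C \<and>
    (\<forall>E1 E2. thin rho \<epsilon> (- E1) \<longrightarrow> thin rho \<epsilon> (- E2) \<longrightarrow>
      (\<forall>u0 \<in> (\<Inter>k. sobolev k). observability_ineq S T E1 E2 C u0))"
proof -
  have "0 < T - S" using assms by simp
  then obtain \<epsilon> C where \<epsilon>: "0 < \<epsilon>" "\<epsilon> \<le> 1" and C: "0 < C" and main: "\<And>E F w. E \<in> sets borel \<Longrightarrow> F \<in> sets borel \<Longrightarrow> thin_at_rho \<epsilon> E \<Longrightarrow> thin_at_rho \<epsilon> F \<Longrightarrow>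
      integrable lborel w \<Longrightarrow> sqnorm w < \<infinity> \<Longrightarrow>
      sqnorm w \<le> ennreal C * (sqnorm (\<lambda>x. indicator (- E) x * ft w (- x)) +
        sqnorm (\<lambda>y. indicator (- F) y * ft (\<lambda>\<xi>. cis (- ((T - S) * \<xi>\<^sup>2)) * w \<xi>) (- y)))"
    using thin_L2_observability by blast
  \<comment> \<open>The factor 2 is the one in \<open>sobolev_fourier_side\<close>.\<close>
  have "observability_ineq S T E1 E2 (2 * C) u0"
    if thin: "thin rho \<epsilon> (- E1)" "thin rho \<epsilon> (- E2)" and u0: "u0 \<in> (\<Inter>k. sobolev k)" for E1 E2 u0
  proof -
    obtain E where E: "E \<in> sets borel" "- E1 \<subseteq> E" "thin_at_rho \<epsilon> E" using thin_rho_ex_borel[OF thin(1)] by blast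
    obtain F where F: "F \<in> sets borel" "- E2 \<subseteq> F" "thin_at_rho \<epsilon> F" using thin_rho_ex_borel[OF thin(2)] by blast
    obtain v where v: "integrable lborel v" "sqnorm v < \<infinity>" "L2_norm_sq u0 \<le> 2 * sqnorm v"
      and sol: "\<And>t x. schrodinger_solution u0 t x = ft (\<lambda>\<xi>. cis (- (t * \<xi>\<^sup>2)) * v \<xi>) (- x)"
      using sobolev_fourier_side[OF u0] by blast
    \<comment> \<open>The frequency profile at time \<open>S\<close>, from which the time
      \<open>T - S\<close> remains to be evolved.\<close>
    define w where "w = (\<lambda>\<xi>. cis (- (S * \<xi>\<^sup>2)) * v \<xi>)"
    have w: "integrable lborel w" unfolding w_def by (rule integrable_multiplier[OF v(1)])
    have sqw: "sqnorm w = sqnorm v" unfolding w_def by (rule sqnorm_multiplier)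
    have solS: "schrodinger_solution u0 S = (\<lambda>x. ft w (- x))" by (simp add: sol w_def fun_eq_iff)
    have "cis (- (T * \<xi>\<^sup>2)) = cis (- ((T - S) * \<xi>\<^sup>2)) * cis (- (S * \<xi>\<^sup>2))" for \<xi>
      by (simp add: cis_mult algebra_simps)
    then have solT: "schrodinger_solution u0 T = (\<lambda>y. ft (\<lambda>\<xi>. cis (- ((T - S) * \<xi>\<^sup>2)) * w \<xi>) (- y))"
      by (simp add: sol w_def fun_eq_iff mult.assoc)
    have meas: "(\<lambda>x. ft u (- x)) \<in> borel_measurable borel" if "integrable lborel u" for u
      by (rule measurable_compose[OF _ borel_measurable_ft[OF that]]) simp
    have "L2_norm_sq u0 \<le> 2 * sqnorm w" using v(3) sqw by simp
    also have "\<dots> \<le> 2 * (ennreal C * (sqnorm (\<lambda>x. indicator (- E) x * schrodinger_solution u0 S x) +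
        sqnorm (\<lambda>y. indicator (- F) y * schrodinger_solution u0 T y)))"
      unfolding solS solT using v(2) sqw by (intro mult_left_mono main E F w) auto
    also have "\<dots> \<le> 2 * (ennreal C * (l2_norm_sq (local_sup E1 (schrodinger_solution u0 S)) + l2_norm_sq (local_sup E2 (schrodinger_solution u0 T))))"
      unfolding solS solT
      by (intro mult_left_mono add_mono sqnorm_le_local_sup E F meas w integrable_multiplier) auto
    finally show ?thesis using C by (simp add: observability_ineq_def ennreal_mult mult.assoc)
  qed
  then show ?thesis using \<epsilon> C by (intro exI[of _ \<epsilon>] exI[of _ "2 * C"]) auto
qed

section \<open>Interfering wave packets\<close>

lemma ft_add:
  assumes "integrable lborel f" "integrable lborel g"
  shows "ft (\<lambda>x. f x + g x) \<xi> = ft f \<xi> + ft g \<xi>"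
  unfolding ft_def
  by (simp add: distrib_left Bochner_Integration.integral_add integrable_cis_mult assms)

text \<open>A class with pointwise inversion that is closed under \<open>ft\<close>, reflection and
  the propagator multiplier, so that a state prescribed at time \<open>S\<close> can be carried back
  to time 0 within the class.\<close>

inductive gaussian_sum :: "(real \<Rightarrow> complex) \<Rightarrow> bool" where
  gaussian_sum_gauss: "0 < Re z \<Longrightarrow> gaussian_sum (\<lambda>x. c * gauss z w x)"
| gaussian_sum_add: "gaussian_sum f \<Longrightarrow> gaussian_sum g \<Longrightarrow> gaussian_sum (\<lambda>x. f x + g x)"

lemma gaussian_sum_bound:
  assumes "gaussian_sum f"
  shows "\<exists>M a. 0 \<le> M \<and> 0 < a \<and> (\<forall>x. cmod (f x) \<le> M * exp (- a * x\<^sup>2))"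
  using assms
proof induction
  case (gaussian_sum_gauss z c w)
  let ?M = "cmod c * exp ((\<bar>Re w\<bar> + 1)\<^sup>2 / (2 * Re z))"
  have "cmod (c * gauss z w x) \<le> ?M * exp (- (Re z / 2) * x\<^sup>2)" for x
    using mult_left_mono[OF norm_gaussian_le[OF gaussian_sum_gauss order_refl, of x 0 w] norm_ge_zero[of c]]
    by (simp add: gauss_def norm_mult mult.assoc)
  then show ?case using gaussian_sum_gauss by (intro exI[of _ ?M] exI[of _ "Re z / 2"]) auto
next
  case (gaussian_sum_add f g)
  then obtain M a M' a' where M: "0 \<le> M" "0 < a" "\<And>x. cmod (f x) \<le> M * exp (- a * x\<^sup>2)"
    and M': "0 \<le> M'" "0 < a'" "\<And>x. cmod (g x) \<le> M' * exp (- a' * x\<^sup>2)" by blast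
  have "cmod (f x + g x) \<le> (M + M') * exp (- min a a' * x\<^sup>2)" for x
  proof -
    have "min a a' * x\<^sup>2 \<le> a * x\<^sup>2" "min a a' * x\<^sup>2 \<le> a' * x\<^sup>2" by (auto intro!: mult_right_mono)
    then have "M * exp (- a * x\<^sup>2) + M' * exp (- a' * x\<^sup>2) \<le> M * exp (- min a a' * x\<^sup>2) + M' * exp (- min a a' * x\<^sup>2)"
      using M M' by (intro add_mono mult_left_mono) auto
    then show ?thesis using norm_triangle_ineq[of "f x" "g x"] M(3)[of x] M'(3)[of x] by (simp add: distrib_right)
  qed
  then show ?case using M M' by (intro exI[of _ "M + M'"] exI[of _ "min a a'"]) auto
qed

lemma borel_measurable_gaussian_sum: "gaussian_sum f \<Longrightarrow> f \<in> borel_measurable borel"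
  by (induction rule: gaussian_sum.induct) measurable

lemma gaussian_sum_weighted:
  assumes f: "gaussian_sum f"
  shows "(\<integral>\<^sup>+ x. ennreal ((1 + x\<^sup>2) ^ k * (cmod (f x))\<^sup>2) \<partial>lborel) < \<infinity>"
proof -
  obtain M a where M: "0 \<le> M" "0 < a" "\<And>x. cmod (f x) \<le> M * exp (- a * x\<^sup>2)"
    using gaussian_sum_bound[OF f] by blast
  \<comment> \<open>Chosen with \<open>k * s \<le> a\<close>, so that \<open>(1 + x^2) ^ k\<close>
    is at most s^(-k) exp(a x^2), which uses up half of the decay of |f|^2.\<close>
  define s where "s = min 1 (a / real (Suc k))"
  have s: "0 < s" "s \<le> 1" using M(2) by (auto simp: s_def)
  have ks: "real k * s \<le> a"
  proof -
    have "real k * s \<le> real k * (a / real (Suc k))" unfolding s_def by (intro mult_left_mono) auto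
    also have "\<dots> \<le> a" using M(2) by (simp add: field_simps)
    finally show ?thesis .
  qed
  have "(1 + x\<^sup>2) ^ k * (cmod (f x))\<^sup>2 \<le> (1 / s) ^ k * M\<^sup>2 * exp (- a * x\<^sup>2)" for x
  proof -
    have "s * (1 + x\<^sup>2) \<le> 1 + s * x\<^sup>2" using s by (simp add: distrib_left)
    also have "\<dots> \<le> exp (s * x\<^sup>2)" by (rule exp_ge_add_one_self)
    finally have "1 + x\<^sup>2 \<le> 1 / s * exp (s * x\<^sup>2)" using s by (simp add: field_simps)
    then have "(1 + x\<^sup>2) ^ k \<le> (1 / s * exp (s * x\<^sup>2)) ^ k" by (intro power_mono) auto
    also have "\<dots> = (1 / s) ^ k * exp (real k * s * x\<^sup>2)"
      unfolding power_mult_distrib by (simp only: exp_of_nat_mult mult.assoc)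
    also have "\<dots> \<le> (1 / s) ^ k * exp (a * x\<^sup>2)"
      using ks s by (intro mult_left_mono) (auto intro!: mult_right_mono)
    finally have 1: "(1 + x\<^sup>2) ^ k \<le> (1 / s) ^ k * exp (a * x\<^sup>2)" .
    have "(cmod (f x))\<^sup>2 \<le> (M * exp (- a * x\<^sup>2))\<^sup>2" by (intro power_mono M) auto
    also have "\<dots> = M\<^sup>2 * exp (- 2 * a * x\<^sup>2)"
      by (simp add: power_mult_distrib power2_eq_square[of "exp _"] exp_add[symmetric])
    finally have 2: "(cmod (f x))\<^sup>2 \<le> M\<^sup>2 * exp (- 2 * a * x\<^sup>2)" .
    have "(1 + x\<^sup>2) ^ k * (cmod (f x))\<^sup>2 \<le> ((1 / s) ^ k * exp (a * x\<^sup>2)) * (M\<^sup>2 * exp (- 2 * a * x\<^sup>2))"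
      using s by (intro mult_mono 1 2) auto
    also have "\<dots> = (1 / s) ^ k * M\<^sup>2 * (exp (a * x\<^sup>2) * exp (- 2 * a * x\<^sup>2))" by (simp add: mult_ac)
    also have "exp (a * x\<^sup>2) * exp (- 2 * a * x\<^sup>2) = exp (- a * x\<^sup>2)" by (simp add: exp_add[symmetric])
    finally show ?thesis .
  qed
  then have "(\<integral>\<^sup>+ x. ennreal ((1 + x\<^sup>2) ^ k * (cmod (f x))\<^sup>2) \<partial>lborel)
    \<le> (\<integral>\<^sup>+ x. ennreal ((1 / s) ^ k * M\<^sup>2 * exp (- a * x\<^sup>2)) \<partial>lborel)"
    by (intro nn_integral_mono ennreal_leI)
  also have "\<dots> = ennreal (LINT x|lborel. (1 / s) ^ k * M\<^sup>2 * exp (- a * x\<^sup>2))"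
    using has_bochner_integral_gaussian[OF M(2)] s
    by (intro nn_integral_eq_integral integrable_mult_right) (auto simp: has_bochner_integral_iff)
  finally show ?thesis by (rule le_less_trans) simp
qed

lemma gaussian_sum_sqnorm: "gaussian_sum f \<Longrightarrow> sqnorm f < \<infinity>"
  using gaussian_sum_weighted[of f 0] by (simp add: sqnorm_def)

lemma integrable_gaussian_sum: "gaussian_sum f \<Longrightarrow> integrable lborel f"
  by (induction rule: gaussian_sum.induct)
    (intro integrable_mult_right integrable_gauss Bochner_Integration.integrable_add; assumption)+

lemma ft_gauss_eq_gauss:
  assumes "0 < Re z"
  shows "ft (gauss z w) \<xi> = exp (w\<^sup>2 / (4 * z)) / (of_real (sqrt 2) * csqrt z) * gauss (1 / (4 * z)) (- \<i> * w / (2 * z)) \<xi>"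
proof -
  have "z \<noteq> 0" using assms by auto
  then have "(w - \<i> * \<xi>)\<^sup>2 / (4 * z) = w\<^sup>2 / (4 * z) + (- (1 / (4 * z)) * (of_real \<xi>)\<^sup>2 + (- \<i> * w / (2 * z)) * of_real \<xi>)"
    by (simp add: field_simps power2_eq_square)
  then show ?thesis by (simp only: ft_gauss[OF assms] gauss_def exp_add) simp
qed

lemma gaussian_sum_ft: "gaussian_sum f \<Longrightarrow> gaussian_sum (ft f)"
proof (induction rule: gaussian_sum.induct)
  case (gaussian_sum_gauss z c w)
  have "ft (\<lambda>x. c * gauss z w x) = (\<lambda>\<xi>. (c * (exp (w\<^sup>2 / (4 * z)) / (of_real (sqrt 2) * csqrt z))) * gauss (1 / (4 * z)) (- \<i> * w / (2 * z)) \<xi>)"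
    by (rule ext) (simp only: ft_cmult ft_gauss_eq_gauss[OF gaussian_sum_gauss] mult.assoc)
  then show ?case by (simp only: gaussian_sum.gaussian_sum_gauss[OF Re_quarter_inverse[OF gaussian_sum_gauss]])
next
  case (gaussian_sum_add f g)
  then have "ft (\<lambda>x. f x + g x) = (\<lambda>\<xi>. ft f \<xi> + ft g \<xi>)"
    by (intro ext ft_add integrable_gaussian_sum)
  then show ?case using gaussian_sum.gaussian_sum_add gaussian_sum_add by simp
qed

lemma gaussian_sum_multiplier: "gaussian_sum f \<Longrightarrow> gaussian_sum (\<lambda>\<xi>. cis (t * \<xi>\<^sup>2) * f \<xi>)"
proof (induction rule: gaussian_sum.induct)
  case (gaussian_sum_gauss z c w)
  have "(\<lambda>\<xi>. cis (t * \<xi>\<^sup>2) * (c * gauss z w \<xi>)) = (\<lambda>\<xi>. c * gauss (z - \<i> * t) w \<xi>)"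
    by (rule ext) (simp add: gauss_def cis_conv_exp exp_add[symmetric] algebra_simps)
  moreover have "0 < Re (z - \<i> * t)" using gaussian_sum_gauss by simp
  ultimately show ?case by (simp only: gaussian_sum.gaussian_sum_gauss)
next
  case (gaussian_sum_add f g)
  then show ?case using gaussian_sum.gaussian_sum_add by (simp add: distrib_left)
qed

lemma gaussian_sum_reflect: "gaussian_sum f \<Longrightarrow> gaussian_sum (\<lambda>x. f (- x))"
proof (induction rule: gaussian_sum.induct)
  case (gaussian_sum_gauss z c w)
  have "gauss z w (- x) = gauss z (- w) x" for x by (simp add: gauss_def)
  then show ?case using gaussian_sum.gaussian_sum_gauss[OF gaussian_sum_gauss] by simp
qed (rule gaussian_sum.gaussian_sum_add)

lemma gaussian_sum_inversion: "gaussian_sum f \<Longrightarrow> ft (ft f) (- x) = f x"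
proof (induction rule: gaussian_sum.induct)
  case (gaussian_sum_gauss z c w)
  have nz: "z \<noteq> 0" "csqrt z \<noteq> 0" using gaussian_sum_gauss by auto
  let ?K = "exp (w\<^sup>2 / (4 * z)) / (of_real (sqrt 2) * csqrt z)"
  have Re: "0 < Re (1 / (4 * z))" by (rule Re_quarter_inverse[OF gaussian_sum_gauss])
  have "ft (ft (\<lambda>x. c * gauss z w x)) (- x) = c * (?K * ft (gauss (1 / (4 * z)) (- \<i> * w / (2 * z))) (- x))"
  proof -
    have "ft (\<lambda>x. c * gauss z w x) = (\<lambda>\<xi>. c * (?K * gauss (1 / (4 * z)) (- \<i> * w / (2 * z)) \<xi>))"
      by (rule ext) (simp only: ft_cmult ft_gauss_eq_gauss[OF gaussian_sum_gauss])
    then show ?thesis by (simp only: ft_cmult)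
  qed
  also have "ft (gauss (1 / (4 * z)) (- \<i> * w / (2 * z))) (- x)
      = exp ((- \<i> * w / (2 * z) + \<i> * x)\<^sup>2 * z) * (2 * csqrt z) / of_real (sqrt 2)"
    using nz by (simp add: ft_gauss[OF Re] csqrt_quarter_inverse[OF gaussian_sum_gauss])
  also have "c * (?K * (exp ((- \<i> * w / (2 * z) + \<i> * x)\<^sup>2 * z) * (2 * csqrt z) / of_real (sqrt 2)))
      = c * (exp (w\<^sup>2 / (4 * z)) * exp ((- \<i> * w / (2 * z) + \<i> * x)\<^sup>2 * z))"
    using nz by (simp add: field_simps flip: of_real_mult)
  also have "exp (w\<^sup>2 / (4 * z)) * exp ((- \<i> * w / (2 * z) + \<i> * x)\<^sup>2 * z) = gauss z w x"
  proof -
    have "w\<^sup>2 / (4 * z) + (- \<i> * w / (2 * z) + \<i> * x)\<^sup>2 * z = - z * (of_real x)\<^sup>2 + w * of_real x"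
      using nz by (simp add: field_simps power2_eq_square)
    then show ?thesis by (simp only: gauss_def flip: exp_add)
  qed
  finally show ?case .
next
  case (gaussian_sum_add f g)
  then have "ft (\<lambda>x. f x + g x) = (\<lambda>\<xi>. ft f \<xi> + ft g \<xi>)"
    by (intro ext ft_add integrable_gaussian_sum)
  then show ?case using gaussian_sum_add
    by (simp add: ft_add integrable_gaussian_sum gaussian_sum_ft)
qed

lemma ft_reflect: "ft (\<lambda>x. f (- x)) \<xi> = ft f (- \<xi>)"
  using lborel_integral_real_affine[of "-1" "\<lambda>x. cis (- (x * \<xi>)) * f (- x)" 0] by (simp add: ft_def)

text \<open>The flow is run backwards: the multiplier \<open>cis (S * \<xi>^2)\<close> undoes the
  evolution from time 0 to \<open>S\<close>.\<close>

lemma ex_gaussian_sum_data: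
  fixes S T :: real
  assumes f: "gaussian_sum f"
  obtains u0 where "u0 \<in> (\<Inter>k. sobolev k)" "L2_norm_sq u0 = sqnorm f"
    "schrodinger_solution u0 S = f"
    "schrodinger_solution u0 T = (\<lambda>y. ft (\<lambda>\<xi>. cis (- ((T - S) * \<xi>\<^sup>2)) * ft f \<xi>) (- y))"
proof -
  define v where "v \<xi> = cis (S * \<xi>\<^sup>2) * ft f \<xi>" for \<xi>
  define u0 where "u0 x = ft v (- x)" for x
  have v: "gaussian_sum v" unfolding v_def[abs_def] by (intro gaussian_sum_multiplier gaussian_sum_ft f)
  have u0: "gaussian_sum u0" unfolding u0_def[abs_def] by (intro gaussian_sum_reflect gaussian_sum_ft v)
  have ftu: "ft u0 = v"
    unfolding u0_def[abs_def] by (simp add: fun_eq_iff ft_reflect gaussian_sum_inversion[OF v])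
  have L2: "L2 u0"
    using gaussian_sum_sqnorm[OF u0] borel_imp_lebesgue_measurable[OF borel_measurable_gaussian_sum[OF u0]]
    by (simp add: L2_def L2_norm_sq_eq_sqnorm)
  have four: "AE \<xi> in lborel. L2_fourier u0 \<xi> = v \<xi>"
    using L2_fourier_eq_ft[OF integrable_gaussian_sum[OF u0] gaussian_sum_sqnorm[OF u0]] by (simp add: ftu)
  have "u0 \<in> sobolev k" for k
  proof -
    have "(\<integral>\<^sup>+ \<xi>. ennreal ((1 + \<xi>\<^sup>2) ^ k * (cmod (L2_fourier u0 \<xi>))\<^sup>2) \<partial>lborel)
      = (\<integral>\<^sup>+ \<xi>. ennreal ((1 + \<xi>\<^sup>2) ^ k * (cmod (v \<xi>))\<^sup>2) \<partial>lborel)"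
      using four by (intro nn_integral_cong_AE) auto
    then show ?thesis using L2 gaussian_sum_weighted[OF v, of k] by (simp add: sobolev_def nn_integral_completion)
  qed
  then have u0_sob: "u0 \<in> (\<Inter>k. sobolev k)" by blast
  have sol: "schrodinger_solution u0 t x = ft (\<lambda>\<xi>. cis (- (t * \<xi>\<^sup>2)) * v \<xi>) (- x)" for t x
    by (rule schrodinger_solution_eq[OF L2 integrable_gaussian_sum[OF v] gaussian_sum_sqnorm[OF v] four])
  have "cis (- (S * \<xi>\<^sup>2)) * v \<xi> = ft f \<xi>" for \<xi> by (simp add: v_def mult.assoc[symmetric] cis_mult)
  then have S: "schrodinger_solution u0 S = f"
    by (simp add: fun_eq_iff sol gaussian_sum_inversion[OF f])
  have "cis (- (T * \<xi>\<^sup>2)) * v \<xi> = cis (- ((T - S) * \<xi>\<^sup>2)) * ft f \<xi>" for \<xi>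
    by (simp add: v_def mult.assoc[symmetric] cis_mult) (simp add: algebra_simps)
  then have T: "schrodinger_solution u0 T = (\<lambda>y. ft (\<lambda>\<xi>. cis (- ((T - S) * \<xi>\<^sup>2)) * ft f \<xi>) (- y))"
    by (simp add: fun_eq_iff sol)
  have "sqnorm u0 = sqnorm (ft u0)" by (intro plancherel[symmetric] integrable_gaussian_sum gaussian_sum_sqnorm u0)
  also have "\<dots> = sqnorm (ft f)" by (simp add: ftu v_def[abs_def] sqnorm_def norm_mult)
  also have "\<dots> = sqnorm f" by (intro plancherel integrable_gaussian_sum gaussian_sum_sqnorm f)
  finally show ?thesis using that[OF u0_sob _ S T] by (simp add: L2_norm_sq_eq_sqnorm)
qed

lemma norm_cis_diff: "cmod (cis x - cis y) = cmod (cis (x - y) - 1)"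
proof -
  have "cis x - cis y = cis y * (cis (x - y) - 1)" by (simp add: right_diff_distrib cis_mult)
  then show ?thesis by (simp add: norm_mult)
qed

lemma norm_cis_minus_1_le: "cmod (cis x - 1) \<le> \<bar>x\<bar>"
proof -
  have "cmod (cis x - 1) = 2 * \<bar>sin (x / 2)\<bar>"
    using dist_exp_i_1[of x] by (simp add: cis_conv_exp)
  also have "\<dots> \<le> 2 * \<bar>x / 2\<bar>" by (intro mult_left_mono abs_sin_x_le_abs_x) auto
  finally show ?thesis by simp
qed

text \<open>Four wave packets whose positions at the two times form a rectangle: at either time they overlap in
  pairs and interfere destructively along the lattice \<open>2\<pi>/N \<int>\<close>.\<close>

lemma ex_interfering_packets:
  fixes \<tau> a N d :: real and l j :: int
  assumes \<tau>: "0 < \<tau>" and d: "d = 2 * \<tau> * N" and Nd: "N * d = 2 * pi * of_int l" and Na: "N * a = pi + 2 * pi * of_int j"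
  defines "G \<equiv> \<lambda>x. exp (- (x\<^sup>2 / (4 * \<tau>)))"
  obtains f where "gaussian_sum f"
    "\<And>x. cmod (f x) = cmod (cis (N * x) - 1) * (G (x - a) + G (x - a - d))"
    "\<And>y. cmod (ft (\<lambda>\<xi>. cis (- (\<tau> * \<xi>\<^sup>2)) * ft f \<xi>) (- y)) \<le> cmod (cis (N * y) - 1) * (G (y - a) + G (y - a - d))"
proof -
  \<comment> \<open>The chirp in \<open>z0\<close> makes a packet with parameters (p, q), located at
    \<open>p\<close> first, arrive at \<open>2 * \<tau> * q\<close>. Thus \<open>q = c\<close> leads
    to \<open>a\<close>, and \<open>q = c + N\<close> to \<open>a + d\<close>.\<close>
  define c where "c = a / (2 * \<tau>)"
  define z where "z = complex_of_real (1 / (4 * \<tau>))"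
  define z0 where "z0 = z + \<i> / (4 * of_real \<tau>)"
  define W where "W p q = Complex (p / (2 * \<tau>)) q" for p q
  \<comment> \<open>Normalises the modulus of the packet to the Gaussian \<open>G\<close> centred at
    \<open>p\<close>.\<close>
  define A where "A p = complex_of_real (exp (- (p\<^sup>2 / (4 * \<tau>))))" for p
  \<comment> \<open>Opposite signs at the frequencies \<open>c + N\<close> and \<open>c\<close>
    produce the factor \<open>cis (N * x) - 1\<close> at the first time.\<close>
  define f where "f x = A a * gauss z0 (W a (c + N)) x + A (a + d) * gauss z0 (W (a + d) (c + N)) x
    + (- A a * gauss z0 (W a c) x + - A (a + d) * gauss z0 (W (a + d) c) x)" for x
  have Rez: "0 < Re z" "0 < Re z0" using \<tau> by (auto simp: z0_def z_def)
  have f: "gaussian_sum f"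
    unfolding f_def[abs_def] using Rez(2) by (intro gaussian_sum_add gaussian_sum_gauss)
  have packet: "A p * gauss z (W p q) x = cis (q * x) * of_real (G (x - p))" for p q x
  proof -
    have "- of_real (p\<^sup>2 / (4 * \<tau>)) + (- z * (of_real x)\<^sup>2 + W p q * of_real x) = \<i> * of_real (q * x) + of_real (- ((x - p)\<^sup>2 / (4 * \<tau>)))"
      using \<tau> by (simp add: complex_eq_iff z_def W_def power2_eq_square field_simps)
    then show ?thesis
      unfolding A_def gauss_def G_def cis_conv_exp exp_of_real[symmetric] by (simp flip: exp_add)
  qed
  have chirp: "gauss z0 w x = cis (- (x\<^sup>2 / (4 * \<tau>))) * gauss z w x" for w x
  proof -
    have "- z0 * (of_real x)\<^sup>2 + w * of_real x = \<i> * of_real (- (x\<^sup>2 / (4 * \<tau>))) + (- z * (of_real x)\<^sup>2 + w * of_real x)"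
      using \<tau> by (simp add: z0_def field_simps)
    then show ?thesis unfolding gauss_def cis_conv_exp exp_add[symmetric] by (rule arg_cong)
  qed
  have packet0: "A p * gauss z0 (W p q) x = cis (- (x\<^sup>2 / (4 * \<tau>))) * (cis (q * x) * of_real (G (x - p)))" for p q x
    by (simp only: packet[symmetric] chirp mult.left_commute)
  have G0: "0 \<le> G x" for x by (simp add: G_def)
  have fx: "cmod (f x) = cmod (cis (N * x) - 1) * (G (x - a) + G (x - a - d))" for x
  proof -
    have "f x = cis (- (x\<^sup>2 / (4 * \<tau>))) * (cis (c * x) * ((cis (N * x) - 1) * of_real (G (x - a) + G (x - a - d))))"
      unfolding f_def mult_minus_left packet0
      by (simp add: algebra_simps cis_mult flip: cis_mult)
    then show ?thesis using G0[of "x - a"] G0[of "x - a - d"]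
      by (simp only: norm_mult norm_cis norm_of_real mult_1_left abs_of_nonneg add_nonneg_nonneg)
  qed
  have zz0: "z = z0 - \<i> / (4 * of_real \<tau>)" by (simp add: z0_def)
  obtain \<kappa> where \<kappa>: "(cmod \<kappa>)\<^sup>2 = 1 / (2 * \<tau>)"
    and ev: "\<And>w y. ft (\<lambda>\<xi>. cis (- (\<tau> * \<xi>\<^sup>2)) * ft (gauss z0 w) \<xi>) (- y) = \<kappa> * cis (y\<^sup>2 / (4 * \<tau>)) * ft (gauss z w) (y / (2 * \<tau>))"
    using gauss_evolution[OF Rez(2) \<tau> zz0] by blast
  have csz: "csqrt z = of_real (sqrt (1 / (4 * \<tau>)))" unfolding z_def using \<tau> by (intro csqrt_of_real) simp
  have evol: "ft (\<lambda>\<xi>. cis (- (\<tau> * \<xi>\<^sup>2)) * ft (\<lambda>x. b * gauss z0 w x) \<xi>) (- y) = b * (\<kappa> * cis (y\<^sup>2 / (4 * \<tau>)) * ft (gauss z w) (y / (2 * \<tau>)))" for b w y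
    by (simp only: ft_cmult mult.left_commute[of "cis _" b] ev)
  have ft_packet: "A p * ft (gauss z (W p q)) \<xi> = cis (- (p * (\<xi> - q))) * of_real (exp (- (\<tau> * (\<xi> - q)\<^sup>2))) * of_real (sqrt (2 * \<tau>))" for p q \<xi>
  proof -
    have "- of_real (p\<^sup>2 / (4 * \<tau>)) + (W p q - \<i> * \<xi>)\<^sup>2 / (4 * z) = \<i> * of_real (- (p * (\<xi> - q))) + of_real (- (\<tau> * (\<xi> - q)\<^sup>2))"
      using \<tau> by (simp add: complex_eq_iff z_def W_def power2_eq_square field_simps)
    then have "A p * exp ((W p q - \<i> * \<xi>)\<^sup>2 / (4 * z)) = cis (- (p * (\<xi> - q))) * of_real (exp (- (\<tau> * (\<xi> - q)\<^sup>2)))"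
      unfolding A_def cis_conv_exp exp_of_real[symmetric] by (simp flip: exp_add)
    moreover have "1 / (of_real (sqrt 2) * csqrt z) = complex_of_real (sqrt (2 * \<tau>))"
    proof -
      have "sqrt 2 * sqrt (1 / (4 * \<tau>)) * sqrt (2 * \<tau>) = 1"
        using \<tau> by (simp add: real_sqrt_mult[symmetric])
      moreover have "1 / r = s" if "r * s = 1" for r s :: real
      proof -
        have "r \<noteq> 0" using that by auto
        then have "s = (r * s) / r" by simp
        then show ?thesis using that by simp
      qed
      ultimately have "1 / (sqrt 2 * sqrt (1 / (4 * \<tau>))) = sqrt (2 * \<tau>)" by blast
      from arg_cong[OF this, of complex_of_real] show ?thesis
        unfolding csz by (simp only: of_real_divide of_real_mult of_real_1)
    qed
    moreover have "A p * ft (gauss z (W p q)) \<xi> = A p * exp ((W p q - \<i> * \<xi>)\<^sup>2 / (4 * z)) * (1 / (of_real (sqrt 2) * csqrt z))"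
      by (simp only: ft_gauss[OF Rez(1)] times_divide_eq_right mult_1_right)
    ultimately show ?thesis by (simp only:)
  qed
  \<comment> \<open>At the later time packets with equal \<open>q\<close> overlap, and these have
    equal signs. The shift \<open>pi\<close> in \<open>N * a\<close> turns their sum into a
    difference, and the term \<open>2 * pi * of_int k\<close> accommodates the second pair, whose
    phase differs by \<open>N * d\<close>.\<close>
  have pair: "cmod (cis (- (a * \<eta>)) + cis (- ((a + d) * \<eta>))) = cmod (cis (N * y) - 1)"
    if \<eta>: "d * \<eta> = N * (y - a) + 2 * pi * of_int k" for \<eta> y and k :: int
  proof -
    have "cis (- ((a + d) * \<eta>)) = cis (- (a * \<eta>)) * (cis (- (d * \<eta>)))" by (simp add: cis_mult algebra_simps)
    moreover have "cis (- (d * \<eta>)) = - cis (- (N * y))"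
    proof -
      have "- (d * \<eta>) = - (N * y) + (pi + 2 * pi * of_int (j - k))" using \<eta> Na by (simp add: algebra_simps)
      then have "cis (- (d * \<eta>)) = cis (- (N * y)) * (cis pi * cis (2 * pi * of_int (j - k)))" by (simp only: cis_mult)
      moreover have "cis (2 * pi * of_int (j - k)) = 1" by (rule cis_multiple_2pi) simp
      ultimately show ?thesis by simp
    qed
    ultimately have "cis (- (a * \<eta>)) + cis (- ((a + d) * \<eta>)) = cis (- (a * \<eta>)) * (cis 0 - cis (- (N * y)))"
      by (simp add: right_diff_distrib)
    then have "cmod (cis (- (a * \<eta>)) + cis (- ((a + d) * \<eta>))) = cmod (cis 0 - cis (- (N * y)))"
      by (simp only: norm_mult norm_cis mult_1_left)
    also have "\<dots> = cmod (cis (N * y) - 1)" using norm_cis_diff[of 0 "- (N * y)"] by simp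
    finally show ?thesis .
  qed
  have "cmod (ft (\<lambda>\<xi>. cis (- (\<tau> * \<xi>\<^sup>2)) * ft f \<xi>) (- y)) \<le> cmod (cis (N * y) - 1) * (G (y - a) + G (y - a - d))" for y
  proof -
    let ?\<xi> = "y / (2 * \<tau>)"
    let ?P = "\<lambda>b w x. b * gauss z0 w x"
    let ?E = "\<lambda>g. ft (\<lambda>\<xi>. cis (- (\<tau> * \<xi>\<^sup>2)) * ft g \<xi>) (- y)"
    have add: "?E (\<lambda>x. g x + h x) = ?E g + ?E h" if "gaussian_sum g" "gaussian_sum h" for g h
    proof -
      have "cis (- (\<tau> * \<xi>\<^sup>2)) * ft (\<lambda>x. g x + h x) \<xi> = cis (- (\<tau> * \<xi>\<^sup>2)) * ft g \<xi> + cis (- (\<tau> * \<xi>\<^sup>2)) * ft h \<xi>" for \<xi>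
        using that by (simp add: ft_add integrable_gaussian_sum distrib_left)
      then show ?thesis using that by (simp add: ft_add integrable_multiplier integrable_gaussian_sum gaussian_sum_ft)
    qed
    have gs: "gaussian_sum (\<lambda>x. b * gauss z0 w x)" for b w using Rez(2) by (rule gaussian_sum_gauss)
    let ?D = "\<lambda>p q. A p * ft (gauss z (W p q)) ?\<xi>"
    have "?E f = \<kappa> * cis (y\<^sup>2 / (4 * \<tau>)) * (?D a (c + N) + ?D (a + d) (c + N) - (?D a c + ?D (a + d) c))"
      unfolding f_def[abs_def] add[OF gaussian_sum_add[OF gs gs] gaussian_sum_add[OF gs gs]] add[OF gs gs] evol
      by (simp add: algebra_simps)
    then have Ef: "cmod (?E f) = cmod \<kappa> * cmod (?D a (c + N) + ?D (a + d) (c + N) - (?D a c + ?D (a + d) c))"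
      by (simp add: norm_mult)
    have D: "cmod (?D a q + ?D (a + d) q) = cmod (cis (N * y) - 1) * exp (- (\<tau> * (?\<xi> - q)\<^sup>2)) * sqrt (2 * \<tau>)"
      if "d * (?\<xi> - q) = N * (y - a) + 2 * pi * of_int k" for q and k :: int
    proof -
      have "?D a q + ?D (a + d) q = (cis (- (a * (?\<xi> - q))) + cis (- ((a + d) * (?\<xi> - q)))) * of_real (exp (- (\<tau> * (?\<xi> - q)\<^sup>2))) * of_real (sqrt (2 * \<tau>))"
        unfolding ft_packet by (simp only: distrib_right)
      then show ?thesis using pair[OF that] \<tau> by (simp only: norm_mult norm_of_real) simp
    qed
    have e1: "d * (?\<xi> - c) = N * (y - a) + 2 * pi * of_int 0" using \<tau> by (simp add: c_def d field_simps)
    have e2: "d * (?\<xi> - (c + N)) = N * (y - a) + 2 * pi * of_int (- l)"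
      using e1 Nd by (simp add: algebra_simps)
    have g1: "\<tau> * (?\<xi> - c)\<^sup>2 = (y - a)\<^sup>2 / (4 * \<tau>)"
    proof -
      have "?\<xi> - c = (y - a) / (2 * \<tau>)" using \<tau> by (simp add: c_def diff_divide_distrib)
      then show ?thesis using \<tau> by (simp add: power2_eq_square)
    qed
    have g2: "\<tau> * (?\<xi> - (c + N))\<^sup>2 = (y - a - d)\<^sup>2 / (4 * \<tau>)"
    proof -
      have "?\<xi> - (c + N) = (y - a - d) / (2 * \<tau>)" using \<tau> by (simp add: c_def d field_simps)
      then show ?thesis using \<tau> by (simp add: power2_eq_square)
    qed
    \<comment> \<open>The two pairs carry different phases, hence an inequality here in place of the
      equality in \<open>fx\<close>.\<close>
    have "cmod (?E f) \<le> cmod \<kappa> * (cmod (?D a (c + N) + ?D (a + d) (c + N)) + cmod (?D a c + ?D (a + d) c))"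
      unfolding Ef by (intro mult_left_mono norm_triangle_ineq4) simp
    also have "\<dots> = cmod \<kappa> * (cmod (cis (N * y) - 1) * G (y - a - d) * sqrt (2 * \<tau>) + cmod (cis (N * y) - 1) * G (y - a) * sqrt (2 * \<tau>))"
      unfolding D[OF e1] D[OF e2] g1 g2 G_def ..
    also have "\<dots> = (cmod \<kappa> * sqrt (2 * \<tau>)) * (cmod (cis (N * y) - 1) * (G (y - a) + G (y - a - d)))"
      by (simp add: algebra_simps)
    also have "cmod \<kappa> * sqrt (2 * \<tau>) = 1"
      by (rule power2_eq_imp_eq) (use \<kappa> \<tau> in \<open>auto simp: power_mult_distrib\<close>)
    finally show ?thesis by simp
  qed
  then show ?thesis using that[OF f fx] by blast
qed

section \<open>Thick sets without observability\<close>

text \<open>The mass distribution principle, with Lebesgue measure on \<open>A\<close> as the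
  mass.\<close>

lemma hausdorff_content_ge:
  assumes [measurable]: "A \<in> sets borel" and AE: "A \<subseteq> E" and K: "0 < K"
    and mass: "\<And>c r. 0 \<le> r \<Longrightarrow> emeasure lborel (A \<inter> ball c r) \<le> ennreal (K * r powr \<alpha>)"
    and p: "ennreal p \<le> emeasure lborel A" "0 \<le> p"
  shows "ennreal (p / K) \<le> hausdorff_content \<alpha> E"
  unfolding hausdorff_content_def
proof (rule INF_greatest, clarify)
  fix c r :: "nat \<Rightarrow> real" assume r: "\<forall>j. 0 \<le> r j" and cov: "E \<subseteq> (\<Union>j. ball (c j) (r j))"
  have "ennreal p \<le> emeasure lborel (\<Union>j. A \<inter> ball (c j) (r j))"
  proof -
    have "A = (\<Union>j. A \<inter> ball (c j) (r j))" using AE cov by blast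
    then show ?thesis using p(1) by simp
  qed
  also have "\<dots> \<le> (\<Sum>j. emeasure lborel (A \<inter> ball (c j) (r j)))"
    by (intro emeasure_subadditive_countably) auto
  also have "\<dots> \<le> (\<Sum>j. ennreal K * ennreal (r j powr \<alpha>))"
    using mass r K by (intro suminf_le) (auto simp flip: ennreal_mult)
  also have "\<dots> = ennreal K * (\<Sum>j. ennreal (r j powr \<alpha>))" by simp
  finally have "ennreal (1 / K) * ennreal p \<le> ennreal (1 / K) * (ennreal K * (\<Sum>j. ennreal (r j powr \<alpha>)))"
    by (intro mult_left_mono) auto
  also have "\<dots> = (\<Sum>j. ennreal (r j powr \<alpha>))"
    using K by (simp flip: ennreal_mult mult.assoc)
  also have "ennreal (1 / K) * ennreal p = ennreal (p / K)"
    using K p(2) by (simp flip: ennreal_mult)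
  finally show "ennreal (p / K) \<le> (\<Sum>j. ennreal (r j powr \<alpha>))" .
qed

lemma hausdorff_content_mono: "A \<subseteq> B \<Longrightarrow> hausdorff_content \<alpha> A \<le> hausdorff_content \<alpha> B"
  unfolding hausdorff_content_def by (intro INF_superset_mono) auto

text \<open>The exponent is chosen such that the \<open>\<alpha>\<close>-content of the intervals of this length around the points of
  \<open>(\<sigma>/n) \<int>\<close> in a unit cell stays bounded below as \<open>n\<close> grows, while the length is \<open>o(1/n)\<close>.\<close>

definition tooth :: "real \<Rightarrow> nat \<Rightarrow> real" where
  "tooth \<alpha> n = real n powr (- (1 / \<alpha>))"

definition comb :: "real \<Rightarrow> real \<Rightarrow> nat \<Rightarrow> real set" where
  "comb \<sigma> \<alpha> n = (\<Union>j::int. {of_int j * \<sigma> / real n .. of_int j * \<sigma> / real n + tooth \<alpha> n})"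

lemma card_int_between_le:
  fixes lo hi :: real
  assumes "lo \<le> hi + 1"
  shows "finite {j::int. lo \<le> of_int j \<and> of_int j \<le> hi}"
    "real (card {j::int. lo \<le> of_int j \<and> of_int j \<le> hi}) \<le> hi - lo + 1"
    "hi - lo - 1 \<le> real (card {j::int. lo \<le> of_int j \<and> of_int j \<le> hi})"
proof -
  have eq: "{j::int. lo \<le> of_int j \<and> of_int j \<le> hi} = {\<lceil>lo\<rceil>..\<lfloor>hi\<rfloor>}"
    by (auto simp: ceiling_le_iff le_floor_iff)
  show "finite {j::int. lo \<le> of_int j \<and> of_int j \<le> hi}" by (simp add: eq)
  show "real (card {j::int. lo \<le> of_int j \<and> of_int j \<le> hi}) \<le> hi - lo + 1"
    "hi - lo - 1 \<le> real (card {j::int. lo \<le> of_int j \<and> of_int j \<le> hi})"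
    unfolding eq using assms by (simp_all, linarith+)
qed

text \<open>Mass distribution on the teeth that start in the lower half of the cell: their total
  length and the constant in the ball estimate both scale like \<eta>^(1 - \<alpha>), so
  \<open>n\<close> cancels from the bound.\<close>

lemma comb_cell_content:
  fixes k :: int
  assumes \<alpha>: "0 < \<alpha>" "\<alpha> < 1" and \<sigma>: "0 < \<sigma>" and n: "0 < n" "8 * \<sigma> \<le> real n"
    and t: "tooth \<alpha> n < 1 / 2" "real n * tooth \<alpha> n < \<sigma>"
  shows "ennreal (1 / (4 * \<sigma> * (2 / \<sigma> + 6))) \<le> hausdorff_content \<alpha> (comb \<sigma> \<alpha> n \<inter> {of_int k ..< of_int k + 1})"
proof -
  define \<eta> where "\<eta> = tooth \<alpha> n"
  have \<eta>: "0 < \<eta>" "\<eta> < 1 / 2" using n t by (auto simp: \<eta>_def tooth_def)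
  have n\<eta>: "real n = \<eta> powr (- \<alpha>)"
    using n \<alpha> by (simp add: \<eta>_def tooth_def powr_powr)
  have n\<eta>1: "real n * \<eta> = \<eta> powr (1 - \<alpha>)"
    unfolding n\<eta> using \<eta> by (simp add: powr_diff powr_minus field_simps)
  define I where "I j = {of_int j * \<sigma> / real n .. of_int j * \<sigma> / real n + \<eta>}" for j :: int
  \<comment> \<open>Left ends lie in the first half of the cell, so that teeth shorter than 1/2 stay
    inside it.\<close>
  define lo hi where "lo = of_int k * real n / \<sigma>" and "hi = (of_int k + 1 / 2) * real n / \<sigma>"
  define J where "J = {j::int. lo \<le> of_int j \<and> of_int j \<le> hi}"
  define A where "A = (\<Union>j\<in>J. I j)"
  have hl: "hi - lo = real n / (2 * \<sigma>)" using \<sigma> by (simp add: hi_def lo_def field_simps)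
  have "0 < real n / (2 * \<sigma>)" using n \<sigma> by simp
  then have lohi: "lo \<le> hi + 1" using hl by linarith
  have J: "finite J" "real n / (4 * \<sigma>) \<le> real (card J)"
  proof -
    show "finite J" unfolding J_def by (rule card_int_between_le(1)[OF lohi])
    have "1 \<le> real n / (4 * \<sigma>)" using n \<sigma> by simp
    moreover have "real n / (2 * \<sigma>) = 2 * (real n / (4 * \<sigma>))" by simp
    ultimately show "real n / (4 * \<sigma>) \<le> real (card J)"
      using card_int_between_le(3)[OF lohi] hl unfolding J_def by linarith
  qed
  have [measurable]: "A \<in> sets borel" unfolding A_def I_def using J(1) by auto
  have sub: "A \<subseteq> comb \<sigma> \<alpha> n \<inter> {of_int k ..< of_int k + 1}"
  proof
    fix x assume "x \<in> A"
    then obtain j where j: "j \<in> J" "x \<in> I j" by (auto simp: A_def)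
    have "of_int k \<le> of_int j * \<sigma> / real n" "of_int j * \<sigma> / real n \<le> of_int k + 1 / 2"
      using j(1) n \<sigma> by (auto simp: J_def lo_def hi_def field_simps)
    then show "x \<in> comb \<sigma> \<alpha> n \<inter> {of_int k ..< of_int k + 1}"
      using j(2) \<eta> by (auto simp: I_def comb_def \<eta>_def)
  qed
  have measA: "ennreal (real n / (4 * \<sigma>) * \<eta>) \<le> emeasure lborel A"
  proof -
    have disj: "disjoint_family_on I J"
      unfolding disjoint_family_on_def
    proof (intro ballI impI)
      fix i j :: int assume "i \<noteq> j"
      have "I i \<inter> I j = {}" if "i < j" for i j :: int
      proof -
        have "of_int i + 1 \<le> (of_int j :: real)" using that by linarith
        then have "(of_int i + 1) * \<sigma> / real n \<le> of_int j * \<sigma> / real n"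
          using n \<sigma> by (intro divide_right_mono mult_right_mono) auto
        moreover have "\<eta> < \<sigma> / real n" using t(2) n by (simp add: \<eta>_def field_simps)
        ultimately show ?thesis by (auto simp: I_def distrib_right add_divide_distrib)
      qed
      then show "I i \<inter> I j = {}" using \<open>i \<noteq> j\<close> by (metis inf_commute linorder_neqE)
    qed
    have "emeasure lborel A = (\<Sum>j\<in>J. emeasure lborel (I j))"
      unfolding A_def by (intro sum_emeasure[symmetric] disj J(1)) (auto simp: I_def)
    also have "\<dots> = ennreal (real (card J) * \<eta>)"
      using \<eta> by (simp add: I_def ennreal_mult ennreal_of_nat_eq_real_of_nat)
    moreover have "real n / (4 * \<sigma>) * \<eta> \<le> real (card J) * \<eta>"
      using J(2) \<eta> by (intro mult_right_mono) auto
    ultimately show ?thesis by (simp only: ennreal_leI)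
  qed
  \<comment> \<open>A ball of radius \<open>r\<close> meets at most
    \<open>(2 * r + \<eta>) * n / \<sigma> + 1\<close> teeth, each in measure at most
    \<open>min \<eta> (2 * r)\<close>. The term proportional to \<open>r\<close> is bounded through
    r \<le> r^\<alpha>, the remaining single teeth through m = m^(1 - \<alpha>) m^\<alpha>.\<close>
  have small: "emeasure lborel (A \<inter> ball c r) \<le> ennreal ((2 / \<sigma> + 6) * \<eta> powr (1 - \<alpha>) * r powr \<alpha>)" if r: "0 \<le> r" "r \<le> 1" for c r
  proof (cases "r = 0")
    case False
    then have r0: "0 < r" using r by simp
    define lo' hi' where "lo' = (c - r - \<eta>) * real n / \<sigma>" and "hi' = (c + r) * real n / \<sigma>"
    define J' where "J' = {j::int. lo' \<le> of_int j \<and> of_int j \<le> hi'}"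
    have hl': "hi' - lo' = (2 * r + \<eta>) * real n / \<sigma>" unfolding hi'_def lo'_def diff_divide_distrib[symmetric] left_diff_distrib[symmetric] by simp
    have "0 \<le> (2 * r + \<eta>) * real n / \<sigma>" using r0 \<eta> \<sigma> by simp
    then have lohi': "lo' \<le> hi' + 1" using hl' by linarith
    have J': "finite J'" "real (card J') \<le> (2 * r + \<eta>) * real n / \<sigma> + 1"
      using card_int_between_le(1,2)[OF lohi'] hl' unfolding J'_def by auto
    have "A \<inter> ball c r \<subseteq> (\<Union>j\<in>J'. I j \<inter> ball c r)"
    proof
      fix x assume x: "x \<in> A \<inter> ball c r"
      then obtain j where j: "x \<in> I j" by (auto simp: A_def)
      have "c - r < x" "x < c + r" using x by (auto simp: dist_real_def)
      then have "c - r - \<eta> \<le> of_int j * \<sigma> / real n" "of_int j * \<sigma> / real n \<le> c + r" using j by (auto simp: I_def)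
      then have "j \<in> J'" using n \<sigma> by (auto simp: J'_def lo'_def hi'_def field_simps)
      then show "x \<in> (\<Union>j\<in>J'. I j \<inter> ball c r)" using j x by auto
    qed
    then have "emeasure lborel (A \<inter> ball c r) \<le> emeasure lborel (\<Union>j\<in>J'. I j \<inter> ball c r)"
      using J' by (intro emeasure_mono) (auto simp: I_def)
    also have "\<dots> \<le> (\<Sum>j\<in>J'. emeasure lborel (I j \<inter> ball c r))"
      using J' by (intro emeasure_subadditive_finite) (auto simp: I_def)
    also have "\<dots> \<le> (\<Sum>j\<in>J'. ennreal (min \<eta> (2 * r)))"
    proof (intro sum_mono)
      fix j
      have "emeasure lborel (I j \<inter> ball c r) \<le> emeasure lborel (I j)" by (intro emeasure_mono) (auto simp: I_def)
      moreover have "emeasure lborel (I j \<inter> ball c r) \<le> emeasure lborel (ball c r)" by (intro emeasure_mono) auto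
      ultimately show "emeasure lborel (I j \<inter> ball c r) \<le> ennreal (min \<eta> (2 * r))"
        using \<eta> r0 by (auto simp: I_def min_def ball_eq_greaterThanLessThan)
    qed
    also have "\<dots> = ennreal (real (card J') * min \<eta> (2 * r))"
      using \<eta> r0 by (simp add: ennreal_mult ennreal_of_nat_eq_real_of_nat)
    also have "\<dots> \<le> ennreal ((2 / \<sigma> + 6) * \<eta> powr (1 - \<alpha>) * r powr \<alpha>)"
    proof (rule ennreal_leI)
      define m where "m = min \<eta> (2 * r)"
      have m: "0 < m" "m \<le> \<eta>" "m \<le> 2 * r" using \<eta> r0 by (auto simp: m_def)
      have rr: "r \<le> r powr \<alpha>" using powr_mono'[of \<alpha> 1 r] r0 r \<alpha> by simp
      have "m = m powr (1 - \<alpha>) * m powr \<alpha>" using m by (simp flip: powr_add)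
      also have "\<dots> \<le> \<eta> powr (1 - \<alpha>) * (2 * r) powr \<alpha>"
        using m \<alpha> by (intro mult_mono powr_mono2) auto
      also have "(2 * r) powr \<alpha> \<le> 2 * r powr \<alpha>"
        using powr_mono[of \<alpha> 1 2] \<alpha> r0 by (simp add: powr_mult mult_right_mono)
      finally have m1: "m \<le> \<eta> powr (1 - \<alpha>) * (2 * r powr \<alpha>)" by (simp add: mult_left_mono)
      have "real (card J') * m \<le> ((2 * r + \<eta>) * real n / \<sigma> + 1) * m"
        using J'(2) m by (intro mult_right_mono) auto
      also have "\<dots> = 2 * r / \<sigma> * (real n * m) + (real n * \<eta> / \<sigma> + 1) * m" using \<sigma> by (simp add: field_simps)
      also have "\<dots> \<le> 2 * r / \<sigma> * (real n * \<eta>) + (1 + 1) * m"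
        using t(2) m \<sigma> r0 n by (intro add_mono mult_left_mono mult_right_mono) (auto simp: \<eta>_def)
      also have "\<dots> \<le> 2 / \<sigma> * \<eta> powr (1 - \<alpha>) * r powr \<alpha> + 2 * (\<eta> powr (1 - \<alpha>) * (2 * r powr \<alpha>))"
      proof (rule add_mono)
        have "2 * r / \<sigma> * (real n * \<eta>) = 2 / \<sigma> * \<eta> powr (1 - \<alpha>) * r" by (simp add: n\<eta>1)
        also have "\<dots> \<le> 2 / \<sigma> * \<eta> powr (1 - \<alpha>) * r powr \<alpha>" using rr \<sigma> by (intro mult_left_mono) auto
        finally show "2 * r / \<sigma> * (real n * \<eta>) \<le> 2 / \<sigma> * \<eta> powr (1 - \<alpha>) * r powr \<alpha>" .
      qed (use m1 in \<open>simp add: mult_ac\<close>)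
      also have "\<dots> \<le> (2 / \<sigma> + 6) * \<eta> powr (1 - \<alpha>) * r powr \<alpha>" by (simp add: distrib_right)
      finally show "real (card J') * min \<eta> (2 * r) \<le> (2 / \<sigma> + 6) * \<eta> powr (1 - \<alpha>) * r powr \<alpha>" unfolding m_def .
    qed
    finally show ?thesis .
  qed simp
  have mass: "emeasure lborel (A \<inter> ball c r) \<le> ennreal ((2 / \<sigma> + 6) * \<eta> powr (1 - \<alpha>) * r powr \<alpha>)" if r: "0 \<le> r" for c r
  \<comment> \<open>For larger radii the bound at radius 1 suffices, since \<open>A\<close> lies in
    one ball of radius 1.\<close>
  proof (cases "r \<le> 1")
    case False
    have "A \<subseteq> ball (of_int k + 1 / 2) 1" using sub by (force simp: dist_real_def)
    then have "emeasure lborel (A \<inter> ball c r) \<le> emeasure lborel (A \<inter> ball (of_int k + 1 / 2) 1)"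
      by (intro emeasure_mono) auto
    also have "\<dots> \<le> ennreal ((2 / \<sigma> + 6) * \<eta> powr (1 - \<alpha>) * 1 powr \<alpha>)" by (rule small) auto
    also have "\<dots> \<le> ennreal ((2 / \<sigma> + 6) * \<eta> powr (1 - \<alpha>) * r powr \<alpha>)"
      using False \<alpha> \<sigma> by (intro ennreal_leI mult_left_mono powr_mono2) auto
    finally show ?thesis .
  qed (use small r in auto)
  have "ennreal (real n / (4 * \<sigma>) * \<eta> / ((2 / \<sigma> + 6) * \<eta> powr (1 - \<alpha>))) \<le> hausdorff_content \<alpha> (comb \<sigma> \<alpha> n \<inter> {of_int k ..< of_int k + 1})"
    using \<eta> \<sigma> by (intro hausdorff_content_ge[OF _ sub _ mass measA]) (auto simp: add_pos_pos)
  moreover have "real n / (4 * \<sigma>) * \<eta> / ((2 / \<sigma> + 6) * \<eta> powr (1 - \<alpha>)) = 1 / (4 * \<sigma> * (2 / \<sigma> + 6))"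
  proof -
    have "real n / (4 * \<sigma>) * \<eta> = \<eta> powr (1 - \<alpha>) / (4 * \<sigma>)" using n\<eta>1 by simp
    moreover have "\<eta> powr (1 - \<alpha>) \<noteq> 0" using \<eta> by simp
    ultimately show ?thesis by (simp only:) simp
  qed
  ultimately show ?thesis by simp
qed

text \<open>The order varies with the cell because one set has to defeat every constant, hence carry
  combs of arbitrarily high order, while every cell keeps its content.\<close>

definition layered_comb :: "real \<Rightarrow> real \<Rightarrow> (int \<Rightarrow> nat) \<Rightarrow> real set" where
  "layered_comb \<sigma> \<alpha> m = {x. x \<in> comb \<sigma> \<alpha> (m \<lfloor>x\<rfloor>)}"

lemma thick_layered_comb:
  assumes \<alpha>: "0 < \<alpha>" "\<alpha> < 1" and \<sigma>: "0 < \<sigma>"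
    and m: "\<And>k. 0 < m k" "\<And>k. 8 * \<sigma> \<le> real (m k)" "\<And>k. tooth \<alpha> (m k) < 1 / 2" "\<And>k. real (m k) * tooth \<alpha> (m k) < \<sigma>"
  shows "thick \<alpha> (layered_comb \<sigma> \<alpha> m)"
proof -
  define \<gamma> where "\<gamma> = 1 / (4 * \<sigma> * (2 / \<sigma> + 6))"
  have \<gamma>: "0 < \<gamma>" using \<sigma> by (simp add: \<gamma>_def add_pos_pos)
  \<comment> \<open>\<open>L = 2\<close>, since every closed interval of length 2 contains a full
    cell; the factor 1/4 makes the inequality strict.\<close>
  have "ennreal (\<gamma> / 4 * 2) < hausdorff_content \<alpha> (layered_comb \<sigma> \<alpha> m \<inter> {x..x + 2})" for x
  proof -
    define k where "k = \<lceil>x\<rceil>"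
    have "comb \<sigma> \<alpha> (m k) \<inter> {of_int k ..< of_int k + 1} \<subseteq> layered_comb \<sigma> \<alpha> m \<inter> {x..x + 2}"
    proof
      fix y assume y: "y \<in> comb \<sigma> \<alpha> (m k) \<inter> {of_int k ..< of_int k + 1}"
      then have "\<lfloor>y\<rfloor> = k" by (auto intro: floor_unique)
      moreover have "x \<le> of_int k" "of_int k < x + 1" unfolding k_def by linarith+
      ultimately show "y \<in> layered_comb \<sigma> \<alpha> m \<inter> {x..x + 2}" using y by (auto simp: layered_comb_def)
    qed
    from hausdorff_content_mono[OF this, of \<alpha>]
    have "ennreal \<gamma> \<le> hausdorff_content \<alpha> (layered_comb \<sigma> \<alpha> m \<inter> {x..x + 2})"
      using comb_cell_content[OF \<alpha> \<sigma> m, of k k] unfolding \<gamma>_def by order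
    moreover have "ennreal (\<gamma> / 4 * 2) < ennreal \<gamma>" using \<gamma> by (simp add: ennreal_less_iff)
    ultimately show ?thesis by order
  qed
  moreover have "0 < \<gamma> / 4" using \<gamma> by simp
  ultimately show ?thesis unfolding thick_def by (metis zero_less_numeral)
qed

text \<open>A Gaussian at \<open>x\<close> is at most a multiple of a wider Gaussian at any
  \<open>y\<close> within distance 1. So the squared supremum over a cell is bounded by an integral
  over that cell, and the sum over cells by an integral over the line.\<close>

lemma local_sup_gaussian_le:
  fixes \<tau> B p q :: real
  assumes \<tau>: "0 < \<tau>" and B: "0 \<le> B"
    and le: "\<And>x. x \<in> E \<Longrightarrow> (cmod (f x))\<^sup>2 \<le> B * (exp (- ((x - p)\<^sup>2 / (4 * \<tau>))) + exp (- ((x - q)\<^sup>2 / (4 * \<tau>))))"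
  shows "l2_norm_sq (local_sup E f) \<le> ennreal (B * (2 * exp (1 / (4 * \<tau>)) * sqrt (8 * pi * \<tau>)))"
proof -
  define P where "P s y = exp (1 / (4 * \<tau>)) * exp (- (1 / (8 * \<tau>)) * (y - s)\<^sup>2)" for s y :: real
  have P0: "0 \<le> P s y" for s y by (simp add: P_def)
  have shift: "exp (- ((x - s)\<^sup>2 / (4 * \<tau>))) \<le> P s y" if "\<bar>x - y\<bar> \<le> 1" for x y s
  proof -
    have "(y - s)\<^sup>2 \<le> 2 * (x - s)\<^sup>2 + 2 * (x - y)\<^sup>2"
      using zero_le_power2[of "(x - s) + (x - y)"] by (simp add: power2_eq_square algebra_simps)
    also have "(x - y)\<^sup>2 \<le> 1" using that by (simp add: abs_square_le_1)
    finally have "- (x - s)\<^sup>2 \<le> 1 - (y - s)\<^sup>2 / 2" by simp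
    from divide_right_mono[OF this, of "4 * \<tau>"] have "- ((x - s)\<^sup>2 / (4 * \<tau>)) \<le> 1 / (4 * \<tau>) + - (1 / (8 * \<tau>)) * (y - s)\<^sup>2"
      using \<tau> by (simp add: diff_divide_distrib)
    then show ?thesis unfolding P_def exp_add[symmetric] by simp
  qed
  have intP: "(\<integral>\<^sup>+ y. ennreal (P s y) \<partial>lborel) = ennreal (exp (1 / (4 * \<tau>)) * sqrt (8 * pi * \<tau>))" for s
  proof -
    have "has_bochner_integral lborel (\<lambda>y. exp (1 / (4 * \<tau>)) * exp (- (1 / (8 * \<tau>)) * y\<^sup>2)) (exp (1 / (4 * \<tau>)) * sqrt (pi / (1 / (8 * \<tau>))))"
      using \<tau> by (intro has_bochner_integral_mult_right has_bochner_integral_gaussian) simp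
    then have "(\<integral>\<^sup>+ y. ennreal (exp (1 / (4 * \<tau>)) * exp (- (1 / (8 * \<tau>)) * y\<^sup>2)) \<partial>lborel) = ennreal (exp (1 / (4 * \<tau>)) * sqrt (pi / (1 / (8 * \<tau>))))"
      by (subst nn_integral_eq_integral) (auto simp: has_bochner_integral_iff)
    then show ?thesis unfolding P_def
      using nn_integral_lborel_shift[of "\<lambda>y. ennreal (exp (1 / (4 * \<tau>)) * exp (- (1 / (8 * \<tau>)) * y\<^sup>2))" s] by (simp add: mult_ac)
  qed
  have [measurable]: "P s \<in> borel_measurable borel" for s unfolding P_def[abs_def] by measurable
  let ?c = "\<lambda>k::int. {of_int k ..< of_int k + 1 :: real}"
  have sup_le: "(local_sup E f k)\<^sup>2 \<le> ennreal (B * (P p y + P q y))" if y: "y \<in> ?c k" for k y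
  proof -
    have "local_sup E f k \<le> ennreal (sqrt (B * (P p y + P q y)))"
      unfolding local_sup_def
    proof (rule SUP_least)
      fix x assume x: "x \<in> E \<inter> {of_int k .. of_int k + 1}"
      have "\<bar>x - y\<bar> \<le> 1" using x y by auto
      then have "(cmod (f x))\<^sup>2 \<le> B * (P p y + P q y)"
        using x by (intro order_trans[OF le mult_left_mono[OF add_mono[OF shift shift] B]]) auto
      then show "ennreal (cmod (f x)) \<le> ennreal (sqrt (B * (P p y + P q y)))"
        by (intro ennreal_leI real_le_rsqrt)
    qed
    then have "(local_sup E f k)\<^sup>2 \<le> (ennreal (sqrt (B * (P p y + P q y))))\<^sup>2" by (intro power_mono) auto
    also have "\<dots> = ennreal (B * (P p y + P q y))" using B P0 by (simp add: ennreal_power)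
    finally show ?thesis .
  qed
  have fin: "(\<Sum>k\<in>K. (local_sup E f k)\<^sup>2) \<le> ennreal (B * (2 * exp (1 / (4 * \<tau>)) * sqrt (8 * pi * \<tau>)))" if "finite K" for K
  proof -
    have "(\<Sum>k\<in>K. (local_sup E f k)\<^sup>2) = (\<Sum>k\<in>K. \<integral>\<^sup>+ y. (local_sup E f k)\<^sup>2 * indicator (?c k) y \<partial>lborel)"
      by (intro sum.cong refl) (simp add: nn_integral_cmult_indicator)
    also have "\<dots> = (\<integral>\<^sup>+ y. (\<Sum>k\<in>K. (local_sup E f k)\<^sup>2 * indicator (?c k) y) \<partial>lborel)"
      by (rule nn_integral_sum[symmetric]) auto
    also have "\<dots> \<le> (\<integral>\<^sup>+ y. ennreal (B * (P p y + P q y)) \<partial>lborel)"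
    proof (rule nn_integral_mono)
      fix y
      have "(\<Sum>k\<in>K. (local_sup E f k)\<^sup>2 * indicator (?c k) y) \<le> (\<Sum>k\<in>K. if k = \<lfloor>y\<rfloor> then ennreal (B * (P p y + P q y)) else 0)"
      proof (intro sum_mono)
        fix k
        show "(local_sup E f k)\<^sup>2 * indicator (?c k) y \<le> (if k = \<lfloor>y\<rfloor> then ennreal (B * (P p y + P q y)) else 0)"
        proof (cases "y \<in> ?c k")
          case True
          then have "\<lfloor>y\<rfloor> = k" by (auto intro: floor_unique)
          then show ?thesis using sup_le[OF True] True by simp
        qed simp
      qed
      also have "\<dots> \<le> ennreal (B * (P p y + P q y))" using that by (simp add: sum.delta)
      finally show "(\<Sum>k\<in>K. (local_sup E f k)\<^sup>2 * indicator (?c k) y) \<le> ennreal (B * (P p y + P q y))" .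
    qed
    also have "\<dots> = ennreal B * ((\<integral>\<^sup>+ y. ennreal (P p y) \<partial>lborel) + (\<integral>\<^sup>+ y. ennreal (P q y) \<partial>lborel))"
      using B P0 by (simp add: ennreal_mult ennreal_plus nn_integral_cmult nn_integral_add)
    also have "\<dots> = ennreal (B * (2 * exp (1 / (4 * \<tau>)) * sqrt (8 * pi * \<tau>)))"
    proof -
      have "0 \<le> exp (1 / (4 * \<tau>)) * sqrt (8 * pi * \<tau>)" using \<tau> by simp
      then show ?thesis unfolding intP using B by (simp add: mult.assoc flip: ennreal_mult ennreal_plus)
    qed
    finally show ?thesis .
  qed
  show ?thesis
    unfolding l2_norm_sq_def by (rule infsum_le_finite_sums) (auto intro: fin nonneg_summable_on_complete)
qed

text \<open>On \<open>{a..a + 1}\<close> the Gaussian is bounded below, and |cis(N x) - 1|^2 = 2 - 2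
  cos(N x) has integral at least \<open>2 - 4 / N\<close>, hence at least 1.\<close>

lemma sqnorm_interfering_ge:
  fixes N a \<tau> :: real
  assumes \<tau>: "0 < \<tau>" and N: "4 \<le> N" and f: "gaussian_sum f"
    and ge: "\<And>x. cmod (cis (N * x) - 1) * exp (- ((x - a)\<^sup>2 / (4 * \<tau>))) \<le> cmod (f x)"
  shows "ennreal (exp (- (1 / (2 * \<tau>)))) \<le> sqnorm f"
proof -
  have sq: "(cmod (cis t - 1))\<^sup>2 = 2 - 2 * cos t" for t
    unfolding cmod_power2 using sin_cos_squared_add[of t] by (simp add: power2_eq_square algebra_simps)
  let ?e = "exp (- (1 / (2 * \<tau>)))"
  have "(\<integral>\<^sup>+ x. ennreal (2 - 2 * cos (N * x)) * indicator {a..a + 1} x \<partial>lborel)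
      = ennreal ((2 * (a + 1) - 2 * sin (N * (a + 1)) / N) - (2 * a - 2 * sin (N * a) / N))"
  proof (rule nn_integral_FTC_Icc)
    show "((\<lambda>x. 2 * x - 2 * sin (N * x) / N) has_real_derivative 2 - 2 * cos (N * x)) (at x)" for x
      using N by (auto intro!: derivative_eq_intros)
  qed (use cos_le_one in auto)
  moreover have "1 \<le> (2 * (a + 1) - 2 * sin (N * (a + 1)) / N) - (2 * a - 2 * sin (N * a) / N)"
  proof -
    have "2 * sin (N * (a + 1)) / N \<le> 2 * 1 / N" "2 * (- 1) / N \<le> 2 * sin (N * a) / N"
      using N by (intro divide_right_mono mult_left_mono; simp)+
    moreover have "2 * 1 / N \<le> 1 / 2" "- (1 / 2) \<le> 2 * (- 1) / N" using N by (auto simp: field_simps)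
    ultimately show ?thesis by (simp only: distrib_left)
  qed
  ultimately have "ennreal 1 \<le> (\<integral>\<^sup>+ x. ennreal (2 - 2 * cos (N * x)) * indicator {a..a + 1} x \<partial>lborel)"
    by (simp only: ennreal_leI)
  then have "ennreal ?e * ennreal 1 \<le> ennreal ?e * (\<integral>\<^sup>+ x. ennreal (2 - 2 * cos (N * x)) * indicator {a..a + 1} x \<partial>lborel)"
    by (intro mult_left_mono) auto
  also have "\<dots> = (\<integral>\<^sup>+ x. ennreal ?e * (ennreal (2 - 2 * cos (N * x)) * indicator {a..a + 1} x) \<partial>lborel)"
    by (rule nn_integral_cmult[symmetric]) measurable
  also have "\<dots> \<le> sqnorm f"
    unfolding sqnorm_def
  proof (rule nn_integral_mono)
    fix x
    show "ennreal ?e * (ennreal (2 - 2 * cos (N * x)) * indicator {a..a + 1} x) \<le> ennreal ((cmod (f x))\<^sup>2)"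
    proof (cases "x \<in> {a..a + 1}")
      case True
      have "(x - a)\<^sup>2 \<le> 1" using True by (simp add: abs_square_le_1)
      then have "(x - a)\<^sup>2 / (2 * \<tau>) \<le> 1 / (2 * \<tau>)" using \<tau> by (intro divide_right_mono) auto
      then have e: "?e \<le> (exp (- ((x - a)\<^sup>2 / (4 * \<tau>))))\<^sup>2"
        by (simp add: power2_eq_square exp_add[symmetric])
      have "?e * (2 - 2 * cos (N * x)) \<le> (exp (- ((x - a)\<^sup>2 / (4 * \<tau>))))\<^sup>2 * (2 - 2 * cos (N * x))"
        using cos_le_one by (intro mult_right_mono e) auto
      also have "\<dots> = (cmod (cis (N * x) - 1) * exp (- ((x - a)\<^sup>2 / (4 * \<tau>))))\<^sup>2"
        by (simp add: power_mult_distrib sq)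
      also have "\<dots> \<le> (cmod (f x))\<^sup>2" by (intro power_mono ge) auto
      finally show ?thesis using True cos_le_one[of "N * x"] by (simp add: ennreal_leI flip: ennreal_mult)
    qed simp
  qed
  finally show ?thesis by simp
qed

text \<open>In the window of cells that carry the comb of order \<open>n\<close> the factor
  \<open>cis (N * x) - 1\<close> is small; outside it both centres are at distance at least
  \<open>n\<close>. Of the two Gaussian factors in the square one is spent on this, the other is
  kept for the summation over cells.\<close>

lemma interfering_on_layered_comb:
  fixes \<sigma> \<alpha> \<tau> a d N :: real and n :: nat
  assumes \<tau>: "0 < \<tau>" and \<sigma>: "0 < \<sigma>" and n: "0 < n" and N: "N = 2 * pi * real n / \<sigma>"
    and m: "\<And>k. 2 ^ n \<le> k \<Longrightarrow> k < 2 * 2 ^ n \<Longrightarrow> m k = n"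
    and a: "2 ^ n + real n \<le> a" "a + d + real n \<le> 2 * 2 ^ n" and d: "0 \<le> d"
    and x: "x \<in> layered_comb \<sigma> \<alpha> m"
  shows "(cmod (cis (N * x) - 1) * (exp (- ((x - a)\<^sup>2 / (4 * \<tau>))) + exp (- ((x - a - d)\<^sup>2 / (4 * \<tau>)))))\<^sup>2
    \<le> (2 * (N * tooth \<alpha> n)\<^sup>2 + 8 * exp (- ((real n)\<^sup>2 / (4 * \<tau>)))) *
      (exp (- ((x - a)\<^sup>2 / (4 * \<tau>))) + exp (- ((x - (a + d))\<^sup>2 / (4 * \<tau>))))"
proof -
  define D where "D = cmod (cis (N * x) - 1)"
  define g h where "g = exp (- ((x - a)\<^sup>2 / (4 * \<tau>)))" and "h = exp (- ((x - a - d)\<^sup>2 / (4 * \<tau>)))"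
  define e where "e = exp (- ((real n)\<^sup>2 / (4 * \<tau>)))"
  have gh: "0 < g" "g \<le> 1" "0 < h" "h \<le> 1" using \<tau> by (auto simp: g_def h_def)
  have D: "0 \<le> D" "D \<le> 2" unfolding D_def using norm_triangle_ineq4[of "cis (N * x)" 1] by auto
  have "D\<^sup>2 * (g + h) \<le> 2 * (N * tooth \<alpha> n)\<^sup>2 + 8 * e"
  proof (cases "2 ^ n \<le> x \<and> x < 2 * 2 ^ n")
    case True
    have "m \<lfloor>x\<rfloor> = n"
    proof (rule m)
      show "2 ^ n \<le> \<lfloor>x\<rfloor>" using True by (simp add: le_floor_iff)
      show "\<lfloor>x\<rfloor> < 2 * 2 ^ n" using True by (simp add: floor_less_iff)
    qed
    then obtain j :: int where j: "of_int j * \<sigma> / real n \<le> x" "x \<le> of_int j * \<sigma> / real n + tooth \<alpha> n"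
      using x by (auto simp: layered_comb_def comb_def)
    define r where "r = x - of_int j * \<sigma> / real n"
    have r: "0 \<le> r" "r \<le> tooth \<alpha> n" using j by (auto simp: r_def)
    have "N * x = N * r + 2 * pi * of_int j" using n \<sigma> by (simp add: N r_def field_simps)
    then have "cis (N * x) = cis (N * r) * cis (2 * pi * of_int j)" by (simp only: cis_mult)
    moreover have "cis (2 * pi * of_int j) = 1" by (rule cis_multiple_2pi) simp
    ultimately have "D \<le> \<bar>N * r\<bar>" using norm_cis_minus_1_le[of "N * r"] by (simp add: D_def)
    also have "\<dots> = N * r" using r n \<sigma> by (simp add: N abs_mult)
    also have "\<dots> \<le> N * tooth \<alpha> n" using n \<sigma> by (intro mult_left_mono r) (simp add: N)
    finally have "D\<^sup>2 \<le> (N * tooth \<alpha> n)\<^sup>2" using D by (intro power_mono) auto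
    then have "D\<^sup>2 * (g + h) \<le> (N * tooth \<alpha> n)\<^sup>2 * 2" using gh by (intro mult_mono) auto
    moreover have "0 \<le> e" by (simp add: e_def)
    ultimately show ?thesis by simp
  next
    case False
    have far: "real n \<le> \<bar>x - a\<bar>" "real n \<le> \<bar>x - a - d\<bar>" using False a d by auto
    have "exp (- (s\<^sup>2 / (4 * \<tau>))) \<le> e" if "real n \<le> \<bar>s\<bar>" for s
    proof -
      have "(real n)\<^sup>2 \<le> s\<^sup>2" using power_mono[OF that, of 2] by simp
      then show ?thesis unfolding e_def using \<tau> by (simp add: divide_right_mono)
    qed
    then have "g + h \<le> 2 * e" using far unfolding g_def h_def by (smt (verit))
    moreover have "D\<^sup>2 \<le> 2\<^sup>2" using D by (intro power_mono) auto
    ultimately have "D\<^sup>2 * (g + h) \<le> 2\<^sup>2 * (2 * e)" using gh by (intro mult_mono) auto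
    also have "2\<^sup>2 * (2 * e) = 8 * e" by simp
    finally show ?thesis by (rule order_trans) simp
  qed
  then have "D\<^sup>2 * (g + h) * (g + h) \<le> (2 * (N * tooth \<alpha> n)\<^sup>2 + 8 * e) * (g + h)"
    using gh by (intro mult_right_mono) auto
  then show ?thesis
    unfolding D_def[symmetric] g_def[symmetric] h_def[symmetric] e_def[symmetric] diff_diff_eq[symmetric]
    by (simp add: power_mult_distrib power2_eq_square[of "g + h"] mult.assoc)
qed

section \<open>Choice of parameters and failure of every constant\<close>

lemma tooth_tendsto:
  assumes \<alpha>: "0 < \<alpha>" "\<alpha> < 1"
  shows "tooth \<alpha> \<longlonglongrightarrow> 0" "(\<lambda>n. real n * tooth \<alpha> n) \<longlonglongrightarrow> 0"
proof -
  show "tooth \<alpha> \<longlonglongrightarrow> 0"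
    unfolding tooth_def[abs_def] using \<alpha> by (intro tendsto_neg_powr filterlim_real_sequentially) simp
  have "(\<lambda>n. real n powr (1 - 1 / \<alpha>)) \<longlonglongrightarrow> 0"
    using \<alpha> by (intro tendsto_neg_powr filterlim_real_sequentially) (simp add: field_simps)
  moreover have "\<forall>\<^sub>F n in sequentially. real n powr (1 - 1 / \<alpha>) = real n * tooth \<alpha> n"
    using eventually_gt_at_top[of 0]
    by eventually_elim (simp add: tooth_def powr_diff powr_minus divide_inverse)
  ultimately show "(\<lambda>n. real n * tooth \<alpha> n) \<longlonglongrightarrow> 0" by (rule Lim_transform_eventually)
qed

lemma thick_sets_without_observability:
  fixes S T \<alpha> :: real
  assumes ST: "S < T" and \<alpha>: "0 < \<alpha>" "\<alpha> < 1"
  shows "\<exists>E1 E2. thick \<alpha> E1 \<and> thick \<alpha> E2 \<and>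
    \<not> (\<exists>C>0. \<forall>u0 \<in> (\<Inter>k. sobolev k). observability_ineq S T E1 E2 C u0)"
proof -
  define \<tau> where "\<tau> = T - S"
  have \<tau>: "0 < \<tau>" using ST by (simp add: \<tau>_def)
  define \<sigma> where "\<sigma> = 2 * sqrt (pi * \<tau>)"
  have \<sigma>: "0 < \<sigma>" "\<sigma> * \<sigma> = 4 * pi * \<tau>" using \<tau> by (auto simp: \<sigma>_def)
  have "\<forall>\<^sub>F n in sequentially. 0 < n \<and> 8 * \<sigma> \<le> real n \<and> tooth \<alpha> n < 1 / 2 \<and> real n * tooth \<alpha> n < \<sigma>"
    using \<sigma>(1) by (intro eventually_conj eventually_gt_at_top order_tendstoD(2)[OF tooth_tendsto(1)[OF \<alpha>]]
        order_tendstoD(2)[OF tooth_tendsto(2)[OF \<alpha>]] eventually_compose_filterlim[OF eventually_ge_at_top filterlim_real_sequentially]) auto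
  then obtain n0 where n0: "\<And>n. n0 \<le> n \<Longrightarrow> 0 < n \<and> 8 * \<sigma> \<le> real n \<and> tooth \<alpha> n < 1 / 2 \<and> real n * tooth \<alpha> n < \<sigma>"
    unfolding eventually_sequentially by blast
  \<comment> \<open>Equal to \<open>n\<close> on the dyadic block of cells from 2^n up to 2^(n+1)
    when \<open>n \<ge> n0\<close>; the maximum secures the conditions on the combs in all other
    cells.\<close>
  define m where "m k = max n0 (floor_log (nat k))" for k :: int
  define E where "E = layered_comb \<sigma> \<alpha> m"
  have thick: "thick \<alpha> E"
    unfolding E_def using n0 by (intro thick_layered_comb \<alpha> \<sigma>) (auto simp: m_def)
  define N where "N n = 2 * pi * real n / \<sigma>" for n
  define B where "B n = 2 * (N n * tooth \<alpha> n)\<^sup>2 + 8 * exp (- ((real n)\<^sup>2 / (4 * \<tau>)))" for n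
  define M where "M = 2 * exp (1 / (4 * \<tau>)) * sqrt (8 * pi * \<tau>)"
  have B0: "0 \<le> B n" for n by (simp add: B_def)
  have M0: "0 \<le> M" using \<tau> by (simp add: M_def)
  have B_lim: "B \<longlonglongrightarrow> 0"
  proof -
    have "(\<lambda>n. 2 * pi / \<sigma> * (real n * tooth \<alpha> n)) \<longlonglongrightarrow> 2 * pi / \<sigma> * 0"
      by (intro tendsto_intros tooth_tendsto(2)[OF \<alpha>])
    then have 1: "(\<lambda>n. N n * tooth \<alpha> n) \<longlonglongrightarrow> 0" by (simp add: N_def mult_ac)
    have "filterlim (\<lambda>n. (1 / (4 * \<tau>)) * (real n)\<^sup>2) at_top sequentially"
      using \<tau> by (intro filterlim_tendsto_pos_mult_at_top[OF tendsto_const] filterlim_pow_at_top filterlim_real_sequentially) auto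
    then have "filterlim (\<lambda>n. - ((1 / (4 * \<tau>)) * (real n)\<^sup>2)) at_bot sequentially"
      unfolding filterlim_uminus_at_bot by simp
    then have "(\<lambda>n. exp (- ((1 / (4 * \<tau>)) * (real n)\<^sup>2))) \<longlonglongrightarrow> 0" by (rule filterlim_compose[OF exp_at_bot])
    then have 2: "(\<lambda>n. exp (- ((real n)\<^sup>2 / (4 * \<tau>)))) \<longlonglongrightarrow> 0" by simp
    have "(\<lambda>n. 2 * (N n * tooth \<alpha> n)\<^sup>2 + 8 * exp (- ((real n)\<^sup>2 / (4 * \<tau>)))) \<longlonglongrightarrow> 2 * 0\<^sup>2 + 8 * 0"
      by (intro tendsto_intros 1 2)
    then show ?thesis by (simp add: B_def[abs_def])
  qed
  have key: "exp (- (1 / (2 * \<tau>))) \<le> C * (2 * (B n * M))"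
    if C: "0 < C" and n2: "2 \<le> n" and obs: "\<forall>u0 \<in> (\<Inter>k. sobolev k). observability_ineq S T E E C u0"
      and n: "n0 \<le> n" "4 \<le> N n" "real n * (2 + \<sigma>) + \<sigma> \<le> 2 ^ n" for C n
  proof -
    have npos: "0 < n" using n0[OF n(1)] by simp
    define d where "d = real n * \<sigma>"
    have d0: "0 \<le> d" using \<sigma> by (simp add: d_def)
    \<comment> \<open>Rounding up to the lattice and adding half a spacing puts \<open>a\<close>
      just beyond \<open>2 ^ n + n\<close>, midway between two lattice points, so that
      \<open>N n * a\<close> is \<open>pi\<close> modulo \<open>2 * pi\<close>.\<close>
    define j where "j = \<lceil>(2 ^ n + real n) * real n / \<sigma>\<rceil>"
    define a where "a = \<sigma> / real n * (of_int j + 1 / 2)"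
    have j: "(2 ^ n + real n) * real n / \<sigma> \<le> of_int j" "of_int j < (2 ^ n + real n) * real n / \<sigma> + 1"
      unfolding j_def by linarith+
    have a1: "2 ^ n + real n \<le> a"
    proof -
      have "2 ^ n + real n = \<sigma> / real n * ((2 ^ n + real n) * real n / \<sigma>)" using \<sigma> npos by simp
      also have "\<dots> \<le> a" unfolding a_def using j \<sigma> by (intro mult_left_mono) auto
      finally show ?thesis .
    qed
    have a2: "a \<le> 2 ^ n + real n + 3 / 2 * (\<sigma> / real n)"
    proof -
      have "a \<le> \<sigma> / real n * ((2 ^ n + real n) * real n / \<sigma> + 3 / 2)"
        unfolding a_def using j \<sigma> by (intro mult_left_mono) auto
      also have "\<dots> = 2 ^ n + real n + 3 / 2 * (\<sigma> / real n)" using \<sigma> npos by (simp add: field_simps)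
      finally show ?thesis .
    qed
    have "3 / 2 * (\<sigma> / real n) \<le> \<sigma>"
    proof -
      have "\<sigma> / real n \<le> \<sigma> / 2" using \<sigma> n2 by (intro divide_left_mono) auto
      then show ?thesis using \<sigma> by simp
    qed
    \<comment> \<open>The block has room for two margins of length \<open>n\<close>, the separation
      \<open>n * \<sigma>\<close> and a rounding error of at most \<open>\<sigma>\<close>.\<close>
    then have a3: "a + d + real n \<le> 2 * 2 ^ n" using a2 n(3) by (simp add: d_def algebra_simps)
    have Nd: "N n * d = 2 * pi * of_int (int n * int n)" using \<sigma> npos by (simp add: N_def d_def)
    have dN: "d = 2 * \<tau> * N n" using \<sigma> by (simp add: N_def d_def field_simps)
    have Na: "N n * a = pi + 2 * pi * of_int j" using \<sigma> npos by (simp add: N_def a_def field_simps)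
    obtain f where f: "gaussian_sum f"
      "\<And>x. cmod (f x) = cmod (cis (N n * x) - 1) * (exp (- ((x - a)\<^sup>2 / (4 * \<tau>))) + exp (- ((x - a - d)\<^sup>2 / (4 * \<tau>))))"
      "\<And>y. cmod (ft (\<lambda>\<xi>. cis (- (\<tau> * \<xi>\<^sup>2)) * ft f \<xi>) (- y)) \<le> cmod (cis (N n * y) - 1) * (exp (- ((y - a)\<^sup>2 / (4 * \<tau>))) + exp (- ((y - a - d)\<^sup>2 / (4 * \<tau>))))"
      using ex_interfering_packets[OF \<tau> dN Nd Na] by blast
    obtain u0 where u0: "u0 \<in> (\<Inter>k. sobolev k)" "L2_norm_sq u0 = sqnorm f" "schrodinger_solution u0 S = f"
      "schrodinger_solution u0 T = (\<lambda>y. ft (\<lambda>\<xi>. cis (- (\<tau> * \<xi>\<^sup>2)) * ft f \<xi>) (- y))"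
      using ex_gaussian_sum_data[OF f(1), of S T] unfolding \<tau>_def by blast
    have mk: "m k = n" if "2 ^ n \<le> k" "k < 2 * 2 ^ n" for k :: int
    proof -
      have "int (2 ^ n) \<le> k" "k < int (2 * 2 ^ n)" using that by simp_all
      then have "2 ^ n \<le> nat k" "nat k < 2 * 2 ^ n" by (auto simp: le_nat_iff nat_less_iff)
      moreover from this(1) have "0 < nat k" by (rule less_le_trans[rotated]) simp
      ultimately have "floor_log (nat k) = n" by (intro floor_log_eqI)
      then show ?thesis using n(1) by (simp add: m_def)
    qed
    have on_E: "(cmod (cis (N n * x) - 1) * (exp (- ((x - a)\<^sup>2 / (4 * \<tau>))) + exp (- ((x - a - d)\<^sup>2 / (4 * \<tau>)))))\<^sup>2
        \<le> B n * (exp (- ((x - a)\<^sup>2 / (4 * \<tau>))) + exp (- ((x - (a + d))\<^sup>2 / (4 * \<tau>))))" if "x \<in> E" for x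
      unfolding B_def using that unfolding E_def
      by (intro interfering_on_layered_comb[OF \<tau> \<sigma>(1) npos N_def mk a1 a3 d0])
    have bS: "l2_norm_sq (local_sup E (schrodinger_solution u0 S)) \<le> ennreal (B n * M)"
      unfolding u0(3) M_def using on_E by (intro local_sup_gaussian_le[OF \<tau> B0]) (auto simp: f(2))
    have bT: "l2_norm_sq (local_sup E (schrodinger_solution u0 T)) \<le> ennreal (B n * M)"
      unfolding u0(4) M_def
    proof (rule local_sup_gaussian_le[OF \<tau> B0])
      fix y assume "y \<in> E"
      from order_trans[OF power_mono[OF f(3)[of y] norm_ge_zero] on_E[OF this]]
      show "(cmod (ft (\<lambda>\<xi>. cis (- (\<tau> * \<xi>\<^sup>2)) * ft f \<xi>) (- y)))\<^sup>2
        \<le> B n * (exp (- ((y - a)\<^sup>2 / (4 * \<tau>))) + exp (- ((y - (a + d))\<^sup>2 / (4 * \<tau>))))" .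
    qed
    have "ennreal (exp (- (1 / (2 * \<tau>)))) \<le> sqnorm f"
      by (rule sqnorm_interfering_ge[OF \<tau> n(2) f(1), of a]) (simp add: f(2) mult_left_mono)
    also have "\<dots> \<le> ennreal C * (l2_norm_sq (local_sup E (schrodinger_solution u0 S)) + l2_norm_sq (local_sup E (schrodinger_solution u0 T)))"
      using bspec[OF obs u0(1)] unfolding observability_ineq_def u0(2) .
    also have "\<dots> \<le> ennreal C * (ennreal (B n * M) + ennreal (B n * M))"
      by (intro mult_left_mono add_mono bS bT) auto
    also have "\<dots> = ennreal (C * (2 * (B n * M)))"
      using C B0[of n] M0 by (simp flip: ennreal_mult ennreal_plus)
    finally show ?thesis using C B0[of n] M0 by (subst (asm) ennreal_le_iff) auto
  qed
  have "\<not> (\<exists>C>0. \<forall>u0 \<in> (\<Inter>k. sobolev k). observability_ineq S T E E C u0)"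
  proof
    assume "\<exists>C>0. \<forall>u0 \<in> (\<Inter>k. sobolev k). observability_ineq S T E E C u0"
    then obtain C where C: "0 < C" "\<forall>u0 \<in> (\<Inter>k. sobolev k). observability_ineq S T E E C u0" by blast
    have "(\<lambda>n. C * (2 * (B n * M))) \<longlonglongrightarrow> C * (2 * (0 * M))" by (intro tendsto_intros B_lim)
    then have "\<forall>\<^sub>F n in sequentially. C * (2 * (B n * M)) < exp (- (1 / (2 * \<tau>)))"
      by (intro order_tendstoD) auto
    moreover have "\<forall>\<^sub>F n in sequentially. 4 \<le> N n"
    proof -
      have "filterlim (\<lambda>n. 2 * pi / \<sigma> * real n) at_top sequentially"
        using \<sigma> by (intro filterlim_tendsto_pos_mult_at_top[OF tendsto_const] filterlim_real_sequentially) auto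
      then show ?thesis by (simp add: filterlim_at_top N_def)
    qed
    moreover have "\<forall>\<^sub>F n in sequentially. real n * (2 + \<sigma>) + \<sigma> \<le> 2 ^ n"
    proof -
      have "(\<lambda>n. (2 + \<sigma>) * (real n * (1 / 2) ^ n) + \<sigma> * (1 / 2) ^ n) \<longlonglongrightarrow> (2 + \<sigma>) * 0 + \<sigma> * 0"
        by (intro tendsto_intros powser_times_n_limit_0 LIMSEQ_power_zero) auto
      then have "\<forall>\<^sub>F n in sequentially. (2 + \<sigma>) * (real n * (1 / 2) ^ n) + \<sigma> * (1 / 2) ^ n < 1"
        by (intro order_tendstoD) auto
      then show ?thesis
        by eventually_elim (simp add: power_one_over field_simps)
    qed
    ultimately have "\<forall>\<^sub>F n in sequentially. False"
      using eventually_ge_at_top[of n0] eventually_ge_at_top[of 2]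
    proof eventually_elim
      case (elim n)
      then show False using key[OF C(1) _ C(2), of n] by linarith
    qed
    then show False by simp
  qed
  then show ?thesis using thick by blast
qed

theorem theorem1p7:
  fixes S T :: real
  assumes "0 \<le> S" and "S < T"
  shows "(\<exists>\<epsilon> C. 0 < \<epsilon> \<and> \<epsilon> \<le> 1 \<and> 0 < C \<and>
            (\<forall>E1 E2. thin rho \<epsilon> (- E1) \<longrightarrow> thin rho \<epsilon> (- E2) \<longrightarrow>
               (\<forall>u0 \<in> (\<Inter>k. sobolev k). observability_ineq S T E1 E2 C u0)))
       \<and> (\<forall>\<alpha>. 0 < \<alpha> \<longrightarrow> \<alpha> < 1 \<longrightarrow>
            (\<exists>E1 E2. thick \<alpha> E1 \<and> thick \<alpha> E2 \<and>
               \<not> (\<exists>C>0. \<forall>u0 \<in> (\<Inter>k. sobolev k). observability_ineq S T E1 E2 C u0)))"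
  using observability_from_thin_sets[OF assms(2)] thick_sets_without_observability[OF assms(2)]
  by blast

end
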